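(* Let $\mathbb K$ be a field of characteristic zero and let $M$ be a Verma module over $Vir$ with central charge $\kappa\in\mathbb K$. Then the annihilator of $M$ in $U(Vir)$ is the ideal $(c-\kappa)$. As a result, for any $\kappa\in\mathbb K$ the algebra $U(Vir)/(c-\kappa)$ is primitive.
   Context: Let $\mathbb K$ be a field of characteristic zero. The Virasoro algebra $Vir$ is the Lie algebra over $\mathbb K$ with basis $\{e_n : n\in\mathbb Z\}\cup\{c\}$ and bracket $[e_i,e_j]=(j-i)e_{i+j}+\frac{i^3-i}{12}\delta_{i+j,0}\,c$, with $c$ central. $U(\cdot)$ denotes the universal enveloping algebra, and $(c-\kappa)$ the two-sided ideal of $U(Vir)$ generated by $c-\kappa$. Let $\mathfrak n_+$ be the span of $\{e_n : n\ge 1\}$, let $\mathfrak h$ be the span of $c,e_0$, and let $\mathfrak b_+=\mathfrak n_+\oplus\mathfrak h$. For $\kappa,\lambda\in\mathbb K$, let $\mathbb K_{\kappa,\lambda}$ be the one-dimensional representation of $\mathfrak b_+$ on which $\mathfrak n_+$ acts trivially, $c$ acts as $\kappa$ and $e_0$ acts as $\lambda$. The Verma module is $M_{\kappa,\lambda}=U(Vir)\otimes_{U(\mathfrak b_+)}\mathbb K_{\kappa,\lambda}$; its central charge is $\kappa$. A ring is primitive if it has a faithful simple left module. *)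

theory Defs
  imports HOL.Vector_Spaces "HOL-Algebra.QuotRing" "HOL-Algebra.Module" "HOL-Algebra.Free_Abelian_Groups"
begin

section \<open>Left modules over noncommutative rings\<close>

text \<open>The locale \<^locale>\<open>Module.module\<close> of HOL-Algebra is restricted to commutative rings.  We reuse its
  record type and its notion of submodule.  The fields \<open>mult\<close> and \<open>one\<close> of such a record
  play no role.\<close>

locale left_module = R?: ring R + M?: abelian_group M
    for R :: "('a, 'r) ring_scheme" (structure) and M :: "('a, 'b, 'm) module_scheme" (structure) +
  assumes smult_closed [simp, intro]:
      "\<lbrakk>a \<in> carrier R; x \<in> carrier M\<rbrakk> \<Longrightarrow> a \<odot>\<^bsub>M\<^esub> x \<in> carrier M"
    and smult_l_distr:
      "\<lbrakk>a \<in> carrier R; b \<in> carrier R; x \<in> carrier M\<rbrakk>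
        \<Longrightarrow> (a \<oplus>\<^bsub>R\<^esub> b) \<odot>\<^bsub>M\<^esub> x = a \<odot>\<^bsub>M\<^esub> x \<oplus>\<^bsub>M\<^esub> b \<odot>\<^bsub>M\<^esub> x"
    and smult_r_distr:
      "\<lbrakk>a \<in> carrier R; x \<in> carrier M; y \<in> carrier M\<rbrakk>
        \<Longrightarrow> a \<odot>\<^bsub>M\<^esub> (x \<oplus>\<^bsub>M\<^esub> y) = a \<odot>\<^bsub>M\<^esub> x \<oplus>\<^bsub>M\<^esub> a \<odot>\<^bsub>M\<^esub> y"
    and smult_assoc:
      "\<lbrakk>a \<in> carrier R; b \<in> carrier R; x \<in> carrier M\<rbrakk>
        \<Longrightarrow> (a \<otimes>\<^bsub>R\<^esub> b) \<odot>\<^bsub>M\<^esub> x = a \<odot>\<^bsub>M\<^esub> (b \<odot>\<^bsub>M\<^esub> x)"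
    and smult_one [simp]: "x \<in> carrier M \<Longrightarrow> \<one>\<^bsub>R\<^esub> \<odot>\<^bsub>M\<^esub> x = x"

definition annihilator :: "('a, 'r) ring_scheme \<Rightarrow> ('a, 'b, 'm) module_scheme \<Rightarrow> 'a set" where
  "annihilator R M = {a \<in> carrier R. \<forall>x \<in> carrier M. a \<odot>\<^bsub>M\<^esub> x = \<zero>\<^bsub>M\<^esub>}"

definition simple_left_module :: "('a, 'r) ring_scheme \<Rightarrow> ('a, 'b, 'm) module_scheme \<Rightarrow> bool" where
  "simple_left_module R M \<longleftrightarrow> left_module R M \<and> carrier M \<noteq> {\<zero>\<^bsub>M\<^esub>} \<and>
     (\<forall>N. submodule N R M \<longrightarrow> N = {\<zero>\<^bsub>M\<^esub>} \<or> N = carrier M)"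

definition faithful_left_module :: "('a, 'r) ring_scheme \<Rightarrow> ('a, 'b, 'm) module_scheme \<Rightarrow> bool" where
  "faithful_left_module R M \<longleftrightarrow> left_module R M \<and> annihilator R M = {\<zero>\<^bsub>R\<^esub>}"

text \<open>HOL cannot quantify over types, so the module ranges over one fixed type, that of sets of ring
  elements.  This is no restriction: a simple module is isomorphic to the quotient of \<open>R\<close> by
  the annihilator of any nonzero element, whose elements are cosets.  See \<open>primitive_ringI\<close>.\<close>

definition primitive_ring :: "('a, 'r) ring_scheme \<Rightarrow> bool" where
  "primitive_ring R \<longleftrightarrow>
     (\<exists>M :: ('a, 'a set) module. simple_left_module R M \<and> faithful_left_module R M)"

lemma (in left_module) smult_r_null [simp]: "a \<in> carrier R \<Longrightarrow> a \<odot>\<^bsub>M\<^esub> \<zero>\<^bsub>M\<^esub> = \<zero>\<^bsub>M\<^esub>"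
  using smult_r_distr[of a "\<zero>\<^bsub>M\<^esub>" "\<zero>\<^bsub>M\<^esub>"] M.add.l_cancel_one' by force

lemma (in left_module) smult_l_null [simp]: "x \<in> carrier M \<Longrightarrow> \<zero>\<^bsub>R\<^esub> \<odot>\<^bsub>M\<^esub> x = \<zero>\<^bsub>M\<^esub>"
  using smult_l_distr[of "\<zero>\<^bsub>R\<^esub>" "\<zero>\<^bsub>R\<^esub>" x] M.add.l_cancel_one' by force

lemma (in left_module) smult_l_minus:
  assumes "a \<in> carrier R" "x \<in> carrier M"
  shows "(\<ominus>\<^bsub>R\<^esub> a) \<odot>\<^bsub>M\<^esub> x = \<ominus>\<^bsub>M\<^esub> (a \<odot>\<^bsub>M\<^esub> x)"
  using assms smult_l_distr[of "\<ominus>\<^bsub>R\<^esub> a" a x] M.minus_equality[of "(\<ominus>\<^bsub>R\<^esub> a) \<odot>\<^bsub>M\<^esub> x" "a \<odot>\<^bsub>M\<^esub> x"]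
  by (simp add: R.l_neg)

lemma (in left_module) smult_r_minus:
  assumes "a \<in> carrier R" "x \<in> carrier M"
  shows "a \<odot>\<^bsub>M\<^esub> (\<ominus>\<^bsub>M\<^esub> x) = \<ominus>\<^bsub>M\<^esub> (a \<odot>\<^bsub>M\<^esub> x)"
  using assms smult_r_distr[of a "\<ominus>\<^bsub>M\<^esub> x" x] M.minus_equality[of "a \<odot>\<^bsub>M\<^esub> (\<ominus>\<^bsub>M\<^esub> x)" "a \<odot>\<^bsub>M\<^esub> x"]
  by (simp add: M.l_neg)

lemma (in left_module) submodule_iff:
  "submodule N R M \<longleftrightarrow> N \<subseteq> carrier M \<and> \<zero>\<^bsub>M\<^esub> \<in> N \<and> (\<forall>x\<in>N. \<forall>y\<in>N. x \<oplus>\<^bsub>M\<^esub> y \<in> N) \<and>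
     (\<forall>a\<in>carrier R. \<forall>x\<in>N. a \<odot>\<^bsub>M\<^esub> x \<in> N)" (is "_ \<longleftrightarrow> ?rhs")
proof
  assume "submodule N R M"
  then show ?rhs
    by (auto simp: submodule_def submodule_axioms_def subgroup_def)
next
  assume N: ?rhs
  have "\<ominus>\<^bsub>M\<^esub> x \<in> N" if "x \<in> N" for x
    using N that smult_l_minus[of "\<one>\<^bsub>R\<^esub>" x] by (metis R.a_inv_closed R.one_closed smult_one subsetD)
  with N show "submodule N R M"
    by (auto simp: submodule_def submodule_axioms_def subgroup_def a_inv_def)
qed

lemma left_module_transfer:
  fixes M :: "('a, 'b, 'm) module_scheme" and f :: "'b \<Rightarrow> 'c"
  assumes M: "left_module R M" and inj: "inj_on f (carrier M)"
  defines "g \<equiv> inv_into (carrier M) f"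
  defines "M' \<equiv> \<lparr>carrier = f ` carrier M, monoid.mult = undefined, one = undefined,
    ring.zero = f \<zero>\<^bsub>M\<^esub>, add = (\<lambda>x y. f (g x \<oplus>\<^bsub>M\<^esub> g y)), smult = (\<lambda>a x. f (a \<odot>\<^bsub>M\<^esub> g x))\<rparr>"
  shows "left_module R M'" and "annihilator R M' = annihilator R M"
    and "simple_left_module R M \<Longrightarrow> simple_left_module R M'"
proof -
  interpret left_module R M by (rule M)
  have g [simp]: "g (f x) = x" if "x \<in> carrier M" for x
    unfolding g_def using inj that by (rule inv_into_f_f)
  have f_eq: "f x = f y \<longleftrightarrow> x = y" if "x \<in> carrier M" "y \<in> carrier M" for x y
    using inj that by (auto dest: inj_onD)
  have "abelian_group M'"
  proof (rule abelian_groupI)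
    fix x assume "x \<in> carrier M'"
    then obtain u where u: "u \<in> carrier M" "x = f u" by (auto simp: M'_def)
    then show "\<exists>y\<in>carrier M'. y \<oplus>\<^bsub>M'\<^esub> x = \<zero>\<^bsub>M'\<^esub>"
      by (intro bexI[of _ "f (\<ominus>\<^bsub>M\<^esub> u)"]) (auto simp: M'_def M.l_neg)
  qed (auto simp: M'_def M.add.m_ac)
  then show M': "left_module R M'"
    by (intro left_module.intro left_module_axioms.intro R.ring_axioms)
       (auto simp: M'_def smult_l_distr smult_r_distr smult_assoc)
  show "annihilator R M' = annihilator R M"
    by (auto simp: annihilator_def M'_def f_eq)
  assume simple: "simple_left_module R M"
  show "simple_left_module R M'"
    unfolding simple_left_module_def
  proof (intro conjI allI impI M')
    show "carrier M' \<noteq> {\<zero>\<^bsub>M'\<^esub>}"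
      using simple f_eq M.zero_closed unfolding simple_left_module_def M'_def by fastforce
    fix N assume "submodule N R M'"
    then have N: "N \<subseteq> f ` carrier M" "f \<zero>\<^bsub>M\<^esub> \<in> N" "\<And>x y. x \<in> N \<Longrightarrow> y \<in> N \<Longrightarrow> f (g x \<oplus>\<^bsub>M\<^esub> g y) \<in> N"
      "\<And>a x. a \<in> carrier R \<Longrightarrow> x \<in> N \<Longrightarrow> f (a \<odot>\<^bsub>M\<^esub> g x) \<in> N"
      unfolding left_module.submodule_iff[OF M'] by (auto simp: M'_def)
    have gf: "x \<in> carrier M \<Longrightarrow> f x \<in> N \<Longrightarrow> x \<in> g ` N" for x
      by (metis g image_eqI)
    have "submodule (g ` N) R M"
      unfolding submodule_iff
    proof (intro conjI ballI)
      show "g ` N \<subseteq> carrier M" using N(1) by fastforce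
      show "\<zero>\<^bsub>M\<^esub> \<in> g ` N" by (intro gf N(2)) simp
      show "u \<oplus>\<^bsub>M\<^esub> v \<in> g ` N" if "u \<in> g ` N" "v \<in> g ` N" for u v
        using that \<open>g ` N \<subseteq> carrier M\<close> by (blast intro: gf N(3) M.a_closed)
      show "a \<odot>\<^bsub>M\<^esub> u \<in> g ` N" if "a \<in> carrier R" "u \<in> g ` N" for a u
        using that \<open>g ` N \<subseteq> carrier M\<close> by (blast intro: gf N(4) smult_closed)
    qed
    then consider "g ` N = {\<zero>\<^bsub>M\<^esub>}" | "g ` N = carrier M"
      using simple unfolding simple_left_module_def by blast
    moreover have "N = f ` g ` N"
    proof -
      have "f (g y) = y" if "y \<in> N" for y using N(1) that by fastforce
      then show ?thesis by (simp add: image_image)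
    qed
    ultimately show "N = {\<zero>\<^bsub>M'\<^esub>} \<or> N = carrier M'"
      by cases (auto simp: M'_def)
  qed
qed

lemma primitive_ringI:
  fixes M :: "('a, 'b, 'm) module_scheme"
  assumes simple: "simple_left_module R M" and faithful: "faithful_left_module R M"
  shows "primitive_ring R"
proof -
  interpret left_module R M using simple by (simp add: simple_left_module_def)
  obtain x where x: "x \<in> carrier M" "x \<noteq> \<zero>\<^bsub>M\<^esub>"
    using simple M.zero_closed unfolding simple_left_module_def by blast
  let ?N = "(\<lambda>a. a \<odot>\<^bsub>M\<^esub> x) ` carrier R"
  have "submodule ?N R M"
    unfolding submodule_iff using x
    by (auto simp: smult_l_distr[symmetric] smult_assoc[symmetric] intro: image_eqI[of _ _ "\<zero>\<^bsub>R\<^esub>"])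
  moreover have "x \<in> ?N" using x by (auto intro: image_eqI[of _ _ "\<one>\<^bsub>R\<^esub>"])
  ultimately have N: "?N = carrier M"
    using simple x(2) unfolding simple_left_module_def by blast
  have "inj_on (\<lambda>y. {a \<in> carrier R. a \<odot>\<^bsub>M\<^esub> x = y}) (carrier M)"
  proof (rule inj_onI)
    fix y z
    assume "y \<in> carrier M" and eq: "{a \<in> carrier R. a \<odot>\<^bsub>M\<^esub> x = y} = {a \<in> carrier R. a \<odot>\<^bsub>M\<^esub> x = z}"
    then obtain a where "a \<in> carrier R" "a \<odot>\<^bsub>M\<^esub> x = y" unfolding N[symmetric] by blast
    then show "y = z" using eq by blast
  qed
  note tr = left_module_transfer[OF left_module_axioms this]
  show ?thesis
    unfolding primitive_ring_def
    by (rule exI, rule conjI[OF tr(3)[OF simple]])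
       (use faithful tr(1,2) in \<open>simp only: faithful_left_module_def\<close>)
qed


section \<open>Extension of scalars\<close>

text \<open>\<open>S \<otimes>\<^sub>R N\<close> for a ring homomorphism \<open>j\<close> from \<open>R\<close> to \<open>S\<close> and a left \<open>R\<close>-module
  \<open>N\<close>: the free abelian group on pairs modulo the relations of a balanced tensor product, where
  \<open>S\<close> is a right \<open>R\<close>-module via \<open>j\<close>.\<close>

definition tensor_relations ::
    "('a \<Rightarrow> 's) \<Rightarrow> ('a, 'r) ring_scheme \<Rightarrow> ('s, 't) ring_scheme \<Rightarrow> ('a, 'n, 'm) module_scheme
      \<Rightarrow> ('s \<times> 'n \<Rightarrow>\<^sub>0 int) set" where
  "tensor_relations j R S N =
     {frag_of (s \<oplus>\<^bsub>S\<^esub> s', n) - frag_of (s, n) - frag_of (s', n) | s s' n.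
        s \<in> carrier S \<and> s' \<in> carrier S \<and> n \<in> carrier N} \<union>
     {frag_of (s, n \<oplus>\<^bsub>N\<^esub> n') - frag_of (s, n) - frag_of (s, n') | s n n'.
        s \<in> carrier S \<and> n \<in> carrier N \<and> n' \<in> carrier N} \<union>
     {frag_of (s \<otimes>\<^bsub>S\<^esub> j r, n) - frag_of (s, r \<odot>\<^bsub>N\<^esub> n) | s r n.
        s \<in> carrier S \<and> r \<in> carrier R \<and> n \<in> carrier N}"

definition tensor_kernel ::
    "('a \<Rightarrow> 's) \<Rightarrow> ('a, 'r) ring_scheme \<Rightarrow> ('s, 't) ring_scheme \<Rightarrow> ('a, 'n, 'm) module_scheme
      \<Rightarrow> ('s \<times> 'n \<Rightarrow>\<^sub>0 int) set" where
  "tensor_kernel j R S N =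
     generate (free_Abelian_group (carrier S \<times> carrier N)) (tensor_relations j R S N)"

text \<open>An element \<open>s\<close> of \<open>S\<close> acts by \<open>s' \<otimes> n \<mapsto> (s s') \<otimes> n\<close>.  Adding the kernel to the image of a
  coset under this additive map yields the full coset of the result.\<close>

definition extend_scalars ::
    "('a \<Rightarrow> 's) \<Rightarrow> ('a, 'r) ring_scheme \<Rightarrow> ('s, 't) ring_scheme \<Rightarrow> ('a, 'n, 'm) module_scheme
      \<Rightarrow> ('s, ('s \<times> 'n \<Rightarrow>\<^sub>0 int) set) module" where
  "extend_scalars j R S N =
    (let F = free_Abelian_group (carrier S \<times> carrier N);
         K = tensor_kernel j R S N;
         T = F Mod K
     in \<lparr>carrier = carrier T, monoid.mult = undefined, one = undefined,
         ring.zero = \<one>\<^bsub>T\<^esub>, add = monoid.mult T,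
         smult = (\<lambda>s A. K <#>\<^bsub>F\<^esub> frag_extend (\<lambda>(s', n). frag_of (s \<otimes>\<^bsub>S\<^esub> s', n)) ` A)\<rparr>)"


section \<open>Free associative algebras\<close>

text \<open>Words form the free monoid under concatenation, so that \<open>'v list \<Rightarrow>\<^sub>0 'k\<close>, with the
  convolution product of \<^theory>\<open>HOL-Library.Poly_Mapping\<close>, is the free associative
  \<open>'k\<close>-algebra on \<open>'v\<close>.\<close>

instantiation list :: (type) monoid_add
begin
definition zero_list :: "'a list" where "zero_list = []"
definition plus_list :: "'a list \<Rightarrow> 'a list \<Rightarrow> 'a list" where "plus_list = (@)"
instance by standard (auto simp: zero_list_def plus_list_def)
end

definition free_algebra :: "'v set \<Rightarrow> ('v list \<Rightarrow>\<^sub>0 'k::field) ring" where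
  "free_algebra A = \<lparr>carrier = {p. Poly_Mapping.keys p \<subseteq> lists A}, monoid.mult = (*), one = 1, ring.zero = 0, add = (+)\<rparr>"

abbreviation letter :: "'v \<Rightarrow> 'v list \<Rightarrow>\<^sub>0 'k::field" where
  "letter x \<equiv> Poly_Mapping.single [x] 1"

abbreviation const :: "'k::field \<Rightarrow> 'v list \<Rightarrow>\<^sub>0 'k" where
  "const a \<equiv> Poly_Mapping.single [] a"


section \<open>Universal enveloping algebras\<close>

locale lie_algebra = vector_space scale
  for scale :: "'k::field \<Rightarrow> 'v::ab_group_add \<Rightarrow> 'v" (infixr \<open>*s\<close> 75) +
  fixes bracket :: "'v \<Rightarrow> 'v \<Rightarrow> 'v"
  assumes bracket_add_left: "bracket (x + y) z = bracket x z + bracket y z"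
    and bracket_add_right: "bracket x (y + z) = bracket x y + bracket x z"
    and bracket_scale_left: "bracket (a *s x) y = a *s bracket x y"
    and bracket_scale_right: "bracket x (a *s y) = a *s bracket x y"
    and bracket_self: "bracket x x = 0"
    and jacobi: "bracket x (bracket y z) + bracket y (bracket z x) + bracket z (bracket x y) = 0"
begin

definition lie_subalgebra :: "'v set \<Rightarrow> bool" where
  "lie_subalgebra L \<longleftrightarrow> subspace L \<and> (\<forall>x\<in>L. \<forall>y\<in>L. bracket x y \<in> L)"

text \<open>The first two families of relations cut the free algebra on the set \<open>L\<close> down to the tensor
  algebra of the vector space \<open>L\<close>.\<close>

definition uea_relations :: "'v set \<Rightarrow> ('v list \<Rightarrow>\<^sub>0 'k) set" where
  "uea_relations L =
     {letter (x + y) - letter x - letter y | x y. x \<in> L \<and> y \<in> L} \<union>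
     {letter (a *s x) - const a * letter x | a x. x \<in> L} \<union>
     {letter x * letter y - letter y * letter x - letter (bracket x y) | x y. x \<in> L \<and> y \<in> L}"

definition uea_ideal :: "'v set \<Rightarrow> ('v list \<Rightarrow>\<^sub>0 'k) set" where
  "uea_ideal L = Idl\<^bsub>free_algebra L\<^esub> (uea_relations L)"

definition uea :: "'v set \<Rightarrow> ('v list \<Rightarrow>\<^sub>0 'k) set ring" where
  "uea L = free_algebra L Quot uea_ideal L"

definition uea_in :: "'v set \<Rightarrow> 'v \<Rightarrow> ('v list \<Rightarrow>\<^sub>0 'k) set" where
  "uea_in L x = uea_ideal L +>\<^bsub>free_algebra L\<^esub> letter x"

definition uea_const :: "'v set \<Rightarrow> 'k \<Rightarrow> ('v list \<Rightarrow>\<^sub>0 'k) set" where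
  "uea_const L a = uea_ideal L +>\<^bsub>free_algebra L\<^esub> const a"

text \<open>The homomorphism into the enveloping algebra of \<open>L\<close> induced by the inclusion of a Lie
  subalgebra: it enlarges a coset of the smaller ideal to the coset of \<open>uea_ideal L\<close> containing it.\<close>

definition uea_map :: "'v set \<Rightarrow> ('v list \<Rightarrow>\<^sub>0 'k) set \<Rightarrow> ('v list \<Rightarrow>\<^sub>0 'k) set" where
  "uea_map L A = uea_ideal L <+>\<^bsub>free_algebra L\<^esub> A"

end

text \<open>The module over an enveloping algebra given by a representation \<open>\<rho>\<close> of the Lie algebra on a
  vector space with scalar multiplication \<open>sc\<close>: a word \<open>x\<^sub>1 \<dots> x\<^sub>n\<close> acts as \<open>\<rho> x\<^sub>1 \<circ> \<dots> \<circ> \<rho> x\<^sub>n\<close>.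
  If \<open>\<rho>\<close> is a representation then all elements of a coset act alike.\<close>

definition free_act ::
    "('k::field \<Rightarrow> 'w::ab_group_add \<Rightarrow> 'w) \<Rightarrow> ('v \<Rightarrow> 'w \<Rightarrow> 'w) \<Rightarrow> ('v list \<Rightarrow>\<^sub>0 'k) \<Rightarrow> 'w \<Rightarrow> 'w" where
  "free_act sc \<rho> p u = (\<Sum>w \<in> Poly_Mapping.keys p. sc (Poly_Mapping.lookup p w) (foldr \<rho> w u))"

definition rep_module ::
    "('k::field \<Rightarrow> 'w::ab_group_add \<Rightarrow> 'w) \<Rightarrow> ('v \<Rightarrow> 'w \<Rightarrow> 'w) \<Rightarrow> (('v list \<Rightarrow>\<^sub>0 'k) set, 'w) module" where
  "rep_module sc \<rho> = \<lparr>carrier = UNIV, monoid.mult = undefined, one = undefined, ring.zero = 0, add = (+),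
     smult = (\<lambda>A u. the_elem ((\<lambda>p. free_act sc \<rho> p u) ` A))\<rparr>"


section \<open>The Virasoro algebra\<close>

datatype vir_basis = E int | C

type_synonym 'k vir = "vir_basis \<Rightarrow>\<^sub>0 'k"

definition vir_scale :: "'k::field_char_0 \<Rightarrow> 'k vir \<Rightarrow> 'k vir" where
  "vir_scale a x = Poly_Mapping.map ((*) a) x"

abbreviation vir_e :: "int \<Rightarrow> 'k::field_char_0 vir" where
  "vir_e n \<equiv> Poly_Mapping.single (E n) 1"

abbreviation vir_c :: "'k::field_char_0 vir" where
  "vir_c \<equiv> Poly_Mapping.single C 1"

fun vir_basis_bracket :: "vir_basis \<Rightarrow> vir_basis \<Rightarrow> 'k::field_char_0 vir" where
  "vir_basis_bracket (E i) (E j) =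
     vir_scale (of_int (j - i)) (vir_e (i + j)) +
     (if i + j = 0 then vir_scale (of_int (i ^ 3 - i) / 12) vir_c else 0)"
| "vir_basis_bracket _ _ = 0"

definition vir_linear_extension :: "(vir_basis \<Rightarrow> 'k::field_char_0 vir) \<Rightarrow> 'k vir \<Rightarrow> 'k vir" where
  "vir_linear_extension f x = (\<Sum>b \<in> Poly_Mapping.keys x. vir_scale (Poly_Mapping.lookup x b) (f b))"

definition vir_bracket :: "'k::field_char_0 vir \<Rightarrow> 'k vir \<Rightarrow> 'k vir" where
  "vir_bracket x y =
     vir_linear_extension (\<lambda>a. vir_linear_extension (\<lambda>b. vir_basis_bracket a b) y) x"

lemma lookup_vir_scale [simp]:
  "Poly_Mapping.lookup (vir_scale a x) b = a * Poly_Mapping.lookup x b"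
  by (simp add: vir_scale_def Poly_Mapping.map.rep_eq when_def)

global_interpretation vir_vs: vector_space "vir_scale :: 'k::field_char_0 \<Rightarrow> 'k vir \<Rightarrow> 'k vir"
  by standard (auto intro!: poly_mapping_eqI simp: lookup_add algebra_simps)

lemma vir_scale_single: "vir_scale a (Poly_Mapping.single b c) = Poly_Mapping.single b (a * c)"
  by (auto intro!: poly_mapping_eqI simp: lookup_single when_def)

lemma vir_induct [case_names basis scale add]:
  assumes "\<And>b. P (Poly_Mapping.single b 1)" "\<And>a x. P x \<Longrightarrow> P (vir_scale a x)"
    and "\<And>x y. P x \<Longrightarrow> P y \<Longrightarrow> P (x + y)"
  shows "P (x :: 'k::field_char_0 vir)"
proof -
  have single: "P (Poly_Mapping.single b a)" for b a
    using assms(2)[OF assms(1), of a b] by (simp add: vir_scale_single)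
  have "P (\<Sum>b\<in>A. Poly_Mapping.single b (Poly_Mapping.lookup x b))" if "finite A" for A
    using that by induction (use single[of undefined 0] in \<open>auto intro: assms(3) single\<close>)
  moreover have "(\<Sum>b\<in>Poly_Mapping.keys x. Poly_Mapping.single b (Poly_Mapping.lookup x b)) = x"
    by (rule poly_mapping_eqI) (simp add: lookup_sum lookup_single when_def in_keys_iff)
  ultimately show ?thesis by (metis finite_keys)
qed

lemma vir_linear_extension_add:
  "vir_linear_extension f (x + y) = vir_linear_extension f x + vir_linear_extension f y"
  unfolding vir_linear_extension_def
  by (rule setsum_keys_plus_distrib) (simp_all add: vir_vs.scale_left_distrib)

lemma vir_linear_extension_single:
  "vir_linear_extension f (Poly_Mapping.single b a) = vir_scale a (f b)"
  by (simp add: vir_linear_extension_def)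

lemma vir_linear_extension_scale:
  "vir_linear_extension f (vir_scale a x) = vir_scale a (vir_linear_extension f x)"
proof (cases "a = 0")
  case False
  then have "Poly_Mapping.keys (vir_scale a x) = Poly_Mapping.keys x"
    by (auto simp: in_keys_iff)
  then show ?thesis
    by (simp add: vir_linear_extension_def vir_vs.scale_sum_right)
qed (simp add: vir_linear_extension_def)

lemma vir_bracket_add_left: "vir_bracket (x + y) z = vir_bracket x z + vir_bracket y z"
  by (simp add: vir_bracket_def vir_linear_extension_add)

lemma vir_bracket_add_right: "vir_bracket x (y + z) = vir_bracket x y + vir_bracket x z"
  by (simp add: vir_bracket_def vir_linear_extension_add)
     (simp add: vir_linear_extension_def vir_vs.scale_right_distrib sum.distrib)

lemma vir_bracket_scale_left: "vir_bracket (vir_scale a x) y = vir_scale a (vir_bracket x y)"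
  by (simp add: vir_bracket_def vir_linear_extension_scale)

lemma vir_bracket_scale_right: "vir_bracket x (vir_scale a y) = vir_scale a (vir_bracket x y)"
  by (simp add: vir_bracket_def vir_linear_extension_scale)
     (simp add: vir_linear_extension_def vir_vs.scale_sum_right mult_ac)

lemma vir_bracket_basis:
  "vir_bracket (Poly_Mapping.single a 1) (Poly_Mapping.single b 1) = vir_basis_bracket a b"
  by (simp add: vir_bracket_def vir_linear_extension_single)

lemmas vir_bracket_bilinear =
  vir_bracket_add_left vir_bracket_add_right vir_bracket_scale_left vir_bracket_scale_right

lemma vir_bracket_zero [simp]: "vir_bracket x 0 = 0" "vir_bracket 0 x = 0"
  using vir_bracket_scale_right[of x 0 0] vir_bracket_scale_left[of 0 0 x] by simp_all

lemma vir_bracket_antisym: "vir_bracket x y = - vir_bracket y x"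
  for x y :: "'k::field_char_0 vir"
proof -
  have anti: "vir_basis_bracket a b = - (vir_basis_bracket b a :: 'k vir)" for a b
  proof (cases "\<exists>i. a = E i \<and> b = E (- i)")
    case False
    then show ?thesis
      by (cases a; cases b)
         (auto intro!: poly_mapping_eqI simp: lookup_single when_def algebra_simps
           eq_neg_iff_add_eq_0)
  qed (auto intro!: poly_mapping_eqI
         simp: lookup_add lookup_minus lookup_uminus lookup_single when_def field_simps)
  have base: "vir_bracket (Poly_Mapping.single a 1) (Poly_Mapping.single b 1) =
      - (vir_bracket (Poly_Mapping.single b 1) (Poly_Mapping.single a 1) :: 'k vir)" for a b
    unfolding vir_bracket_basis by (rule anti)
  show ?thesis
  proof (induction x rule: vir_induct)
    case (basis a)
    show ?case
      by (induction y rule: vir_induct) (rule base, simp_all add: vir_bracket_bilinear)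
  qed (simp_all add: vir_bracket_bilinear)
qed

lemma vir_jacobi:
  "vir_bracket x (vir_bracket y z) + vir_bracket y (vir_bracket z x) + vir_bracket z (vir_bracket x y) = 0"
  for x y z :: "'k::field_char_0 vir"
proof -
  let ?J = "\<lambda>x y z :: 'k vir.
    vir_bracket x (vir_bracket y z) + vir_bracket y (vir_bracket z x) + vir_bracket z (vir_bracket x y)"
  let ?s = "\<lambda>b. Poly_Mapping.single b 1 :: 'k vir"
  have add: "?J (x + x') y z = ?J x y z + ?J x' y z" for x x' y z
    by (simp add: vir_bracket_bilinear)
  have scale: "?J (vir_scale a x) y z = vir_scale a (?J x y z)" for a x y z
    by (simp add: vir_bracket_bilinear vir_vs.scale_right_distrib)
  have rot: "?J x y z = ?J y z x" for x y z by (simp add: ac_simps)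
  have e: "vir_bracket (?s (E i)) (vir_bracket (?s (E j)) (?s (E k))) =
      vir_scale (of_int ((k - j) * (j + k - i))) (?s (E (i + j + k))) +
      (if i + j + k = 0 then vir_scale (of_int ((k - j) * (i ^ 3 - i)) / 12) (?s C) else 0)" for i j k
    by (simp add: vir_bracket_basis vir_bracket_bilinear)
       (auto intro!: poly_mapping_eqI simp: lookup_add lookup_minus lookup_single when_def algebra_simps)
  have basis: "?J (?s a) (?s b) (?s c) = 0" for a b c
  proof (cases "\<exists>i j k. a = E i \<and> b = E j \<and> c = E k")
    case True
    then obtain i j k where abc: "a = E i" "b = E j" "c = E k" by blast
    have perm: "j + k + i = i + j + k" "k + i + j = i + j + k" by simp_all
    show ?thesis
    proof (cases "i + j + k = 0")
      case True
      then have k: "k = - i - j" by simp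
      show ?thesis unfolding abc e perm k
        by (rule poly_mapping_eqI)
           (simp add: lookup_add lookup_single when_def power3_eq_cube field_simps)
    next
      case False
      then show ?thesis unfolding abc e perm
        by (auto intro!: poly_mapping_eqI simp: lookup_add lookup_single when_def algebra_simps)
    qed
  next
    case False
    then show ?thesis
      by (cases a; cases b; cases c) (auto simp: vir_bracket_basis vir_bracket_bilinear)
  qed
  have 1: "?J x (?s b) (?s c) = 0" for x b c
    by (induction x rule: vir_induct) (simp_all only: basis add scale add_0_left vir_vs.scale_zero_right)
  have 2: "?J y (?s c) x = 0" for x y c
  proof (induction y rule: vir_induct)
    case (basis b)
    show ?case by (rule trans[OF rot[symmetric] 1])
  qed (simp_all only: add scale add_0_left vir_vs.scale_zero_right)
  show ?thesis
  proof (induction x rule: vir_induct)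
    case (basis a)
    show ?case by (rule trans[OF rot[symmetric] 2])
  qed (simp_all only: add scale add_0_left vir_vs.scale_zero_right)
qed

global_interpretation vir: lie_algebra "vir_scale :: 'k::field_char_0 \<Rightarrow> 'k vir \<Rightarrow> 'k vir" vir_bracket
proof
  show "vir_bracket x x = 0" for x :: "'k vir"
  proof (rule poly_mapping_eqI)
    fix b
    have "Poly_Mapping.lookup (vir_bracket x x) b = - Poly_Mapping.lookup (vir_bracket x x) b"
      by (metis lookup_uminus vir_bracket_antisym)
    then have "2 * Poly_Mapping.lookup (vir_bracket x x) b = 0"
      unfolding mult_2 eq_neg_iff_add_eq_0 .
    then show "Poly_Mapping.lookup (vir_bracket x x) b = Poly_Mapping.lookup 0 b"
      by simp
  qed
qed (rule vir_bracket_bilinear vir_jacobi)+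

definition vir_n_plus :: "'k::field_char_0 vir set" where
  "vir_n_plus = vir_vs.span (vir_e ` {1..})"

definition vir_h :: "'k::field_char_0 vir set" where
  "vir_h = vir_vs.span {vir_c, vir_e 0}"

definition vir_b_plus :: "'k::field_char_0 vir set" where
  "vir_b_plus = {x + y | x y. x \<in> vir_n_plus \<and> y \<in> vir_h}"

abbreviation U_vir :: "('k::field_char_0 vir list \<Rightarrow>\<^sub>0 'k) set ring" where
  "U_vir \<equiv> vir.uea UNIV"

definition c_minus_ideal :: "'k::field_char_0 \<Rightarrow> ('k vir list \<Rightarrow>\<^sub>0 'k) set set" where
  "c_minus_ideal \<kappa> = Idl\<^bsub>U_vir\<^esub> {vir.uea_in UNIV vir_c \<ominus>\<^bsub>U_vir\<^esub> vir.uea_const UNIV \<kappa>}"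


subsection \<open>Verma modules\<close>

text \<open>On \<open>\<bbbK>\<^sub>\<kappa>\<^sub>,\<^sub>\<mu>\<close> the element \<open>x\<close> of the subalgebra \<open>vir_b_plus\<close> acts as the scalar below.  It vanishes
  on \<open>vir_n_plus\<close>, as elements of this span involve neither \<open>vir_c\<close> nor \<open>vir_e 0\<close>.\<close>

definition verma_weight :: "'k::field_char_0 \<Rightarrow> 'k \<Rightarrow> 'k vir \<Rightarrow> 'k" where
  "verma_weight \<kappa> \<mu> x = \<kappa> * Poly_Mapping.lookup x C + \<mu> * Poly_Mapping.lookup x (E 0)"

definition one_dim_module ::
    "'k::field_char_0 \<Rightarrow> 'k \<Rightarrow> (('k vir list \<Rightarrow>\<^sub>0 'k) set, 'k) module" where
  "one_dim_module \<kappa> \<mu> = rep_module (*) (\<lambda>x u. verma_weight \<kappa> \<mu> x * u)"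

definition verma_module ::
    "'k::field_char_0 \<Rightarrow> 'k \<Rightarrow>
      (('k vir list \<Rightarrow>\<^sub>0 'k) set, (('k vir list \<Rightarrow>\<^sub>0 'k) set \<times> 'k \<Rightarrow>\<^sub>0 int) set) module" where
  "verma_module \<kappa> \<mu> =
     extend_scalars (vir.uea_map UNIV) (vir.uea vir_b_plus) U_vir (one_dim_module \<kappa> \<mu>)"

end

theory Submission
  imports Defs "HOL-Library.Multiset"
begin

text \<open>
Let \<open>t \<ge> 0\<close>.  A character \<open>\<chi>\<close> of the subalgebra spanned by the \<open>e\<^sub>i\<close> with \<open>i \<ge> t\<close>, together with
\<open>c \<mapsto> \<kappa>\<close>, induces a module \<open>V\<close> with a generator \<open>v\<close>.  The monomials in the \<open>e\<^sub>i\<close> with \<open>i < t\<close>, applied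
to \<open>v\<close>, form a basis of \<open>V\<close>.  Here \<open>V\<close> is built directly on the space of polynomials in these
letters: the operators \<open>e\<^sub>i\<close> are defined by recursion on the degree, and the Virasoro relations
(\<open>e_commutator\<close>) follow by induction from the Jacobi identity.  This is the usual argument
for the Poincare-Birkhoff-Witt theorem, applied to the pair of an algebra and a subalgebra.

The annihilator of every such \<open>V\<close> is the ideal \<open>(c - \<kappa>)\<close> (\<open>annihilator_eq\<close>).  Modulo this ideal an
element \<open>p\<close> is a combination of words in the \<open>e\<^sub>i\<close> of length at most \<open>d\<close>, and up to shorter words only
the commutative monomials of degree \<open>d\<close> that these words define matter; they form the symbol of \<open>p\<close>.
Suppose that \<open>p\<close> kills \<open>V\<close>.  If all letters of a monomial \<open>m\<close> of degree \<open>d\<close> are smaller than \<open>t\<close>, then its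
coefficient in the symbol is the coefficient of the basis element \<open>m v\<close> in \<open>p v = 0\<close>.  If \<open>m\<close> contains
a letter \<open>a \<ge> t\<close>, choose \<open>n\<close> huge: the commutator \<open>[e\<^bsub>-n\<^esub>, p]\<close> kills \<open>V\<close> as well, its symbol is
obtained by the derivation \<open>x\<^sub>i \<mapsto> (i + n) x\<^bsub>i-n\<^esub>\<close>, and the coefficient at the monomial that arises from \<open>m\<close> by
replacing one \<open>a\<close> by the new letter \<open>a - n < t\<close> is a nonzero multiple of the coefficient of \<open>m\<close>.  So induction on the
number of letters \<open>\<ge> t\<close> shows that the symbol vanishes (\<open>symbol_zero\<close>), \<open>p\<close> is congruent to a
combination of shorter words, and induction on \<open>d\<close> gives \<open>p \<in> (c - \<kappa>)\<close>.

For \<open>t = 0\<close> there is a map from the Verma module to \<open>V\<close> sending \<open>s \<otimes> n\<close> to \<open>n (s v)\<close>.  Therefore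
every element that kills the Verma module kills \<open>V\<close>, and the converse inclusion holds since
\<open>c - \<kappa>\<close> is central and kills the inducing representation.

For primitivity a Verma module is inconvenient, because whether it is simple depends on its
highest weight.  The case \<open>t = 1\<close> with \<open>\<chi>(e\<^sub>2) \<noteq> 0\<close>, a Whittaker module, is simple for every \<open>\<kappa>\<close>
(\<open>whittaker_simple\<close>): give the letter \<open>e\<^bsub>-n\<^esub>\<close> weight \<open>n + 2\<close>; if \<open>p\<close> is the largest index that occurs in
the part of largest weight of a vector, then \<open>e\<^bsub>p+2\<^esub> - \<chi>(e\<^bsub>p+2\<^esub>)\<close> acts on that part, to leading order, as a nonzero
multiple of the partial derivative by \<open>e\<^bsub>-p\<^esub>\<close>, so that a nonzero vector of least weight in a submodule is a
multiple of \<open>v\<close>.  A ring modulo the annihilator of a simple module is primitive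
(\<open>primitive_quotient_by_annihilator\<close>).
\<close>

section \<open>Spaces of finitely supported functions\<close>

definition pscale :: "'k::field \<Rightarrow> ('b \<Rightarrow>\<^sub>0 'k) \<Rightarrow> 'b \<Rightarrow>\<^sub>0 'k" where
  "pscale a p = Poly_Mapping.map ((*) a) p"

definition lin :: "('a \<Rightarrow> 'b \<Rightarrow>\<^sub>0 'k) \<Rightarrow> ('a \<Rightarrow>\<^sub>0 'k::field) \<Rightarrow> 'b \<Rightarrow>\<^sub>0 'k" where
  "lin f p = (\<Sum>a \<in> Poly_Mapping.keys p. pscale (Poly_Mapping.lookup p a) (f a))"

lemma lookup_pscale [simp]: "Poly_Mapping.lookup (pscale a p) b = a * Poly_Mapping.lookup p b"
  by (simp add: pscale_def Poly_Mapping.map.rep_eq when_def)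

global_interpretation ps: vector_space "pscale :: 'k::field \<Rightarrow> ('b \<Rightarrow>\<^sub>0 'k) \<Rightarrow> _"
  by standard (auto intro!: poly_mapping_eqI simp: lookup_add algebra_simps)

lemma pscale_single: "pscale a (Poly_Mapping.single b c) = Poly_Mapping.single b (a * c)"
  by (auto intro!: poly_mapping_eqI simp: lookup_single when_def)

lemma lin_add: "lin f (p + q) = lin f p + lin f q"
  unfolding lin_def by (rule setsum_keys_plus_distrib) (simp_all add: ps.scale_left_distrib)

lemma lin_zero [simp]: "lin f 0 = 0"
  by (simp add: lin_def)

lemma lin_single: "lin f (Poly_Mapping.single a c) = pscale c (f a)"
  by (simp add: lin_def)

lemma lin_scale: "lin f (pscale c p) = pscale c (lin f p)"
proof (cases "c = 0")
  case False
  then have "Poly_Mapping.keys (pscale c p) = Poly_Mapping.keys p"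
    by (auto simp: in_keys_iff)
  then show ?thesis by (simp add: lin_def ps.scale_sum_right)
qed simp

lemma lin_minus: "lin f (- p) = - lin f p"
  using lin_add[of f p "- p"] by (simp add: eq_neg_iff_add_eq_0 add.commute)

lemma lin_diff: "lin f (p - q) = lin f p - lin f q"
  using lin_add[of f p "- q"] by (simp add: lin_minus)

lemma lin_sum: "lin f (\<Sum>x\<in>A. g x) = (\<Sum>x\<in>A. lin f (g x))"
  by (induction A rule: infinite_finite_induct) (simp_all add: lin_add)

lemma poly_mapping_sum_single:
  "p = (\<Sum>b\<in>Poly_Mapping.keys p. pscale (Poly_Mapping.lookup p b) (Poly_Mapping.single b 1))"
  by (rule poly_mapping_eqI) (simp add: pscale_single lookup_sum lookup_single when_def in_keys_iff)

text \<open>The vectors supported in a set of basis elements; filtrations are given in this form.\<close>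

definition supported :: "'b set \<Rightarrow> ('b \<Rightarrow>\<^sub>0 'k::field) set" where
  "supported A = {p. Poly_Mapping.keys p \<subseteq> A}"

lemma supported_iff: "p \<in> supported A \<longleftrightarrow> (\<forall>b. b \<notin> A \<longrightarrow> Poly_Mapping.lookup p b = 0)"
  by (auto simp: supported_def in_keys_iff)

lemma supportedD: "p \<in> supported A \<Longrightarrow> b \<notin> A \<Longrightarrow> Poly_Mapping.lookup p b = 0"
  by (auto simp: supported_iff)

lemma supported_mono: "p \<in> supported A \<Longrightarrow> A \<subseteq> B \<Longrightarrow> p \<in> supported B"
  by (auto simp: supported_def)

lemma supported_0 [simp]: "0 \<in> supported A"
  by (simp add: supported_def)

lemma supported_add: "p \<in> supported A \<Longrightarrow> q \<in> supported A \<Longrightarrow> p + q \<in> supported A"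
  by (auto simp: supported_iff lookup_add)

lemma supported_diff: "p \<in> supported A \<Longrightarrow> q \<in> supported A \<Longrightarrow> p - q \<in> supported A"
  by (auto simp: supported_iff lookup_minus)

lemma supported_scale: "p \<in> supported A \<Longrightarrow> pscale c p \<in> supported A"
  by (auto simp: supported_iff)

lemma supported_single: "b \<in> A \<Longrightarrow> Poly_Mapping.single b c \<in> supported A"
  by (auto simp: supported_iff lookup_single when_def)

lemma supported_sum: "(\<And>x. x \<in> X \<Longrightarrow> f x \<in> supported A) \<Longrightarrow> (\<Sum>x\<in>X. f x) \<in> supported A"
  by (induction X rule: infinite_finite_induct) (auto intro: supported_add)

lemma supported_lin:
  assumes "p \<in> supported A" "\<And>a. a \<in> A \<Longrightarrow> f a \<in> supported B"
  shows "lin f p \<in> supported B"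
  unfolding lin_def using assms by (intro supported_sum supported_scale) (auto simp: supported_def)

lemma lin_cong_on:
  assumes "p \<in> supported A" "\<And>a. a \<in> A \<Longrightarrow> f a = g a"
  shows "lin f p = lin g p"
  unfolding lin_def using assms by (intro sum.cong) (auto simp: supported_def)

lemma lin_induct [consumes 1, case_names zero single add]:
  assumes "p \<in> supported A"
    and "P 0" and "\<And>b c. b \<in> A \<Longrightarrow> P (Poly_Mapping.single b c)"
    and "\<And>p q. P p \<Longrightarrow> P q \<Longrightarrow> P (p + q)"
  shows "P p"
proof -
  have "P (\<Sum>b\<in>X. pscale (Poly_Mapping.lookup p b) (Poly_Mapping.single b 1))"
    if "finite X" "X \<subseteq> A" for X
    using that by (induction) (auto simp: assms(2) pscale_single intro!: assms(3,4))
  then show ?thesis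
    using assms(1) poly_mapping_sum_single[of p] unfolding supported_def
    by (metis finite_keys mem_Collect_eq)
qed

lemma lin_lin: "lin f (lin g p) = lin (\<lambda>a. lin f (g a)) p"
  by (simp add: lin_def[of g] lin_def[of "\<lambda>a. lin f (g a)"] lin_sum lin_scale)

lemma lookup_lin: "Poly_Mapping.lookup (lin f p) b =
    (\<Sum>a\<in>Poly_Mapping.keys p. Poly_Mapping.lookup p a * Poly_Mapping.lookup (f a) b)"
  by (simp add: lin_def lookup_sum)

lemma supported_UNIV [simp]: "p \<in> supported UNIV"
  by (simp add: supported_def)

section \<open>Modules over quotients of free algebras\<close>

lemma (in ideal) abelian_subgroup: "abelian_subgroup I R"
  by (rule abelian_subgroupI3[OF is_additive_subgroup is_abelian_group])

lemma (in ideal) quot_carrier: "X \<in> carrier (R Quot I) \<longleftrightarrow> (\<exists>a\<in>carrier R. X = I +> a)"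
  by (auto simp: FactRing_def A_RCOSETS_def')

lemma (in ideal) quot_add:
  "\<lbrakk>a \<in> carrier R; b \<in> carrier R\<rbrakk> \<Longrightarrow> (I +> a) \<oplus>\<^bsub>R Quot I\<^esub> (I +> b) = I +> (a \<oplus> b)"
  by (simp add: FactRing_def a_rcos_sum)

lemma (in ideal) quot_mult:
  "\<lbrakk>a \<in> carrier R; b \<in> carrier R\<rbrakk> \<Longrightarrow> (I +> a) \<otimes>\<^bsub>R Quot I\<^esub> (I +> b) = I +> (a \<otimes> b)"
  by (simp add: FactRing_def rcoset_mult_add)

lemma ideal_annihilator:
  assumes "left_module R M"
  shows "ideal (annihilator R M) R"
proof -
  interpret left_module R M by fact
  show ?thesis
  proof (rule idealI[OF R.ring_axioms])
    show "subgroup (annihilator R M) (add_monoid R)"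
    proof (rule R.add.subgroupI)
      have "\<zero>\<^bsub>R\<^esub> \<in> annihilator R M" by (simp add: annihilator_def)
      then show "annihilator R M \<noteq> {}" by blast
      show "\<ominus>\<^bsub>R\<^esub> a \<in> annihilator R M" if "a \<in> annihilator R M" for a
        using that by (simp add: annihilator_def smult_l_minus)
    qed (auto simp: annihilator_def smult_l_distr)
  qed (auto simp: annihilator_def smult_assoc)
qed

text \<open>A module over \<open>R\<close> is a faithful module over the quotient by its annihilator, with the same submodules.\<close>

lemma primitive_quotient_by_annihilator:
  fixes M :: "('a, 'b, 'm) module_scheme"
  assumes simple: "simple_left_module R M"
  shows "primitive_ring (R Quot annihilator R M)"
proof -
  define J where "J = annihilator R M"
  have lm: "left_module R M" using simple unfolding simple_left_module_def by (rule conjunct1)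
  interpret left_module R M by (rule lm)
  have I: "ideal J R" unfolding J_def by (rule ideal_annihilator[OF lm])
  note abelian_subgroup = ideal.abelian_subgroup[OF I]
  let ?Q = "R Quot J"
  define M' :: "('a set, 'b) module" where
    "M' = \<lparr>carrier = carrier M, monoid.mult = undefined, one = undefined, ring.zero = \<zero>\<^bsub>M\<^esub>, add = add M,
      smult = (\<lambda>X u. the_elem ((\<lambda>a. a \<odot>\<^bsub>M\<^esub> u) ` X))\<rparr>"
  \<comment> \<open>All elements of a coset of the annihilator act alike, so the action descends to the quotient.\<close>
  have smult: "(J +>\<^bsub>R\<^esub> a) \<odot>\<^bsub>M'\<^esub> u = a \<odot>\<^bsub>M\<^esub> u" if "a \<in> carrier R" "u \<in> carrier M" for a u
  proof -
    have "b \<odot>\<^bsub>M\<^esub> u = a \<odot>\<^bsub>M\<^esub> u" if b: "b \<in> J +>\<^bsub>R\<^esub> a" for b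
    proof -
      obtain h where "h \<in> J" "b = h \<oplus>\<^bsub>R\<^esub> a" using b unfolding a_r_coset_def' by blast
      then show ?thesis using \<open>a \<in> carrier R\<close> \<open>u \<in> carrier M\<close> by (simp add: J_def annihilator_def smult_l_distr)
    qed
    moreover have "a \<in> J +>\<^bsub>R\<^esub> a" using that by (simp add: abelian_subgroup.a_rcos_self[OF abelian_subgroup])
    ultimately have "(\<lambda>b. b \<odot>\<^bsub>M\<^esub> u) ` (J +>\<^bsub>R\<^esub> a) = {a \<odot>\<^bsub>M\<^esub> u}" by blast
    then show ?thesis by (simp add: M'_def)
  qed
  note carrier_Q = ideal.quot_carrier[OF I] and add_Q = ideal.quot_add[OF I] and mult_Q = ideal.quot_mult[OF I]
  have one_Q: "\<one>\<^bsub>?Q\<^esub> = J +>\<^bsub>R\<^esub> \<one>\<^bsub>R\<^esub>" by (simp add: FactRing_def)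
  have M'_simps [simp]: "carrier M' = carrier M" "\<zero>\<^bsub>M'\<^esub> = \<zero>\<^bsub>M\<^esub>" "add M' = add M"
    by (simp_all add: M'_def)
  have "abelian_group M'"
  proof (rule abelian_groupI)
    fix x assume "x \<in> carrier M'"
    then show "\<exists>y\<in>carrier M'. y \<oplus>\<^bsub>M'\<^esub> x = \<zero>\<^bsub>M'\<^esub>"
      by (intro bexI[of _ "\<ominus>\<^bsub>M\<^esub> x"]) (auto simp: M.l_neg)
  qed (auto simp: M.add.m_ac)
  then have M': "left_module ?Q M'"
    by (intro left_module.intro left_module_axioms.intro ideal.quotient_is_ring[OF I])
       (auto simp: carrier_Q add_Q mult_Q one_Q smult smult_l_distr smult_r_distr smult_assoc)
  have "annihilator ?Q M' = {J}"
  proof -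
    have "X = J" if "X \<in> annihilator ?Q M'" for X
    proof -
      obtain a where a: "a \<in> carrier R" "X = J +>\<^bsub>R\<^esub> a"
        using \<open>X \<in> annihilator ?Q M'\<close> by (auto simp: annihilator_def carrier_Q)
      have "X \<odot>\<^bsub>M'\<^esub> u = \<zero>\<^bsub>M\<^esub>" if "u \<in> carrier M" for u
        using \<open>X \<in> annihilator ?Q M'\<close> that by (simp add: annihilator_def)
      then have "a \<odot>\<^bsub>M\<^esub> u = \<zero>\<^bsub>M\<^esub>" if "u \<in> carrier M" for u
        using smult[OF a(1) that] a(2) that by simp
      then have "a \<in> J"
        using a(1) by (simp add: J_def annihilator_def)
      then show ?thesis using a abelian_subgroup.a_rcos_const[OF abelian_subgroup] by simp
    qed
    moreover have "J \<in> annihilator ?Q M'"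
    proof -
      have "J \<subseteq> carrier R" by (auto simp: J_def annihilator_def)
      then have "J = J +>\<^bsub>R\<^esub> \<zero>\<^bsub>R\<^esub>" by simp
      then show ?thesis using smult[of "\<zero>\<^bsub>R\<^esub>"] by (auto simp: annihilator_def carrier_Q)
    qed
    ultimately show ?thesis by blast
  qed
  then have "faithful_left_module ?Q M'"
    using M' by (simp add: faithful_left_module_def FactRing_def)
  moreover have "simple_left_module ?Q M'"
    unfolding simple_left_module_def
  proof (intro conjI allI impI M')
    show "carrier M' \<noteq> {\<zero>\<^bsub>M'\<^esub>}" using simple by (simp add: simple_left_module_def)
    fix N assume "submodule N ?Q M'"
    then have N: "N \<subseteq> carrier M" "\<zero>\<^bsub>M\<^esub> \<in> N" "\<forall>x\<in>N. \<forall>y\<in>N. x \<oplus>\<^bsub>M\<^esub> y \<in> N"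
      "\<forall>X\<in>carrier ?Q. \<forall>x\<in>N. X \<odot>\<^bsub>M'\<^esub> x \<in> N"
      unfolding left_module.submodule_iff[OF M'] by simp_all
    have "a \<odot>\<^bsub>M\<^esub> x \<in> N" if "a \<in> carrier R" "x \<in> N" for a x
      using N(4) smult[of a x] that N(1) by (metis carrier_Q subsetD)
    then have "submodule N R M" using N unfolding submodule_iff by blast
    then show "N = {\<zero>\<^bsub>M'\<^esub>} \<or> N = carrier M'"
      using simple by (simp add: simple_left_module_def)
  qed
  ultimately show ?thesis unfolding J_def by (rule primitive_ringI[rotated])
qed

lemma free_algebra_simps [simp]:
  "p \<in> carrier (free_algebra A) \<longleftrightarrow> p \<in> supported (lists A)"
  "monoid.mult (free_algebra A) = (*)" "one (free_algebra A) = 1"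
  "ring.zero (free_algebra A) = 0" "add (free_algebra A) = (+)"
  by (simp_all add: free_algebra_def supported_def)

lemma single_list_mult: "Poly_Mapping.single u a * Poly_Mapping.single v b = Poly_Mapping.single (u @ v) (a * b)"
  by (simp add: mult_single plus_list_def)

lemma const_1: "const 1 = 1"
  by (simp add: zero_list_def[symmetric])

lemma one_supported: "1 \<in> supported (lists A)"
  unfolding const_1[symmetric] by (rule supported_single) simp

lemma const_mult: "const a * p = pscale a p" for p :: "'v list \<Rightarrow>\<^sub>0 'k::field"
proof -
  have "p \<in> supported UNIV" by (simp add: supported_def)
  then show ?thesis
    by (induction rule: lin_induct) (simp_all add: single_list_mult pscale_single distrib_left ps.scale_right_distrib)
qed

lemma mult_const: "p * const a = pscale a p" for p :: "'v list \<Rightarrow>\<^sub>0 'k::field"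
proof -
  have "p \<in> supported UNIV" by (simp add: supported_def)
  then show ?thesis
    by (induction rule: lin_induct)
       (simp_all add: single_list_mult pscale_single distrib_right ps.scale_right_distrib mult.commute)
qed

lemma supported_lists_mult:
  assumes "p \<in> supported (lists A)" "q \<in> supported (lists A)"
  shows "p * q \<in> supported (lists A)"
proof -
  have "u + v \<in> lists A" if "u \<in> Poly_Mapping.keys p" "v \<in> Poly_Mapping.keys q" for u v
  proof -
    have "u \<in> lists A" "v \<in> lists A" using that assms unfolding supported_def by blast+
    then show ?thesis by (simp add: plus_list_def)
  qed
  then show ?thesis using keys_mult[of p q] unfolding supported_def by blast
qed

lemma free_algebra_is_ring: "ring (free_algebra A :: ('v list \<Rightarrow>\<^sub>0 'k::field) ring)"
proof (rule ringI)
  show "abelian_group (free_algebra A :: ('v list \<Rightarrow>\<^sub>0 'k) ring)"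
  proof (rule abelian_groupI)
    fix p :: "'v list \<Rightarrow>\<^sub>0 'k" assume "p \<in> carrier (free_algebra A)"
    then show "\<exists>q\<in>carrier (free_algebra A). q \<oplus>\<^bsub>free_algebra A\<^esub> p = \<zero>\<^bsub>free_algebra A\<^esub>"
      by (intro bexI[of _ "- p"]) (auto simp: supported_def)
  qed (auto simp: supported_add)
  show "Group.monoid (free_algebra A :: ('v list \<Rightarrow>\<^sub>0 'k) ring)"
    by (rule monoidI)
       (auto simp: supported_lists_mult mult.assoc one_supported)
qed (auto simp: distrib_left distrib_right)

text \<open>Representations of a Lie subalgebra \<open>L\<close>.  Only the operators \<open>\<rho> x\<close> with \<open>x\<close> in \<open>L\<close> are constrained, so that
the locale covers both the Virasoro algebra itself and its subalgebra \<open>vir_b_plus\<close>.\<close>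

locale lie_representation = lie_algebra scale bracket + W: vector_space sc
  for scale :: "'k::field \<Rightarrow> 'v::ab_group_add \<Rightarrow> 'v" (infixr \<open>*s\<close> 75)
    and bracket :: "'v \<Rightarrow> 'v \<Rightarrow> 'v"
    and sc :: "'k \<Rightarrow> 'w::ab_group_add \<Rightarrow> 'w" +
  fixes L :: "'v set" and \<rho> :: "'v \<Rightarrow> 'w \<Rightarrow> 'w"
  assumes subalgebra: "lie_subalgebra L"
    and rho_add: "x \<in> L \<Longrightarrow> \<rho> x (u + v) = \<rho> x u + \<rho> x v"
    and rho_scale: "x \<in> L \<Longrightarrow> \<rho> x (sc a u) = sc a (\<rho> x u)"
    and rho_add_vector: "\<lbrakk>x \<in> L; y \<in> L\<rbrakk> \<Longrightarrow> \<rho> (x + y) u = \<rho> x u + \<rho> y u"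
    and rho_scale_vector: "x \<in> L \<Longrightarrow> \<rho> (a *s x) u = sc a (\<rho> x u)"
    and rho_bracket: "\<lbrakk>x \<in> L; y \<in> L\<rbrakk> \<Longrightarrow> \<rho> (bracket x y) u = \<rho> x (\<rho> y u) - \<rho> y (\<rho> x u)"
begin

abbreviation free where "free \<equiv> (free_algebra L :: ('v list \<Rightarrow>\<^sub>0 'k) ring)"

sublocale free: ring free
  by (rule free_algebra_is_ring)

lemma closed:
  "\<lbrakk>x \<in> L; y \<in> L\<rbrakk> \<Longrightarrow> x + y \<in> L" "x \<in> L \<Longrightarrow> a *s x \<in> L" "\<lbrakk>x \<in> L; y \<in> L\<rbrakk> \<Longrightarrow> bracket x y \<in> L"
  using subalgebra by (auto simp: lie_subalgebra_def subspace_add subspace_scale)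

lemma letter_carrier: "x \<in> L \<Longrightarrow> letter x \<in> supported (lists L)"
  by (rule supported_single) simp

lemma const_carrier: "const a \<in> supported (lists L)"
  by (rule supported_single) simp

lemma relations_carrier: "uea_relations L \<subseteq> carrier free"
  unfolding uea_relations_def
  by (auto intro!: supported_diff supported_lists_mult letter_carrier const_carrier closed)

sublocale relations: ideal "uea_ideal L" free
  unfolding uea_ideal_def by (rule free.genideal_ideal[OF relations_carrier])

sublocale U: ring "uea L"
  unfolding uea_def by (rule relations.quotient_is_ring)

abbreviation run :: "('v list \<Rightarrow>\<^sub>0 'k) \<Rightarrow> 'w \<Rightarrow> 'w" where
  "run \<equiv> free_act sc \<rho>"

lemma foldr_add: "w \<in> lists L \<Longrightarrow> foldr \<rho> w (u + v) = foldr \<rho> w u + foldr \<rho> w v"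
  by (induction w) (auto simp: rho_add)

lemma foldr_scale: "w \<in> lists L \<Longrightarrow> foldr \<rho> w (sc a u) = sc a (foldr \<rho> w u)"
  by (induction w) (auto simp: rho_scale)

lemma run_plus: "run (p + q) u = run p u + run q u"
  unfolding free_act_def by (rule setsum_keys_plus_distrib) (simp_all add: W.scale_left_distrib)

lemma run_zero [simp]: "run 0 u = 0"
  by (simp add: free_act_def)

lemma run_minus: "run (- p) u = - run p u"
  using run_plus[of p "- p" u] by (simp add: eq_neg_iff_add_eq_0 add.commute)

lemma run_diff: "run (p - q) u = run p u - run q u"
  using run_plus[of p "- q" u] by (simp add: run_minus)

lemma run_single: "run (Poly_Mapping.single w a) u = sc a (foldr \<rho> w u)"
  by (simp add: free_act_def)

lemma run_one [simp]: "run 1 u = u"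
  unfolding const_1[symmetric] run_single by simp

lemma run_add:
  assumes "p \<in> supported (lists L)" shows "run p (u + v) = run p u + run p v"
  unfolding free_act_def sum.distrib[symmetric]
proof (intro sum.cong refl)
  fix w assume "w \<in> Poly_Mapping.keys p"
  then have "w \<in> lists L" using assms unfolding supported_def by blast
  then show "sc (Poly_Mapping.lookup p w) (foldr \<rho> w (u + v)) =
      sc (Poly_Mapping.lookup p w) (foldr \<rho> w u) + sc (Poly_Mapping.lookup p w) (foldr \<rho> w v)"
    by (simp only: foldr_add W.scale_right_distrib)
qed

lemma run_scale:
  assumes "p \<in> supported (lists L)" shows "run p (sc a u) = sc a (run p u)"
  unfolding free_act_def W.scale_sum_right
proof (intro sum.cong refl)
  fix w assume "w \<in> Poly_Mapping.keys p"
  then have "w \<in> lists L" using assms unfolding supported_def by blast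
  then show "sc (Poly_Mapping.lookup p w) (foldr \<rho> w (sc a u)) = sc a (sc (Poly_Mapping.lookup p w) (foldr \<rho> w u))"
    by (simp only: foldr_scale W.scale_left_commute)
qed

lemma run_zero_right [simp]: "p \<in> supported (lists L) \<Longrightarrow> run p 0 = 0"
  using run_scale[of p 0 0] by simp

lemma run_mult:
  assumes p: "p \<in> supported (lists L)" and q: "q \<in> supported (lists L)"
  shows "run (p * q) u = run p (run q u)"
  using p
proof (induction rule: lin_induct)
  case w: (single w a)
  show ?case using q
  proof (induction rule: lin_induct)
    case (single v b)
    then show ?case using w
      by (simp add: single_list_mult run_single foldr_scale)
  next
    case (add p q)
    then show ?case using w by (simp add: distrib_left run_plus run_add supported_single)
  qed (use w in \<open>simp add: supported_single\<close>)
qed (simp_all add: distrib_right run_plus)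

lemma kernel_ideal: "ideal {p \<in> supported (lists L). \<forall>u. run p u = 0} free" (is "ideal ?K _")
proof (rule idealI)
  show "subgroup ?K (add_monoid free)"
  proof (rule free.add.subgroupI)
    show "?K \<noteq> {}" by (auto intro!: exI[of _ 0])
    show "\<ominus>\<^bsub>free\<^esub> p \<in> ?K" if "p \<in> ?K" for p
    proof -
      have "\<ominus>\<^bsub>free\<^esub> p = - p"
        using that by (intro free.minus_equality) (auto simp: supported_def)
      then show ?thesis using that by (simp add: supported_def run_minus)
    qed
  qed (auto simp: supported_add run_plus)
qed (auto simp: free_algebra_is_ring supported_lists_mult run_mult)

text \<open>The elements of the free algebra that act as zero form an ideal, and the defining relations
of the enveloping algebra lie in it; hence the free algebra acts through the enveloping algebra.\<close>

lemma run_relations: "p \<in> uea_ideal L \<Longrightarrow> run p u = 0"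
proof -
  have "uea_relations L \<subseteq> {p \<in> supported (lists L). \<forall>u. run p u = 0}"
  proof
    fix p assume p: "p \<in> uea_relations L"
    then have "\<forall>u. run p u = 0"
      unfolding uea_relations_def
      by (auto simp: run_diff run_mult letter_carrier const_carrier run_single
          rho_add_vector rho_scale_vector rho_bracket)
    then show "p \<in> {p \<in> supported (lists L). \<forall>u. run p u = 0}"
      using p relations_carrier by auto
  qed
  from free.genideal_minimal[OF kernel_ideal this]
  show "p \<in> uea_ideal L \<Longrightarrow> run p u = 0" unfolding uea_ideal_def by blast
qed

abbreviation coset where "coset p \<equiv> uea_ideal L +>\<^bsub>free\<^esub> p"
abbreviation M where "M \<equiv> rep_module sc \<rho> :: (('v list \<Rightarrow>\<^sub>0 'k) set, 'w) module"

lemma coset_smult: "p \<in> supported (lists L) \<Longrightarrow> coset p \<odot>\<^bsub>M\<^esub> u = run p u"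
proof -
  assume p: "p \<in> supported (lists L)"
  have "run q u = run p u" if "q \<in> coset p" for q
    using that by (auto simp: a_r_coset_def r_coset_def run_plus run_relations)
  moreover have "p \<in> coset p" using p by (simp add: relations.a_rcos_self)
  ultimately have "(\<lambda>q. run q u) ` coset p = {run p u}" by blast
  then show ?thesis by (simp add: rep_module_def)
qed

lemma uea_carrier: "X \<in> carrier (uea L) \<longleftrightarrow> (\<exists>p\<in>supported (lists L). X = coset p)"
  by (auto simp: uea_def FactRing_def A_RCOSETS_def' simp del: free_algebra_simps(2-))

lemma coset_carrier [simp]: "p \<in> supported (lists L) \<Longrightarrow> coset p \<in> carrier (uea L)"
  by (auto simp: uea_carrier)

lemma coset_add: "\<lbrakk>p \<in> supported (lists L); q \<in> supported (lists L)\<rbrakk> \<Longrightarrow> coset p \<oplus>\<^bsub>uea L\<^esub> coset q = coset (p + q)"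
  using relations.a_rcos_sum[of p q] by (simp add: uea_def FactRing_def)

lemma coset_mult: "\<lbrakk>p \<in> supported (lists L); q \<in> supported (lists L)\<rbrakk> \<Longrightarrow> coset p \<otimes>\<^bsub>uea L\<^esub> coset q = coset (p * q)"
  using relations.rcoset_mult_add[of p q] by (simp add: uea_def FactRing_def)

lemma coset_one: "\<one>\<^bsub>uea L\<^esub> = coset 1"
  by (simp add: uea_def FactRing_def)

lemma M_simps [simp]: "carrier M = UNIV" "\<zero>\<^bsub>M\<^esub> = 0" "add M = (+)"
  by (simp_all add: rep_module_def)

theorem rep_left_module: "left_module (uea L) M"
proof (intro left_module.intro left_module_axioms.intro U.ring_axioms)
  show "abelian_group M"
  proof (rule abelian_groupI)
    fix x :: 'w
    show "\<exists>y\<in>carrier M. y \<oplus>\<^bsub>M\<^esub> x = \<zero>\<^bsub>M\<^esub>" by (intro bexI[of _ "- x"]) auto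
  qed (auto simp: ac_simps)
  fix X Y :: "('v list \<Rightarrow>\<^sub>0 'k) set" and u v :: 'w
  assume "X \<in> carrier (uea L)"
  then obtain p where p: "p \<in> supported (lists L)" "X = coset p" unfolding uea_carrier by blast
  show "X \<odot>\<^bsub>M\<^esub> u \<in> carrier M" by simp
  show "X \<odot>\<^bsub>M\<^esub> (u \<oplus>\<^bsub>M\<^esub> v) = X \<odot>\<^bsub>M\<^esub> u \<oplus>\<^bsub>M\<^esub> X \<odot>\<^bsub>M\<^esub> v"
    using p by (simp add: coset_smult run_add)
  assume "Y \<in> carrier (uea L)"
  then obtain q where q: "q \<in> supported (lists L)" "Y = coset q" unfolding uea_carrier by blast
  show "(X \<oplus>\<^bsub>uea L\<^esub> Y) \<odot>\<^bsub>M\<^esub> u = X \<odot>\<^bsub>M\<^esub> u \<oplus>\<^bsub>M\<^esub> Y \<odot>\<^bsub>M\<^esub> u"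
    using p q by (simp add: coset_add coset_smult run_plus supported_add)
  show "(X \<otimes>\<^bsub>uea L\<^esub> Y) \<odot>\<^bsub>M\<^esub> u = X \<odot>\<^bsub>M\<^esub> (Y \<odot>\<^bsub>M\<^esub> u)"
    using p q by (simp add: coset_mult coset_smult run_mult supported_lists_mult)
next
  show "\<one>\<^bsub>uea L\<^esub> \<odot>\<^bsub>M\<^esub> u = u" for u
    by (simp add: coset_one coset_smult one_supported)
qed

end

section \<open>Modules induced from a character of a subalgebra\<close>

text \<open>The assumption \<open>character\<close> says that \<open>\<chi>\<close>, extended by \<open>c \<mapsto> \<kappa>\<close>, vanishes on all brackets of
elements \<open>e\<^sub>i\<close> and \<open>e\<^sub>j\<close> with \<open>i, j \<ge> t\<close>: the central term of such a bracket is zero as \<open>t \<ge> 0\<close>.\<close>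

locale vir_character =
  fixes t :: int and \<chi> :: "int \<Rightarrow> 'k::field_char_0" and \<kappa> :: 'k
  assumes t_nonneg: "0 \<le> t"
    and character: "\<lbrakk>t \<le> i; t \<le> j\<rbrakk> \<Longrightarrow> of_int (j - i) * \<chi> (i + j) = 0"
begin

text \<open>Basis vectors of the induced module are multisets of natural numbers; the element \<open>n\<close> of a multiset
stands for the letter \<open>e\<^sub>i\<close> with \<open>i = gen n < t\<close>.  In this way the whole type is the module.  A multiset
stands for the product of its letters, in increasing order of the indices \<open>i\<close>, applied to the generator; hence
the leftmost letter belongs to the largest number.\<close>

definition gen :: "nat \<Rightarrow> int" where
  "gen n = t - 1 - int n"

definition idx :: "int \<Rightarrow> nat" where
  "idx i = nat (t - 1 - i)"

lemma gen_idx: "i < t \<Longrightarrow> gen (idx i) = i"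
  by (simp add: gen_def idx_def)

lemma idx_gen [simp]: "idx (gen n) = n"
  by (simp add: gen_def idx_def)

lemma gen_less [simp]: "gen n < t"
  by (simp add: gen_def)

text \<open>What \<open>e\<^sub>i\<close> does to a monomial to leading order: multiplication by the letter \<open>e\<^sub>i\<close> if \<open>i < t\<close>, and by the
scalar \<open>\<chi> i\<close> otherwise.\<close>

definition lead :: "int \<Rightarrow> nat multiset \<Rightarrow> nat multiset \<Rightarrow>\<^sub>0 'k" where
  "lead i m = (if i < t then Poly_Mapping.single (add_mset (idx i) m) 1
               else Poly_Mapping.single m (\<chi> i))"

definition central :: "int \<Rightarrow> int \<Rightarrow> 'k" where
  "central i j = (if i + j = 0 then of_int (i ^ 3 - i) / 12 * \<kappa> else 0)"

text \<open>The difference between the action of \<open>e\<^sub>i\<close> and its leading term.  If \<open>e\<^sub>j\<close> is the leftmost letter of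
\<open>m = e\<^sub>j u\<close>, then \<open>e\<^sub>i m\<close> is just a sorted monomial when \<open>i \<le> j\<close>, and otherwise it must be
\<open>e\<^sub>j (e\<^sub>i u) + [e\<^sub>i, e\<^sub>j] u\<close>.  The leading term of \<open>e\<^sub>i u\<close> contributes the leading term of \<open>e\<^sub>i m\<close>, so only
the remainder of \<open>e\<^sub>i u\<close> enters; its monomials are no longer than \<open>u\<close>, which makes the recursion
well-founded.  Since its arguments come out of an earlier value, the recursion is
expressed with a bound \<open>s\<close> on the size of \<open>m\<close> instead.\<close>

primrec remainder :: "nat \<Rightarrow> int \<Rightarrow> nat multiset \<Rightarrow> nat multiset \<Rightarrow>\<^sub>0 'k" where
  "remainder 0 i m = 0"
| "remainder (Suc s) i m =
     (if size m \<le> s then remainder s i m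
      else let n = Max_mset m; u = m - {#n#}; j = gen n in
        if i \<le> j then 0
        else lin (\<lambda>x. lead j x + remainder s j x) (remainder s i u) +
          (pscale (of_int (j - i)) (lead (i + j) u + remainder s (i + j) u) +
           pscale (central i j) (Poly_Mapping.single u 1)))"

definition act :: "int \<Rightarrow> nat multiset \<Rightarrow> nat multiset \<Rightarrow>\<^sub>0 'k" where
  "act i m = lead i m + remainder (size m) i m"

definition e :: "int \<Rightarrow> (nat multiset \<Rightarrow>\<^sub>0 'k) \<Rightarrow> nat multiset \<Rightarrow>\<^sub>0 'k" where
  "e i = lin (act i)"

text \<open>The operator by which \<open>[e\<^sub>i, e\<^sub>j]\<close> has to act.\<close>

definition commutator :: "int \<Rightarrow> int \<Rightarrow> (nat multiset \<Rightarrow>\<^sub>0 'k) \<Rightarrow> nat multiset \<Rightarrow>\<^sub>0 'k" where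
  "commutator i j y = pscale (of_int (j - i)) (e (i + j) y) + pscale (central i j) y"

abbreviation monom :: "nat multiset \<Rightarrow> nat multiset \<Rightarrow>\<^sub>0 'k" where
  "monom m \<equiv> Poly_Mapping.single m 1"

lemma lead_supported: "lead i m \<in> supported {x. size x \<le> Suc (size m)}"
  by (auto simp: lead_def intro!: supported_single)

lemma remainder_supported: "remainder s i m \<in> supported {x. size x \<le> size m}"
proof (induction s arbitrary: i m)
  case (Suc s)
  show ?case
  proof (cases "size m \<le> s")
    case False
    define n u where "n = Max_mset m" and "u = m - {#n#}"
    have "m \<noteq> {#}" using False by auto
    then have m: "m = add_mset n u"
      using Max_in[of "set_mset m"] by (simp add: n_def u_def)
    have lead_rem: "lead j x + remainder s j x \<in> supported {x. size x \<le> size m}"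
      if "size x \<le> size u" for j x
      using that m by (intro supported_add) (auto intro: supported_mono[OF lead_supported] supported_mono[OF Suc])
    have "remainder (Suc s) i m = (if i \<le> gen n then 0
        else lin (\<lambda>x. lead (gen n) x + remainder s (gen n) x) (remainder s i u) +
          (pscale (of_int (gen n - i)) (lead (i + gen n) u + remainder s (i + gen n) u) +
           pscale (central i (gen n)) (Poly_Mapping.single u 1)))"
      using False by (simp add: Let_def n_def u_def)
    moreover have "lin (\<lambda>x. lead (gen n) x + remainder s (gen n) x) (remainder s i u)
        \<in> supported {x. size x \<le> size m}"
      by (rule supported_lin[OF Suc]) (simp add: lead_rem)
    moreover have "u \<in> {x. size x \<le> size m}" using m by simp
    ultimately show ?thesis
      by (simp add: supported_add supported_scale supported_single lead_rem)
  qed (use Suc in auto)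
qed simp

lemma remainder_fuel: "size m \<le> s \<Longrightarrow> remainder s i m = remainder (size m) i m"
  by (induction s) (auto simp: le_Suc_eq)

lemma act_supported: "act i m \<in> supported {x. size x \<le> Suc (size m)}"
  unfolding act_def by (intro supported_add lead_supported supported_mono[OF remainder_supported]) auto

lemma act_minus_lead: "act i m - lead i m \<in> supported {x. size x \<le> size m}"
  by (simp add: act_def remainder_supported)

lemma Max_mset_add: "\<forall>x\<in>#u. x \<le> n \<Longrightarrow> Max_mset (add_mset n u) = n"
  by (simp add: Max_eq_iff Max_insert2)

lemma act_leftmost:
  assumes "\<forall>x\<in>#m. x \<le> n" shows "act (gen n) m = monom (add_mset n m)"
proof (cases "size m")
  case (Suc s)
  then have "m \<noteq> {#}" by auto
  then have "Max_mset m \<le> n" using assms by auto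
  then show ?thesis
    unfolding act_def Suc using Suc by (simp add: lead_def Let_def) (simp add: gen_def)
qed (simp add: act_def lead_def)

lemma act_empty: "t \<le> i \<Longrightarrow> act i {#} = Poly_Mapping.single {#} (\<chi> i)"
  by (simp add: act_def lead_def)

lemma e_add: "e i (y + z) = e i y + e i z"
  by (simp add: e_def lin_add)

lemma e_scale: "e i (pscale c y) = pscale c (e i y)"
  by (simp add: e_def lin_scale)

lemma e_diff: "e i (y - z) = e i y - e i z"
  by (simp add: e_def lin_diff)

lemma e_zero [simp]: "e i 0 = 0"
  by (simp add: e_def)

lemma e_single: "e i (Poly_Mapping.single m c) = pscale c (act i m)"
  by (simp add: e_def lin_single)

lemma e_monom [simp]: "e i (monom m) = act i m"
  by (simp add: e_def lin_single)

lemma e_lead: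
  assumes "\<forall>x\<in>#u. x \<le> n" "gen n < i"
  shows "e (gen n) (lead i u) = lead i (add_mset n u)"
  using assms act_leftmost[of "add_mset (idx i) u" n] act_leftmost[of u n]
  by (auto simp: lead_def e_single pscale_single gen_def idx_def add_mset_commute)

text \<open>With the bound eliminated, this is the recursion that motivates the definition of \<open>remainder\<close>.\<close>

lemma act_add_mset:
  assumes n: "\<forall>x\<in>#u. x \<le> n" and i: "gen n < i"
  shows "act i (add_mset n u) = e (gen n) (act i u) + commutator i (gen n) (monom u)"
proof -
  let ?m = "add_mset n u" and ?j = "gen n"
  have "remainder (size ?m) i ?m =
      lin (\<lambda>x. lead ?j x + remainder (size u) ?j x) (remainder (size u) i u) +
          (pscale (of_int (?j - i)) (lead (i + ?j) u + remainder (size u) (i + ?j) u) +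
           pscale (central i ?j) (monom u))"
    using i Max_mset_add[OF n] by (simp add: Let_def)
  also have "lin (\<lambda>x. lead ?j x + remainder (size u) ?j x) (remainder (size u) i u) =
      e ?j (remainder (size u) i u)"
    unfolding e_def by (rule lin_cong_on[OF remainder_supported]) (auto simp: act_def intro: remainder_fuel)
  finally show ?thesis
    unfolding act_def[of i] e_add e_lead[OF n i] commutator_def
    by (simp add: act_def[of "i + ?j"] add.assoc)
qed

lemma commutator_add: "commutator i j (y + z) = commutator i j y + commutator i j z"
  by (simp add: commutator_def e_add ps.scale_right_distrib)

lemma commutator_scale: "commutator i j (pscale c y) = pscale c (commutator i j y)"
  by (simp add: commutator_def e_scale ps.scale_right_distrib mult.commute)

lemma central_swap: "central j i = - central i j"
proof (cases "i + j = 0")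
  case True
  then have "j = - i" by simp
  then show ?thesis by (simp add: central_def field_simps)
qed (simp add: central_def add.commute)

lemma commutator_swap: "commutator j i y = - commutator i j y"
proof -
  have "of_int (i - j) = - (of_int (j - i) :: 'k)" by simp
  then show ?thesis
    unfolding commutator_def central_swap[of j i] add.commute[of j i] by (simp only: ps.scale_minus_left minus_add_distrib)
qed

lemma commutator_jacobi:
  "pscale (of_int (k - j)) (commutator i (j + k) y) - pscale (of_int (k - i)) (commutator j (i + k) y)
    = pscale (of_int (j - i)) (commutator (i + j) k y)"
proof -
  have s: "i + (j + k) = i + j + k" "j + (i + k) = i + j + k" by simp_all
  have c: "of_int (k - j) * of_int (j + k - i) - of_int (k - i) * of_int (i + k - j)
    = (of_int (j - i) * of_int (k - (i + j)) :: 'k)"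
    by (simp add: algebra_simps)
  have d: "of_int (k - j) * central i (j + k) - of_int (k - i) * central j (i + k)
    = of_int (j - i) * central (i + j) k"
  proof (cases "i + j + k = 0")
    case True
    then have k: "k = - i - j" by simp
    have "(k - j) * (i ^ 3 - i) - (k - i) * (j ^ 3 - j) = (j - i) * ((i + j) ^ 3 - (i + j))"
      unfolding k power3_eq_cube by (simp add: algebra_simps)
    then have "of_int (k - j) * of_int (i ^ 3 - i) - of_int (k - i) * of_int (j ^ 3 - j)
        = (of_int (j - i) * of_int ((i + j) ^ 3 - (i + j)) :: 'k)"
      unfolding of_int_mult[symmetric] of_int_diff[symmetric] by (rule arg_cong)
    then have "(of_int (k - j) * of_int (i ^ 3 - i) - of_int (k - i) * of_int (j ^ 3 - j)) * (\<kappa> / 12)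
        = of_int (j - i) * of_int ((i + j) ^ 3 - (i + j)) * (\<kappa> / 12)"
      by (rule arg_cong)
    moreover have "i + (j + k) = 0" "j + (i + k) = 0" "i + j + k = 0" using True by simp_all
    ultimately show ?thesis
      unfolding central_def left_diff_distrib by (simp only: refl if_True times_divide_eq_left times_divide_eq_right mult.assoc)
  qed (simp add: central_def s)
  show ?thesis
    unfolding commutator_def s ps.scale_right_distrib ps.scale_scale
    unfolding c[symmetric] d[symmetric] ps.scale_left_diff_distrib by (simp only: diff_conv_add_uminus minus_add_distrib ac_simps)
qed

definition related :: "int \<Rightarrow> int \<Rightarrow> (nat multiset \<Rightarrow>\<^sub>0 'k) \<Rightarrow> bool" where
  "related i j y \<longleftrightarrow> e i (e j y) = e j (e i y) + commutator i j y"

lemma related_swap: "related i j y \<Longrightarrow> related j i y"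
  by (simp add: related_def commutator_swap[of j i])

lemma related_add: "related i j y \<Longrightarrow> related i j z \<Longrightarrow> related i j (y + z)"
  by (simp add: related_def e_add commutator_add)

lemma related_scale: "related i j y \<Longrightarrow> related i j (pscale c y)"
  by (simp add: related_def e_scale commutator_scale ps.scale_right_distrib)

lemma related_zero: "related i j 0"
  using related_scale[of i j 0 0] by (simp add: related_def commutator_def)

lemma related_supported:
  assumes "y \<in> supported A" "\<And>m. m \<in> A \<Longrightarrow> related i j (monom m)"
  shows "related i j y"
  using assms(1)
proof (induction rule: lin_induct)
  case (single b c)
  show ?case using related_scale[OF assms(2)[OF single], of c] by (simp add: pscale_single)
qed (simp_all add: related_add related_zero)

text \<open>If \<open>gen n\<close> can be prepended to \<open>m\<close> without reordering, the relation is the recursion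
for the action on the longer monomial.\<close>

lemma related_leftmost:
  assumes "\<forall>x\<in>#m. x \<le> n" "gen n < i"
  shows "related i (gen n) (monom m)"
  using assms by (simp add: related_def act_leftmost act_add_mset)

lemma related_lead:
  assumes n: "\<forall>x\<in>#u. x \<le> n" and i: "gen n < i" and j: "gen n < j"
  shows "related i (gen n) (lead j u)"
proof (cases "j < t")
  case True
  have "\<forall>x\<in>#add_mset (idx j) u. x \<le> n" using n j by (auto simp: gen_def idx_def)
  from related_leftmost[OF this i] show ?thesis by (simp add: lead_def True)
next
  case False
  then show ?thesis
    using related_scale[OF related_leftmost[OF n i], of "\<chi> j"] by (simp add: lead_def pscale_single)
qed

text \<open>For \<open>m = e\<^sub>k u\<close> with leftmost letter \<open>e\<^sub>k\<close> and \<open>k < j < i\<close>, expand \<open>e\<^sub>i e\<^sub>j e\<^sub>k u\<close> by moving \<open>e\<^sub>k\<close> to the left past both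
\<open>e\<^sub>j\<close> and \<open>e\<^sub>i\<close>, and likewise with \<open>i\<close> and \<open>j\<close> exchanged.  In the difference the mixed
terms cancel, and the Jacobi identity together with the relations on \<open>u\<close> gives the claim.  Moving \<open>e\<^sub>k\<close>
past \<open>e\<^sub>i\<close> in front of \<open>e\<^sub>j u\<close> is where an induction on the degree alone does not suffice: \<open>e\<^sub>j u\<close> is as
long as \<open>m\<close>, but \<open>e\<^sub>k\<close> is still leftmost in its leading term (\<open>related_lead\<close>).\<close>

lemma related_monom: "related i j (monom m)"
proof (induction "size m" arbitrary: m i j rule: less_induct)
  case less
  have main: "related i j (monom m)" if ji: "j < i" for i j
  proof (cases "m = {#}")
    case True
    show ?thesis
    proof (cases "j < t")
      case True
      then show ?thesis using related_leftmost[of m "idx j" i] ji \<open>m = {#}\<close> by (simp add: gen_idx)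
    next
      case False
      have "central i j = 0" using False ji t_nonneg by (auto simp: central_def)
      moreover have "e i (e j (monom m)) = e j (e i (monom m))"
        using False ji unfolding True e_monom by (simp add: act_empty e_single pscale_single mult.commute)
      moreover have "pscale (of_int (j - i)) (e (i + j) (monom m)) = 0"
        using character[of i j] False ji t_nonneg unfolding True e_monom
        by (simp add: act_empty pscale_single)
      ultimately show ?thesis
        unfolding related_def commutator_def by simp
    qed
  next
    case False
    define n u where "n = Max_mset m" and "u = m - {#n#}"
    have m: "m = add_mset n u"
      using False Max_in[of "set_mset m"] by (simp add: n_def u_def)
    have n: "\<forall>x\<in>#u. x \<le> n" by (auto simp: n_def u_def dest: in_diffD)
    let ?k = "gen n"
    have IH: "related i j y" if "y \<in> supported {x. size x \<le> size u}" for i j y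
    proof (rule related_supported[OF that])
      fix x :: "nat multiset" assume "x \<in> {x. size x \<le> size u}"
      then have "size x < size m" by (simp add: m)
      then show "related i j (monom x)" by (rule less)
    qed
    have IHu: "related i j (monom u)" for i j
      by (rule IH) (auto intro: supported_single)
    show ?thesis
    proof (cases "?k < j")
      case False
      then have "j < t" using gen_less[of n] by linarith
      moreover have "\<forall>x\<in>#m. x \<le> idx j" using n m False by (auto simp: gen_def idx_def)
      ultimately show ?thesis using related_leftmost[of m "idx j" i] ji by (simp add: gen_idx)
    next
      case kj: True
      then have ki: "?k < i" using ji by simp
      have rk: "related i' ?k (act j' u)" if "?k < i'" "?k < j'" for i' j'
        using related_add[OF related_lead[OF n that] IH[OF act_minus_lead[of j' u]]] by simp
      have step: "e i' (e j' (monom m)) = e ?k (e i' (e j' (monom u))) + commutator i' ?k (e j' (monom u))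
          + commutator j' ?k (e i' (monom u)) + pscale (of_int (?k - j')) (commutator i' (j' + ?k) (monom u))"
        if "?k < i'" "?k < j'" for i' j'
      proof -
        have "e i' (e j' (monom m)) = e i' (e ?k (act j' u)) + e i' (commutator j' ?k (monom u))"
          unfolding m e_monom act_add_mset[OF n that(2)] e_add ..
        also have "e i' (e ?k (act j' u)) = e ?k (e i' (act j' u)) + commutator i' ?k (act j' u)"
          using rk[OF that] by (simp add: related_def)
        also have "e i' (commutator j' ?k (monom u)) =
            commutator j' ?k (e i' (monom u)) + pscale (of_int (?k - j')) (commutator i' (j' + ?k) (monom u))"
          using IHu[of i' "j' + ?k"] unfolding related_def
          by (simp add: commutator_def e_add e_scale ps.scale_right_distrib)
        finally show ?thesis by (simp add: add.assoc)
      qed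
      have "e i (e j (monom m)) - e j (e i (monom m)) =
          e ?k (e i (e j (monom u)) - e j (e i (monom u)))
          + (pscale (of_int (?k - j)) (commutator i (j + ?k) (monom u))
             - pscale (of_int (?k - i)) (commutator j (i + ?k) (monom u)))"
        unfolding step[OF ki kj] step[OF kj ki] e_diff by (simp add: algebra_simps)
      also have "\<dots> = e ?k (commutator i j (monom u))
          + pscale (of_int (j - i)) (commutator (i + j) ?k (monom u))"
        using IHu[of i j] unfolding commutator_jacobi related_def by simp
      also have "\<dots> = pscale (of_int (j - i)) (e ?k (e (i + j) (monom u)) + commutator (i + j) ?k (monom u))
          + pscale (central i j) (e ?k (monom u))"
        by (simp add: commutator_def[of i j] e_add e_scale ps.scale_right_distrib)
      also have "e ?k (e (i + j) (monom u)) + commutator (i + j) ?k (monom u) = e (i + j) (e ?k (monom u))"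
        using IHu[of "i + j" ?k] unfolding related_def by simp
      also have "e ?k (monom u) = monom m"
        unfolding m by (simp add: act_leftmost[OF n])
      finally show ?thesis unfolding related_def commutator_def[of i j "monom m"]
        by (simp add: algebra_simps)
    qed
  qed
  show ?case
  proof (cases i j rule: linorder_cases)
    case less
    then show ?thesis by (rule related_swap[OF main])
  next
    case equal
    have "central j j = 0" by (simp add: central_def)
    then show ?thesis by (simp add: equal related_def commutator_def)
  qed (rule main)
qed

theorem e_commutator: "e i (e j y) = e j (e i y) + commutator i j y"
proof -
  have "related i j y"
    by (rule related_supported[of y UNIV]) (simp_all add: supported_def related_monom)
  then show ?thesis by (simp only: related_def)
qed

end

section \<open>Representation of the Virasoro algebra on the induced module\<close>

lemma vir_scale_eq: "vir_scale = pscale"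
  by (simp add: vir_scale_def pscale_def fun_eq_iff)

context vir_character
begin

definition basis_action :: "vir_basis \<Rightarrow> (nat multiset \<Rightarrow>\<^sub>0 'k) \<Rightarrow> nat multiset \<Rightarrow>\<^sub>0 'k" where
  "basis_action b y = (case b of E i \<Rightarrow> e i y | C \<Rightarrow> pscale \<kappa> y)"

definition action :: "'k vir \<Rightarrow> (nat multiset \<Rightarrow>\<^sub>0 'k) \<Rightarrow> nat multiset \<Rightarrow>\<^sub>0 'k" where
  "action x y = lin (\<lambda>b. basis_action b y) x"

lemma action_vir_add: "action (x + x') y = action x y + action x' y"
  by (simp add: action_def lin_add)

lemma action_vir_scale: "action (vir_scale a x) y = pscale a (action x y)"
  by (simp add: action_def lin_scale vir_scale_eq)

lemma action_basis: "action (Poly_Mapping.single b a) y = pscale a (basis_action b y)"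
  by (simp add: action_def lin_single)

lemma basis_action_add: "basis_action b (y + z) = basis_action b y + basis_action b z"
  by (simp add: basis_action_def e_add ps.scale_right_distrib split: vir_basis.split)

lemma basis_action_scale: "basis_action b (pscale a y) = pscale a (basis_action b y)"
  by (simp add: basis_action_def e_scale mult.commute split: vir_basis.split)

lemma action_add: "action x (y + z) = action x y + action x z"
  by (induction x rule: vir_induct)
     (simp_all add: action_basis action_vir_add action_vir_scale basis_action_add ps.scale_right_distrib)

lemma action_scale: "action x (pscale a y) = pscale a (action x y)"
  by (induction x rule: vir_induct)
     (simp_all add: action_basis action_vir_add action_vir_scale basis_action_scale ps.scale_right_distrib mult.commute)

lemma action_vir_basis_bracket:
  "action (vir_basis_bracket a b) y = basis_action a (basis_action b y) - basis_action b (basis_action a y)"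
proof (cases "\<exists>i j. a = E i \<and> b = E j")
  case True
  then obtain i j where "a = E i" "b = E j" by blast
  moreover have "action (vir_basis_bracket (E i) (E j)) y = commutator i j y"
    by (simp add: action_vir_add action_vir_scale action_basis basis_action_def commutator_def central_def)
       (simp add: action_def)
  ultimately show ?thesis using e_commutator[of i j y] by (simp add: basis_action_def)
next
  case False
  then show ?thesis by (cases a; cases b) (auto simp: basis_action_def action_def e_scale)
qed

lemma action_bracket: "action (vir_bracket x x') y = action x (action x' y) - action x' (action x y)"
proof (induction x rule: vir_induct)
  case (basis a)
  show ?case
    by (induction x' rule: vir_induct)
       (simp_all add: vir_bracket_basis action_basis action_vir_basis_bracket vir_bracket_bilinear
         action_vir_add action_vir_scale basis_action_add basis_action_scale ps.scale_right_diff_distrib)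
qed (simp_all add: vir_bracket_bilinear action_vir_add action_vir_scale action_add action_scale
      ps.scale_right_diff_distrib)

text \<open>From here on \<open>rep.run\<close> is the action of the free algebra, \<open>rep.coset\<close> the projection to
the enveloping algebra and \<open>rep.M\<close> the induced module.\<close>

sublocale rep: lie_representation "vir_scale" vir_bracket pscale UNIV action
  by standard (simp_all add: vir.lie_subalgebra_def action_add action_scale action_vir_add action_vir_scale action_bracket)

end

section \<open>The annihilator of an induced module\<close>

text \<open>Combinations of words in the integers stand for elements of the free algebra on the \<open>e\<^sub>i\<close>.  The symbol
makes the letters commute; only its values on multisets of maximal size are of interest.\<close>

definition symbol :: "(int list \<Rightarrow>\<^sub>0 'k::field) \<Rightarrow> int multiset \<Rightarrow>\<^sub>0 'k" where
  "symbol = lin (\<lambda>w. Poly_Mapping.single (mset w) 1)"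

text \<open>The commutator of \<open>e\<^bsub>-n\<^esub>\<close> with a word, without the central terms.  These occur only at a letter \<open>n\<close>.\<close>

primrec ad_word :: "int \<Rightarrow> int list \<Rightarrow> int list \<Rightarrow>\<^sub>0 'k::field_char_0" where
  "ad_word n [] = 0"
| "ad_word n (i # w) = Poly_Mapping.single ((i - n) # w) (of_int (i + n)) +
     lin (\<lambda>v. Poly_Mapping.single (i # v) 1) (ad_word n w)"

lemma ad_word_supported: "ad_word n w \<in> supported {v. length v = length w}"
  by (induction w) (auto intro!: supported_add supported_single supported_lin)

lemma symbol_ad_word:
  "symbol (ad_word n w) =
     (\<Sum>i\<in>#mset w. Poly_Mapping.single (add_mset (i - n) (mset w - {#i#})) (of_int (i + n)))"
proof (induction w)
  case (Cons i w)
  have shift: "lin (\<lambda>v. Poly_Mapping.single (mset (i # v)) 1) (ad_word n w) =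
      lin (\<lambda>m. Poly_Mapping.single (add_mset i m) (1 :: 'a)) (symbol (ad_word n w))"
    by (simp add: symbol_def lin_lin lin_single)
  have sum: "lin f (\<Sum>j\<in>#M. g j) = (\<Sum>j\<in>#M. lin f (g j))" for f :: "int multiset \<Rightarrow> int multiset \<Rightarrow>\<^sub>0 'a" and M :: "int multiset" and g
    by (induction M) (simp_all add: lin_add)
  have "(\<Sum>j\<in>#mset w. Poly_Mapping.single (add_mset i (add_mset (j - n) (mset w - {#j#}))) (of_int (j + n))) =
    (\<Sum>j\<in>#mset w. Poly_Mapping.single (add_mset (j - n) (add_mset i (mset w) - {#j#})) (of_int (j + n) :: 'a))"
    by (intro arg_cong[of _ _ sum_mset] image_mset_cong) (auto simp: add_mset_commute)
  then show ?case
    by (simp add: symbol_def[THEN fun_cong] lin_add lin_single lin_lin)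
       (simp add: shift[unfolded mset.simps] Cons[unfolded symbol_def] sum lin_single pscale_single symbol_def)
qed (simp add: symbol_def)

text \<open>If \<open>a - n\<close> is a new letter, then the monomial in which it replaces one \<open>a\<close> in \<open>m\<close> can arise only from \<open>m\<close>,
and only by hitting one of the \<open>count m a\<close> copies of \<open>a\<close>.\<close>

lemma lookup_symbol_ad_word:
  fixes a n :: int
  assumes "a \<in># m" "a - n \<notin># m" "a - n \<notin># mset w"
  shows "Poly_Mapping.lookup (symbol (ad_word n w)) (add_mset (a - n) (m - {#a#})) =
    (if mset w = m then of_int (a + n) * of_nat (count m a) else (0 :: 'k::field_char_0))"
proof -
  have eq: "add_mset (i - n) (mset w - {#i#}) = add_mset (a - n) (m - {#a#}) \<longleftrightarrow> i = a \<and> mset w = m"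
    if "i \<in># mset w" for i
  proof
    assume *: "add_mset (i - n) (mset w - {#i#}) = add_mset (a - n) (m - {#a#})"
    then have "a - n \<in># add_mset (i - n) (mset w - {#i#})" by simp
    then have "i = a" using assms(3) by (auto dest: in_diffD)
    with * have "mset w - {#a#} = m - {#a#}" by simp
    then show "i = a \<and> mset w = m" using \<open>i = a\<close> that assms(1) by (metis insert_DiffM)
  qed auto
  have "lookup_sum": "Poly_Mapping.lookup (\<Sum>i\<in>#M. g i) x = (\<Sum>i\<in>#M. Poly_Mapping.lookup (g i) x)"
    for M :: "int multiset" and g :: "int \<Rightarrow> int multiset \<Rightarrow>\<^sub>0 'k" and x
    by (induction M) (simp_all add: lookup_add)
  have "Poly_Mapping.lookup (symbol (ad_word n w)) (add_mset (a - n) (m - {#a#})) =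
    (\<Sum>i\<in>#mset w. if i = a then (if mset w = m then of_int (a + n) else 0) else (0::'k))"
    unfolding symbol_ad_word lookup_sum
    by (intro arg_cong[of _ _ sum_mset] image_mset_cong) (auto simp: lookup_single when_def eq)
  also have "\<dots> = (if mset w = m then of_int (a + n) else 0) * of_nat (count (mset w) a)"
    by (rule sum_mset_delta)
  finally show ?thesis by auto
qed

context vir_character
begin

abbreviation run_word :: "int list \<Rightarrow> (nat multiset \<Rightarrow>\<^sub>0 'k) \<Rightarrow> nat multiset \<Rightarrow>\<^sub>0 'k" where
  "run_word w \<equiv> foldr e w"

definition run_words :: "(int list \<Rightarrow>\<^sub>0 'k) \<Rightarrow> (nat multiset \<Rightarrow>\<^sub>0 'k) \<Rightarrow> nat multiset \<Rightarrow>\<^sub>0 'k" where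
  "run_words q y = lin (\<lambda>w. run_word w y) q"

lemma run_words_single: "run_words (Poly_Mapping.single w a) y = pscale a (run_word w y)"
  by (simp add: run_words_def lin_single)

lemma run_words_add: "run_words (p + q) y = run_words p y + run_words q y"
  by (simp add: run_words_def lin_add)

text \<open>For \<open>i \<ge> t\<close> the leading term is a scalar multiple of the monomial, whereas a letter \<open>i < t\<close> lengthens it by one.\<close>

lemma e_supported:
  assumes "y \<in> supported {x. size x \<le> d}"
  shows "e i y \<in> supported {x. size x \<le> Suc d}" "t \<le> i \<Longrightarrow> e i y \<in> supported {x. size x \<le> d}"
proof -
  show "e i y \<in> supported {x. size x \<le> Suc d}"
    unfolding e_def using assms by (rule supported_lin) (rule supported_mono[OF act_supported], auto)
  have "act i m \<in> supported {x. size x \<le> d}" if "t \<le> i" "size m \<le> d" for m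
  proof -
    have "lead i m \<in> supported {x. size x \<le> d}" using that by (auto simp: lead_def intro: supported_single)
    moreover have "act i m - lead i m \<in> supported {x. size x \<le> d}"
      using that by (intro supported_mono[OF act_minus_lead]) auto
    ultimately have "lead i m + (act i m - lead i m) \<in> supported {x. size x \<le> d}"
      by (rule supported_add)
    then show ?thesis by simp
  qed
  then show "t \<le> i \<Longrightarrow> e i y \<in> supported {x. size x \<le> d}"
    unfolding e_def using assms by (auto intro: supported_lin)
qed

text \<open>Each letter raises the degree by at most one, and a letter \<open>\<ge> t\<close> does not raise it, so a word containing such a
letter contributes nothing in the top degree.\<close>

lemma run_word_top:
  "run_word w (monom {#}) - (if set w \<subseteq> {..<t} then monom (image_mset idx (mset w)) else 0)
     \<in> supported {x. size x < length w}"
proof (induction w)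
  case (Cons i w)
  define top where "top w = (if set w \<subseteq> {..<t} then monom (image_mset idx (mset w)) else 0)" for w
  define y where "y = run_word w (monom {#})"
  have y: "y - top w \<in> supported {x. size x < length w}"
    using Cons by (simp add: y_def top_def)
  have top: "top w \<in> supported {x. size x \<le> length w}"
    by (auto simp: top_def intro!: supported_single)
  have "y \<in> supported {x. size x \<le> length w}"
    using supported_add[OF supported_mono[OF y] top] by (simp add: subset_iff)
  have "e i y - top (i # w) \<in> supported {x. size x \<le> length w}"
  proof (cases "i < t")
    case True
    have "e i (y - top w) \<in> supported {x. size x \<le> length w}"
    proof (cases "length w")
      case 0
      then have "y - top w = 0" by (simp add: y_def top_def)
      then show ?thesis by simp
    next
      case (Suc d)
      then show ?thesis using e_supported(1)[of "y - top w" d i] y by (simp add: less_Suc_eq_le)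
    qed
    moreover have "e i (top w) - top (i # w) \<in> supported {x. size x \<le> length w}"
      using act_minus_lead[of i "image_mset idx (mset w)"] True by (auto simp: top_def lead_def)
    ultimately show ?thesis
      using supported_add by (fastforce simp: e_diff)
  next
    case False
    then show ?thesis using e_supported(2)[OF \<open>y \<in> _\<close>, of i] by (simp add: top_def)
  qed
  then show ?case by (simp add: y_def top_def less_Suc_eq_le del: e_monom)
qed simp

lemma run_word_ad_word:
  assumes "n \<notin> set w"
  shows "run_words (ad_word n w) y = e (- n) (run_word w y) - run_word w (e (- n) y)"
  using assms
proof (induction w)
  case (Cons i w)
  have cons: "run_words (lin (\<lambda>v. Poly_Mapping.single (i # v) 1) q) y = e i (run_words q y)" for q
    by (simp add: run_words_def lin_lin lin_single e_def)
  have "e (- n) (e i z) = e i (e (- n) z) + pscale (of_int (i + n)) (e (i - n) z)" for z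
    using Cons.prems e_commutator[of "- n" i z] by (simp add: commutator_def central_def)
  then show ?case using Cons
    by (simp add: run_words_add run_words_single cons e_diff)
qed (simp add: run_words_def)

lemma run_words_ad_word:
  assumes "q \<in> supported {w. n \<notin> set w}"
  shows "run_words (lin (ad_word n) q) y = e (- n) (run_words q y) - run_words q (e (- n) y)"
  using assms
proof (induction rule: lin_induct)
  case (single w a)
  then show ?case
    by (simp add: lin_single run_words_single run_word_ad_word[symmetric] e_scale ps.scale_right_diff_distrib[symmetric])
       (simp add: run_words_def lin_scale)
next
  case (add p q)
  then show ?case by (simp add: lin_add run_words_add e_add)
qed (simp add: run_words_def)

lemma lookup_run_words_vacuum:
  assumes q: "q \<in> supported {w. length w \<le> size m}" and m: "\<forall>i\<in>#m. i < t"
  shows "Poly_Mapping.lookup (run_words q (monom {#})) (image_mset idx m) = Poly_Mapping.lookup (symbol q) m"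
proof -
  have inj: "image_mset idx m = image_mset idx m' \<longleftrightarrow> m = m'" if "\<forall>i\<in>#m'. i < t" for m'
  proof
    assume "image_mset idx m = image_mset idx m'"
    then have "image_mset gen (image_mset idx m) = image_mset gen (image_mset idx m')" by simp
    moreover have "image_mset gen (image_mset idx x) = x" if "\<forall>i\<in>#x. i < t" for x
    proof -
      have "image_mset (gen \<circ> idx) x = image_mset id x"
        using that by (intro image_mset_cong) (auto simp: gen_idx)
      then show ?thesis by (simp add: multiset.map_comp)
    qed
    ultimately show "m = m'" using m that by simp
  qed simp
  have "Poly_Mapping.lookup (run_word w (monom {#})) (image_mset idx m) = (1 when mset w = m)"
    if "length w \<le> size m" for w
  proof -
    have "Poly_Mapping.lookup (run_word w (monom {#}) - (if set w \<subseteq> {..<t} then monom (image_mset idx (mset w)) else 0))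
      (image_mset idx m) = 0"
      using that by (intro supportedD[OF run_word_top]) auto
    then have "Poly_Mapping.lookup (run_word w (monom {#})) (image_mset idx m) =
      Poly_Mapping.lookup (if set w \<subseteq> {..<t} then monom (image_mset idx (mset w)) else 0) (image_mset idx m)"
      by (simp add: lookup_minus)
    also have "\<dots> = (1 when mset w = m)"
      using m inj[of "mset w"] by (auto simp: lookup_single when_def subset_iff)
    finally show ?thesis .
  qed
  then show ?thesis
    using q unfolding run_words_def symbol_def lookup_lin
    by (intro sum.cong) (auto simp: supported_def lookup_single)
qed

text \<open>Induction on the number of letters \<open>\<ge> t\<close> in \<open>m\<close>.  To remove one such letter \<open>a\<close>, pass to the commutator with
\<open>e\<^bsub>-n\<^esub>\<close>, which also acts as zero.\<close>

theorem symbol_zero: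
  assumes "\<And>y. run_words q y = 0" "q \<in> supported {w. length w \<le> size m}"
  shows "Poly_Mapping.lookup (symbol q) m = 0"
  using assms
proof (induction "size (filter_mset (\<lambda>i. t \<le> i) m)" arbitrary: q m)
  case 0
  then have "\<forall>i\<in>#m. i < t" by (simp add: filter_mset_eq_mempty_iff not_le)
  then show ?case using lookup_run_words_vacuum[of q m] 0 by simp
next
  case (Suc r)
  have "size (filter_mset (\<lambda>i. t \<le> i) m) \<noteq> 0" using Suc(2) by linarith
  then obtain a where a: "a \<in># m" "t \<le> a" by (auto simp: filter_mset_eq_mempty_iff)
  define B where "B = Max (insert 0 (abs ` (set_mset m \<union> \<Union> (set ` Poly_Mapping.keys q))))"
  have B: "\<bar>i\<bar> \<le> B" if "i \<in># m \<or> (\<exists>w\<in>Poly_Mapping.keys q. i \<in> set w)" for i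
    unfolding B_def using that by (intro Max_ge) auto
  \<comment> \<open>This makes both \<open>n\<close> and \<open>a - n\<close> exceed all occurring letters in absolute value.\<close>
  define n where "n = 2 * B + 1"
  have "0 \<le> B" unfolding B_def by (intro Max_ge) auto
  have aB: "\<bar>a\<bar> \<le> B" using B a by blast
  have an: "a - n \<notin># m" "a - n < t" "a + n \<noteq> 0"
    using B[of "a - n"] aB \<open>0 \<le> B\<close> t_nonneg a(2) by (auto simp: n_def)
  have anw: "a - n \<notin># mset w" "n \<notin> set w" if "w \<in> Poly_Mapping.keys q" for w
  proof -
    have "\<not> \<bar>a - n\<bar> \<le> B" "\<not> \<bar>n\<bar> \<le> B" using aB \<open>0 \<le> B\<close> by (auto simp: n_def)
    then show "a - n \<notin># mset w" "n \<notin> set w" using B that by auto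
  qed
  define m' where "m' = add_mset (a - n) (m - {#a#})"
  have "Poly_Mapping.lookup (symbol (lin (ad_word n) q)) m' = 0"
  proof (rule Suc(1))
    have m_eq: "m = add_mset a (m - {#a#})" using a by simp
    have "size (filter_mset (\<lambda>i. t \<le> i) (add_mset a x)) = Suc (size (filter_mset (\<lambda>i. t \<le> i) x))"
      "size (filter_mset (\<lambda>i. t \<le> i) (add_mset (a - n) x)) = size (filter_mset (\<lambda>i. t \<le> i) x)" for x
      using a(2) an(2) by simp_all
    from this(1)[of "m - {#a#}"] this(2)[of "m - {#a#}"]
    show "r = size (filter_mset (\<lambda>i. t \<le> i) m')"
      using Suc(2) unfolding m_eq[symmetric] m'_def by linarith
    have "q \<in> supported {w. n \<notin> set w}" using anw(2) by (auto simp: supported_def)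
    from run_words_ad_word[OF this] show "run_words (lin (ad_word n) q) y = 0" for y
      by (simp add: Suc.prems)
    have "size m' = size m"
      using arg_cong[OF m_eq, of size] unfolding m'_def by (simp only: size_add_mset)
    then show "lin (ad_word n) q \<in> supported {w. length w \<le> size m'}"
      using Suc.prems(2) by (auto intro!: supported_lin supported_mono[OF ad_word_supported])
  qed
  moreover have "Poly_Mapping.lookup (symbol (lin (ad_word n) q)) m' =
      of_int (a + n) * of_nat (count m a) * Poly_Mapping.lookup (symbol q) m"
  proof -
    have "Poly_Mapping.lookup (symbol (lin (ad_word n) q)) m' =
      (\<Sum>w\<in>Poly_Mapping.keys q. Poly_Mapping.lookup q w * Poly_Mapping.lookup (symbol (ad_word n w)) m')"
      by (simp add: symbol_def lin_lin lookup_lin)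
    also have "\<dots> = (\<Sum>w\<in>Poly_Mapping.keys q. of_int (a + n) * of_nat (count m a) *
        (Poly_Mapping.lookup q w * (if mset w = m then 1 else 0)))"
      unfolding m'_def using a an(1) anw(1)
      by (intro sum.cong refl, subst lookup_symbol_ad_word) (auto simp del: of_int_add)
    also have "\<dots> = of_int (a + n) * of_nat (count m a) * Poly_Mapping.lookup (symbol q) m"
      unfolding sum_distrib_left[symmetric] by (simp add: symbol_def lookup_lin lookup_single when_def)
    finally show ?thesis .
  qed
  moreover have "of_int (a + n) * of_nat (count m a) \<noteq> (0 :: 'k)"
    using an(3) a(1) by (simp del: of_int_add)
  ultimately show ?case by (metis mult_eq_0_iff)
qed

end

definition vir_words :: "(int list \<Rightarrow>\<^sub>0 'k::field_char_0) \<Rightarrow> 'k vir list \<Rightarrow>\<^sub>0 'k" where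
  "vir_words = lin (\<lambda>w. Poly_Mapping.single (map vir_e w) 1)"

lemma vir_words_single: "vir_words (Poly_Mapping.single w a) = Poly_Mapping.single (map vir_e w) a"
  by (simp add: vir_words_def lin_single pscale_single)

lemma vir_words_add: "vir_words (p + q) = vir_words p + vir_words q"
  by (simp add: vir_words_def lin_add)

lemma vir_words_diff: "vir_words (p - q) = vir_words p - vir_words q"
  by (simp add: vir_words_def lin_diff)

lemma vir_words_zero [simp]: "vir_words 0 = 0"
  by (simp add: vir_words_def)

lemma vir_words_scale: "vir_words (pscale a p) = pscale a (vir_words p)"
  by (simp add: vir_words_def lin_scale)

lemma vir_words_mult: "vir_words (p * q) = vir_words p * vir_words q"
proof -
  have "q \<in> supported UNIV" "p \<in> supported UNIV" by simp_all
  from this(2) show ?thesis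
  proof (induction rule: lin_induct)
    case (single w a)
    from \<open>q \<in> supported UNIV\<close> show ?case
      by (induction rule: lin_induct) (simp_all add: single_list_mult vir_words_single vir_words_add distrib_left)
  qed (simp_all add: vir_words_add distrib_right)
qed

context vir_character
begin

abbreviation U where "U \<equiv> U_vir :: ('k vir list \<Rightarrow>\<^sub>0 'k) set ring"

text \<open>The ideal \<open>(c - \<kappa>)\<close> is pulled back to the free algebra, where one can calculate with elements instead of cosets.\<close>

definition J :: "('k vir list \<Rightarrow>\<^sub>0 'k) set" where
  "J = {p. rep.coset p \<in> c_minus_ideal \<kappa>}"

lemma lists_UNIV_supported [simp]: "p \<in> supported (lists UNIV)"
  by (simp add: supported_def)

lemma coset_minus: "\<ominus>\<^bsub>U\<^esub> rep.coset p = rep.coset (- p)"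
proof (rule rep.U.minus_equality)
  have "rep.coset (- p) \<oplus>\<^bsub>U\<^esub> rep.coset p = rep.coset 0" by (simp add: rep.coset_add)
  also have "rep.coset 0 = rep.coset \<zero>\<^bsub>rep.free\<^esub>" by simp
  also have "\<dots> = vir.uea_ideal UNIV"
    by (rule rep.free.a_coset_add_zero[OF rep.relations.a_subset])
  finally show "rep.coset (- p) \<oplus>\<^bsub>U\<^esub> rep.coset p = \<zero>\<^bsub>U\<^esub>" by (simp add: vir.uea_def FactRing_def)
qed simp_all

lemma c_minus_ideal_eq: "c_minus_ideal \<kappa> = Idl\<^bsub>U\<^esub> {rep.coset (letter vir_c - const \<kappa>)}"
  unfolding c_minus_ideal_def vir.uea_in_def vir.uea_const_def a_minus_def coset_minus
  by (simp add: rep.coset_add)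

lemma c_minus_ideal_ideal: "ideal (c_minus_ideal \<kappa>) U"
  unfolding c_minus_ideal_eq by (rule rep.U.genideal_ideal) simp

lemma J_add: "p \<in> J \<Longrightarrow> q \<in> J \<Longrightarrow> p + q \<in> J"
  using additive_subgroup.a_closed[OF ideal.axioms(1)[OF c_minus_ideal_ideal], of "rep.coset p" "rep.coset q"]
  by (simp add: J_def rep.coset_add)

lemma J_mult: "p \<in> J \<Longrightarrow> q * p \<in> J" "p \<in> J \<Longrightarrow> p * q \<in> J"
  using ideal.I_l_closed[OF c_minus_ideal_ideal, of "rep.coset p" "rep.coset q"]
    ideal.I_r_closed[OF c_minus_ideal_ideal, of "rep.coset p" "rep.coset q"]
  by (simp_all add: J_def rep.coset_mult)

lemma J_relations: "p \<in> vir.uea_relations UNIV \<Longrightarrow> p \<in> J"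
proof -
  assume "p \<in> vir.uea_relations UNIV"
  then have "p \<in> vir.uea_ideal UNIV"
    unfolding vir.uea_ideal_def using rep.free.genideal_self[OF rep.relations_carrier] by blast
  then have "rep.coset p = \<zero>\<^bsub>U\<^esub>"
    using abelian_subgroup.a_rcos_const[OF rep.relations.abelian_subgroup] by (simp add: vir.uea_def FactRing_def)
  then show "p \<in> J"
    using additive_subgroup.zero_closed[OF ideal.axioms(1)[OF c_minus_ideal_ideal]] by (simp add: J_def)
qed

lemma J_c: "letter vir_c - const \<kappa> \<in> J"
  unfolding J_def c_minus_ideal_eq using rep.U.genideal_self' by simp

lemma J_scale: "p \<in> J \<Longrightarrow> pscale a p \<in> J"
  using J_mult(1)[of p "const a"] by (simp add: const_mult)

lemma J_zero: "0 \<in> J"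
  using J_scale[OF J_c, of 0] by simp

definition cong :: "('k vir list \<Rightarrow>\<^sub>0 'k) \<Rightarrow> ('k vir list \<Rightarrow>\<^sub>0 'k) \<Rightarrow> bool" (infix \<open>\<doteq>\<close> 50) where
  "p \<doteq> q \<longleftrightarrow> p - q \<in> J"

lemma cong_refl [simp]: "p \<doteq> p"
  by (simp add: cong_def J_zero)

lemma cong_J: "p \<doteq> q \<Longrightarrow> q \<in> J \<Longrightarrow> p \<in> J"
  using J_add[of "p - q" q] by (simp add: cong_def)

lemma cong_trans [trans]: "p \<doteq> q \<Longrightarrow> q \<doteq> r \<Longrightarrow> p \<doteq> r"
  using J_add[of "p - q" "q - r"] by (simp add: cong_def)

lemma cong_add: "p \<doteq> p' \<Longrightarrow> q \<doteq> q' \<Longrightarrow> p + q \<doteq> p' + q'"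
  using J_add[of "p - p'" "q - q'"] by (simp add: cong_def algebra_simps)

lemma cong_scale: "p \<doteq> q \<Longrightarrow> pscale a p \<doteq> pscale a q"
  using J_scale[of "p - q" a] by (simp add: cong_def ps.scale_right_diff_distrib)

lemma cong_mult: "p \<doteq> p' \<Longrightarrow> q \<doteq> q' \<Longrightarrow> p * q \<doteq> p' * q'"
  using J_add[OF J_mult(2)[of "p - p'" q] J_mult(1)[of "q - q'" p']]
  by (simp add: cong_def algebra_simps)

lemma cong_letter_add: "letter (x + y) \<doteq> letter x + letter y"
proof -
  have "letter (x + y) - letter x - letter y \<in> J"
    by (rule J_relations) (auto simp: vir.uea_relations_def)
  then show ?thesis by (simp add: cong_def diff_diff_add)
qed

lemma cong_letter_scale: "letter (vir_scale a x) \<doteq> pscale a (letter x)"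
  using J_relations[of "letter (vir_scale a x) - const a * letter x"]
  by (auto simp: cong_def vir.uea_relations_def const_mult)

lemma cong_letter_bracket: "letter x * letter y - letter y * letter x \<doteq> letter (vir_bracket x y)"
  using J_relations[of "letter x * letter y - letter y * letter x - letter (vir_bracket x y)"]
  by (auto simp: cong_def vir.uea_relations_def)

lemma cong_letter_c: "letter vir_c \<doteq> const \<kappa>"
  using J_c by (simp add: cong_def)

text \<open>A vector is a combination of the \<open>e\<^sub>i\<close> and \<open>c\<close>, and \<open>c\<close> is congruent to the scalar \<open>\<kappa>\<close>.\<close>

lemma cong_vir_words: "\<exists>q. p \<doteq> vir_words q"
proof -
  have letter: "\<exists>q. letter x \<doteq> vir_words q" for x
  proof (induction x rule: vir_induct)
    case (basis b)
    show ?case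
    proof (cases b)
      case (E i)
      then show ?thesis by (intro exI[of _ "Poly_Mapping.single [i] 1"]) (simp add: vir_words_single)
    next
      case C
      then show ?thesis using cong_letter_c by (intro exI[of _ "const \<kappa>"]) (simp add: vir_words_single)
    qed
  next
    case (scale a x)
    then show ?case using cong_trans[OF cong_letter_scale cong_scale] vir_words_scale by metis
  next
    case (add x y)
    then show ?case using cong_trans[OF cong_letter_add cong_add] vir_words_add by metis
  qed
  have word: "\<exists>q. Poly_Mapping.single w a \<doteq> vir_words q" for w a
  proof (induction w)
    case Nil
    show ?case by (intro exI[of _ "Poly_Mapping.single [] a"]) (simp add: vir_words_single)
  next
    case (Cons x w)
    then obtain q q' where "Poly_Mapping.single w a \<doteq> vir_words q" "letter x \<doteq> vir_words q'" using letter by blast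
    then have "letter x * Poly_Mapping.single w a \<doteq> vir_words (q' * q)"
      unfolding vir_words_mult by (intro cong_mult)
    then show ?case by (auto simp: single_list_mult)
  qed
  have "p \<in> supported UNIV" by simp
  then show ?thesis
  proof (induction rule: lin_induct)
    case zero
    show ?case by (intro exI[of _ 0]) simp
  next
    case (add p q)
    then show ?case using cong_add vir_words_add by metis
  qed (rule word)
qed

definition Low :: "nat \<Rightarrow> (int list \<Rightarrow>\<^sub>0 'k) set" where
  "Low d = {q. \<exists>r\<in>supported {w. length w < d}. vir_words q \<doteq> vir_words r}"

lemma Low_supported: "q \<in> supported {w. length w < d} \<Longrightarrow> q \<in> Low d"
  unfolding Low_def using cong_refl by blast

lemma Low_cong: "vir_words p \<doteq> vir_words q \<Longrightarrow> q \<in> Low d \<Longrightarrow> p \<in> Low d"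
  unfolding Low_def using cong_trans by blast

lemma Low_add: "p \<in> Low d \<Longrightarrow> q \<in> Low d \<Longrightarrow> p + q \<in> Low d"
  unfolding Low_def mem_Collect_eq vir_words_add
  by (metis cong_add vir_words_add supported_add)

lemma Low_scale: "p \<in> Low d \<Longrightarrow> pscale a p \<in> Low d"
  unfolding Low_def mem_Collect_eq
  by (metis cong_scale vir_words_scale supported_scale)

lemma Low_sum: "(\<And>x. x \<in> A \<Longrightarrow> f x \<in> Low d) \<Longrightarrow> (\<Sum>x\<in>A. f x) \<in> Low d"
  by (induction A rule: infinite_finite_induct) (auto intro: Low_add Low_supported)

lemma Low_Cons: "q \<in> Low d \<Longrightarrow> Poly_Mapping.single [i] 1 * q \<in> Low (Suc d)"
proof -
  assume "q \<in> Low d"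
  then obtain r where r: "r \<in> supported {w. length w < d}" "vir_words q \<doteq> vir_words r"
    by (auto simp: Low_def)
  have "Poly_Mapping.single [i] 1 * r \<in> supported {w. length w < Suc d}"
    using r(1)
    by (induction rule: lin_induct) (auto simp: single_list_mult distrib_left intro: supported_single supported_add)
  moreover have "vir_words (Poly_Mapping.single [i] 1 * q) \<doteq> vir_words (Poly_Mapping.single [i] 1 * r)"
    unfolding vir_words_mult using r(2) by (intro cong_mult) auto
  ultimately show ?thesis unfolding Low_def by blast
qed

lemma cong_swap:
  "vir_words (Poly_Mapping.single [i] 1 * Poly_Mapping.single [j] 1 - Poly_Mapping.single [j] 1 * Poly_Mapping.single [i] 1)
    \<doteq> vir_words (pscale (of_int (j - i)) (Poly_Mapping.single [i + j] 1) + const (central i j))"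
proof -
  have "letter (vir_e i) * letter (vir_e j) - letter (vir_e j) * letter (vir_e i) \<doteq>
      letter (vir_scale (of_int (j - i)) (vir_e (i + j)) +
        (if i + j = 0 then vir_scale (of_int (i ^ 3 - i) / 12) vir_c else 0))"
    using cong_letter_bracket[of "vir_e i" "vir_e j"] unfolding vir_bracket_basis vir_basis_bracket.simps .
  also have "\<dots> \<doteq> letter (vir_scale (of_int (j - i)) (vir_e (i + j))) +
      letter (if i + j = 0 then vir_scale (of_int (i ^ 3 - i) / 12) vir_c else 0)"
    by (rule cong_letter_add)
  also have "\<dots> \<doteq> pscale (of_int (j - i)) (letter (vir_e (i + j))) + const (central i j)"
  proof (rule cong_add[OF cong_letter_scale])
    show "letter (if i + j = 0 then vir_scale (of_int (i ^ 3 - i) / 12) vir_c else 0) \<doteq> const (central i j)"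
    proof (cases "i + j = 0")
      case True
      show ?thesis
        using cong_trans[OF cong_letter_scale cong_scale[OF cong_letter_c], of "of_int (i ^ 3 - i) / 12"] True
        by (simp add: central_def pscale_single)
    next
      case False
      show ?thesis using cong_letter_scale[of 0 0] False by (simp add: central_def)
    qed
  qed
  finally show ?thesis
    by (simp add: vir_words_diff vir_words_mult vir_words_single vir_words_add vir_words_scale)
qed

lemma Low_swap:
  "Poly_Mapping.single (i # j # w) 1 - Poly_Mapping.single (j # i # w) 1 \<in> Low (Suc (Suc (length w)))"
proof -
  let ?w = "Poly_Mapping.single w 1 :: int list \<Rightarrow>\<^sub>0 'k"
  have "vir_words ((Poly_Mapping.single [i] 1 * Poly_Mapping.single [j] 1 - Poly_Mapping.single [j] 1 * Poly_Mapping.single [i] 1) * ?w)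
    \<doteq> vir_words ((pscale (of_int (j - i)) (Poly_Mapping.single [i + j] 1) + const (central i j)) * ?w)"
    unfolding vir_words_mult[of _ ?w] by (rule cong_mult[OF cong_swap cong_refl])
  moreover have "(pscale (of_int (j - i)) (Poly_Mapping.single [i + j] 1) + const (central i j)) * ?w
      \<in> supported {v. length v < Suc (Suc (length w))}"
    by (auto simp: distrib_right single_list_mult pscale_single intro!: supported_add supported_single)
  ultimately show ?thesis
    by (auto intro!: Low_cong[OF _ Low_supported] simp: left_diff_distrib single_list_mult)
qed

text \<open>Two letters commute up to shorter words, so the class of a word modulo shorter words depends only on its
letters.\<close>

lemma Low_perm:
  "mset w = mset w' \<Longrightarrow> Poly_Mapping.single w 1 - Poly_Mapping.single w' 1 \<in> Low (length w)"
proof (induction w arbitrary: w')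
  case Nil
  then show ?case by (auto intro: Low_supported)
next
  case (Cons a u)
  have Cons_diff: "Poly_Mapping.single (b # x) 1 - Poly_Mapping.single (b # y) 1 =
      Poly_Mapping.single [b] 1 * (Poly_Mapping.single x 1 - Poly_Mapping.single y 1 :: int list \<Rightarrow>\<^sub>0 'k)" for b x y
    by (simp add: right_diff_distrib single_list_mult)
  have move: "Poly_Mapping.single (a # s @ v) 1 - Poly_Mapping.single (s @ a # v) 1 \<in> Low (Suc (length (s @ v)))" for s v
  proof (induction s)
    case (Cons b s)
    have "Poly_Mapping.single (b # a # s @ v) 1 - Poly_Mapping.single (b # s @ a # v) 1 \<in> Low (Suc (length ((b # s) @ v)))"
      unfolding Cons_diff[of b] using Low_Cons[OF Cons] by simp
    with Low_swap[of a b "s @ v"] show ?case using Low_add by fastforce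
  qed (auto intro: Low_supported)
  have "a \<in> set w'" using Cons.prems by (metis list.set_intros(1) mset_eq_setD)
  then obtain s v where w': "w' = s @ a # v" by (meson split_list)
  then have eq: "mset u = mset (s @ v)" using Cons.prems by simp
  then have len: "length u = length (s @ v)" by (rule mset_eq_length)
  have "Poly_Mapping.single (a # u) 1 - Poly_Mapping.single (a # s @ v) 1 \<in> Low (Suc (length u))"
    unfolding Cons_diff by (rule Low_Cons[OF Cons.IH[OF eq]])
  from Low_add[OF this move[of s v, folded len]] show ?case unfolding w' by simp
qed

text \<open>Sorting all words of maximal length turns \<open>q\<close> into the image of its symbol.\<close>

lemma Low_if_symbol_zero:
  assumes q: "q \<in> supported {w. length w \<le> d}"
    and zero: "\<And>m. size m = d \<Longrightarrow> Poly_Mapping.lookup (symbol q) m = 0"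
  shows "q \<in> Low d"
proof -
  define canon :: "int list \<Rightarrow> int list \<Rightarrow>\<^sub>0 'k" where
    "canon w = (if length w = d then Poly_Mapping.single (sorted_list_of_multiset (mset w)) 1 else 0)" for w
  have "Poly_Mapping.single w 1 - canon w \<in> Low d" if "w \<in> Poly_Mapping.keys q" for w
    using that q Low_perm[of w "sorted_list_of_multiset (mset w)"]
    by (auto simp: canon_def supported_def intro!: Low_supported supported_single)
  then have "lin (\<lambda>w. Poly_Mapping.single w 1 - canon w) q \<in> Low d"
    unfolding lin_def by (intro Low_sum Low_scale)
  moreover have "lin (\<lambda>w. Poly_Mapping.single w 1 - canon w) q = q - lin canon q"
  proof -
    have "lin (\<lambda>w. Poly_Mapping.single w 1 - canon w) q =
      (\<Sum>w\<in>Poly_Mapping.keys q. pscale (Poly_Mapping.lookup q w) (Poly_Mapping.single w 1)) - lin canon q"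
      by (simp add: lin_def ps.scale_right_diff_distrib sum_subtractf)
    then show ?thesis by (simp add: poly_mapping_sum_single[of q, symmetric])
  qed
  moreover have "lin canon q = 0"
  proof -
    let ?sort = "\<lambda>m. if size m = d then Poly_Mapping.single (sorted_list_of_multiset m) 1 else 0"
    have "lin canon q = lin ?sort (symbol q)"
      by (simp add: symbol_def lin_lin lin_single canon_def[abs_def])
    also have "\<dots> = 0"
      unfolding lin_def using zero by (intro sum.neutral) auto
    finally show ?thesis .
  qed
  ultimately show ?thesis by simp
qed

lemma run_vir_words: "rep.run (vir_words q) y = run_words q y"
proof -
  have foldr: "foldr action (map vir_e w) y = run_word w y" for w
    by (induction w) (simp_all add: action_basis basis_action_def)
  have "q \<in> supported UNIV" by simp
  then show ?thesis
    by (induction rule: lin_induct)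
       (simp_all add: vir_words_single rep.run_single foldr run_words_single vir_words_add rep.run_plus run_words_add,
        simp add: run_words_def)
qed

lemma run_J:
  assumes "p \<in> J" shows "rep.run p y = 0"
proof -
  have "c_minus_ideal \<kappa> \<subseteq> annihilator U rep.M"
    unfolding c_minus_ideal_eq
  proof (rule rep.U.genideal_minimal)
    show "ideal (annihilator U rep.M) U" by (rule ideal_annihilator[OF rep.rep_left_module])
    show "{rep.coset (letter vir_c - const \<kappa>)} \<subseteq> annihilator U rep.M"
      by (auto simp: annihilator_def rep.coset_smult rep.run_diff rep.run_single action_basis basis_action_def)
  qed
  then show ?thesis using assms by (auto simp: J_def annihilator_def rep.coset_smult)
qed

lemma vir_words_in_J:
  assumes "q \<in> supported {w. length w < d}" "\<And>y. run_words q y = 0"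
  shows "vir_words q \<in> J"
  using assms
proof (induction d arbitrary: q)
  case 0
  then have "q = 0" by (simp add: supported_def)
  then show ?case by (simp add: J_zero)
next
  case (Suc d)
  then have q: "q \<in> supported {w. length w \<le> d}" by (simp add: less_Suc_eq_le)
  then have "q \<in> Low d" using symbol_zero Suc.prems(2) by (intro Low_if_symbol_zero) auto
  then obtain r where r: "r \<in> supported {w. length w < d}" "vir_words q \<doteq> vir_words r" by (auto simp: Low_def)
  have "run_words r y = 0" for y
    using run_J[OF r(2)[unfolded cong_def], of y] Suc.prems(2) by (simp add: rep.run_diff run_vir_words)
  with Suc.IH r(1) have "vir_words r \<in> J" by blast
  then show ?case by (rule cong_J[OF r(2)])
qed

text \<open>An element that kills the module is congruent to a combination of words in the \<open>e\<^sub>i\<close>.  This combination also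
kills the module, since the ideal does, and therefore lies in the ideal.\<close>

theorem annihilator_eq: "annihilator U rep.M = c_minus_ideal \<kappa>"
proof (intro subset_antisym subsetI)
  fix X assume X: "X \<in> annihilator U rep.M"
  then obtain p where p: "X = rep.coset p" by (auto simp: annihilator_def rep.uea_carrier)
  then have run: "rep.run p y = 0" for y using X by (simp add: annihilator_def rep.coset_smult)
  obtain q where q: "p \<doteq> vir_words q" using cong_vir_words by blast
  have "run_words q y = 0" for y
    using run_J[OF q[unfolded cong_def], of y] run by (simp add: rep.run_diff run_vir_words)
  moreover have "q \<in> supported {w. length w < Suc (Max (length ` Poly_Mapping.keys q))}"
    by (auto simp: supported_def less_Suc_eq_le)
  ultimately have "vir_words q \<in> J" by (intro vir_words_in_J)
  then have "p \<in> J" by (rule cong_J[OF q])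
  then show "X \<in> c_minus_ideal \<kappa>" by (simp add: p J_def)
next
  fix X assume X: "X \<in> c_minus_ideal \<kappa>"
  then have "X \<in> carrier U"
    using additive_subgroup.a_subset[OF ideal.axioms(1)[OF c_minus_ideal_ideal]] by blast
  then obtain p where "X = rep.coset p" by (auto simp: rep.uea_carrier)
  with X have "p \<in> J" by (simp add: J_def)
  with run_J \<open>X = _\<close> show "X \<in> annihilator U rep.M" by (simp add: annihilator_def rep.coset_smult)
qed

text \<open>Every monomial arises from \<open>1\<close> by prepending its letters, in the order from right to left.\<close>

lemma mem_if_generator_mem:
  assumes run: "\<And>p y. y \<in> N \<Longrightarrow> rep.run p y \<in> N" and zero: "0 \<in> N"
    and add: "\<And>y z. y \<in> N \<Longrightarrow> z \<in> N \<Longrightarrow> y + z \<in> N" and one: "monom {#} \<in> N"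
  shows "z \<in> N"
proof -
  have monom: "monom m \<in> N" for m
  proof (induction m rule: multiset_induct_max)
    case (add n m)
    then show ?case
      using run[OF add.IH, of "letter (vir_e (gen n))"]
      by (simp add: rep.run_single action_basis basis_action_def act_leftmost)
  qed (rule one)
  have "z \<in> supported UNIV" by simp
  then show ?thesis
  proof (induction rule: lin_induct)
    case (single m a)
    show ?case using run[OF monom, of "const a" m] by (simp add: rep.run_single pscale_single)
  qed (auto intro: zero add)
qed

lemma generator_cyclic: "\<exists>p. rep.run p (monom {#}) = y"
proof -
  have "y \<in> {y. \<exists>p. rep.run p (monom {#}) = y}"
  proof (rule mem_if_generator_mem)
    show "rep.run p y \<in> {y. \<exists>p. rep.run p (monom {#}) = y}" if "y \<in> {y. \<exists>p. rep.run p (monom {#}) = y}" for p y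
      using that by (auto simp: rep.run_mult[symmetric])
    show "y + z \<in> {y. \<exists>p. rep.run p (monom {#}) = y}"
      if "y \<in> {y. \<exists>p. rep.run p (monom {#}) = y}" "z \<in> {y. \<exists>p. rep.run p (monom {#}) = y}" for y z
      using that by (auto simp: rep.run_plus[symmetric])
    show "0 \<in> {y. \<exists>p. rep.run p (monom {#}) = y}" by (auto intro: exI[of _ 0])
    show "monom {#} \<in> {y. \<exists>p. rep.run p (monom {#}) = y}" by (auto intro: exI[of _ 1])
  qed
  then show ?thesis by simp
qed

end

section \<open>Whittaker modules are simple\<close>

locale vir_whittaker = vir_character 1 \<chi> \<kappa> for \<chi> :: "int \<Rightarrow> 'k::field_char_0" and \<kappa> +
  assumes chi_2: "\<chi> 2 \<noteq> 0"
begin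

text \<open>All \<open>e\<^sub>i\<close> with \<open>i \<ge> 3\<close> are multiples of brackets \<open>[e\<^sub>1, e\<^bsub>i-1\<^esub>]\<close>.\<close>

lemma chi_zero: "3 \<le> i \<Longrightarrow> \<chi> i = 0"
proof -
  assume i: "3 \<le> i"
  have "of_int (i - 1 - 1) * \<chi> (1 + (i - 1)) = 0" using i by (intro character) auto
  moreover have "of_int (i - 1 - 1) \<noteq> (0 :: 'k)" unfolding of_int_eq_0_iff using i by simp
  ultimately show ?thesis by simp
qed

text \<open>With \<open>t = 1\<close> the number \<open>n\<close> stands for \<open>e\<^bsub>-n\<^esub>\<close>.  In general \<open>e\<^sub>i\<close> is given the weight \<open>2 - i\<close>.  Then \<open>e\<^sub>2\<close> has the
weight \<open>0\<close> of the scalar \<open>\<chi> 2\<close> by which it acts on the generator, and a bracket has weight two less than the corresponding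
product.\<close>

definition weight :: "nat multiset \<Rightarrow> int" where
  "weight m = (\<Sum>n\<in>#m. int n + 2)"

abbreviation below :: "int \<Rightarrow> (nat multiset \<Rightarrow>\<^sub>0 'k) set" where
  "below d \<equiv> supported {x. weight x \<le> d}"

lemma weight_simps [simp]: "weight {#} = 0" "weight (add_mset n m) = int n + 2 + weight m"
  by (simp_all add: weight_def)

lemma weight_nonneg: "0 \<le> weight m"
  by (induction m) auto

lemma weight_zero: "weight m \<le> 0 \<Longrightarrow> m = {#}"
proof (cases m)
  case (add n u)
  then show "weight m \<le> 0 \<Longrightarrow> m = {#}" using weight_nonneg[of u] by simp
qed simp

lemma below_mono: "y \<in> below c \<Longrightarrow> c \<le> d \<Longrightarrow> y \<in> below d"
  by (erule supported_mono) auto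

lemma lead_below: "lead i m \<in> below (weight m + 2 - i)"
proof (cases "3 \<le> i")
  case True
  then show ?thesis by (simp add: lead_def chi_zero)
next
  case False
  then show ?thesis by (auto simp: lead_def idx_def intro!: supported_single)
qed

lemma max_decomp:
  fixes m :: "nat multiset"
  assumes "m \<noteq> {#}"
  obtains n u where "m = add_mset n u" "\<forall>x\<in>#u. x \<le> n"
proof -
  have "m = add_mset (Max_mset m) (m - {#Max_mset m#})"
    using assms by simp
  moreover have "\<forall>x\<in>#m - {#Max_mset m#}. x \<le> Max_mset m"
    by (auto dest: in_diffD)
  ultimately show ?thesis by (rule that)
qed

lemma act_minus_lead_add_mset:
  assumes n: "\<forall>x\<in>#u. x \<le> n" and i: "gen n < i"
  shows "act i (add_mset n u) - lead i (add_mset n u) =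
    e (gen n) (act i u - lead i u) + commutator i (gen n) (monom u)"
  using act_add_mset[OF n i] e_lead[OF n i] by (simp add: e_diff)

text \<open>Replacing a product of two letters by their bracket lowers the weight by two; so \<open>e\<^sub>i\<close> agrees with its
leading term up to an error of weight two less than the expected weight \<open>weight m + 2 - i\<close>.\<close>

lemma act_minus_lead_below: "act i m - lead i m \<in> below (weight m - i)"
proof (induction "size m" arbitrary: i m rule: less_induct)
  case less
  show ?case
  proof (cases "m = {#}")
    case True
    then show ?thesis by (simp add: act_def)
  next
    case False
    then obtain n u where m: "m = add_mset n u" and n: "\<forall>x\<in>#u. x \<le> n" by (rule max_decomp)
    have IH: "act j x - lead j x \<in> below (weight x - j)" if "size x \<le> size u" for j x
      using that m by (intro less) simp
    have act: "act j x \<in> below (weight x + 2 - j)" if "size x \<le> size u" for j x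
      using supported_add[OF below_mono[OF IH[OF that, of j], of "weight x + 2 - j"] lead_below[of j x]] by simp
    show ?thesis
    proof (cases "gen n < i")
      case False
      then have "i < 1" "\<forall>x\<in>#m. x \<le> idx i" using n m by (auto simp: gen_def idx_def)
      then have "act i m = lead i m" using act_leftmost[of m "idx i"] by (simp add: gen_idx lead_def)
      then show ?thesis by simp
    next
      case True
      have "e (gen n) (act i u - lead i u) \<in> below (weight m - i)"
        unfolding e_def
      proof (rule supported_lin)
        show "act i u - lead i u \<in> supported {x. weight x \<le> weight u - i \<and> size x \<le> size u}"
          using IH[of u i] act_minus_lead[of i u] by (auto simp: supported_def)
        fix x :: "nat multiset" assume "x \<in> {x. weight x \<le> weight u - i \<and> size x \<le> size u}"
        then show "act (gen n) x \<in> below (weight m - i)"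
          by (intro below_mono[OF act]) (auto simp: gen_def m)
      qed
      moreover have "commutator i (gen n) (monom u) \<in> below (weight m - i)"
        unfolding commutator_def e_monom
      proof (rule supported_add[OF supported_scale])
        show "act (i + gen n) u \<in> below (weight m - i)"
          by (rule below_mono[OF act]) (auto simp: gen_def m)
        show "pscale (central i (gen n)) (monom u) \<in> below (weight m - i)"
          by (auto simp: central_def gen_def m intro!: supported_scale supported_single)
      qed
      ultimately show ?thesis
        unfolding m act_minus_lead_add_mset[OF n True] by (rule supported_add)
    qed
  qed
qed

lemma act_below: "act i m \<in> below (weight m + 2 - i)"
  using supported_add[OF below_mono[OF act_minus_lead_below[of i m], of "weight m + 2 - i"] lead_below[of i m]] by simp

lemma e_below: "y \<in> below d \<Longrightarrow> e i y \<in> below (d + 2 - i)"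
  unfolding e_def by (erule supported_lin) (auto intro: below_mono[OF act_below])

text \<open>Put \<open>k = p + 2\<close>.  To leading order \<open>e\<^sub>k - \<chi> k\<close> is a derivation which sends \<open>e\<^bsub>-n\<^esub>\<close> to
\<open>(-n - k) e\<^bsub>k-n\<^esub>\<close>.  If \<open>n \<le> p\<close>, the index \<open>k - n\<close> is at least \<open>2\<close>, and it equals \<open>2\<close>, where
\<open>\<chi>\<close> is nonzero, only for \<open>n = p\<close>.  So on monomials in letters \<open>\<le> p\<close> the derivation is
\<open>-(2 p + 2) \<chi> 2\<close> times the partial derivative by the letter \<open>p\<close>.\<close>

lemma act_derivative:
  assumes "\<forall>x\<in>#m. x \<le> p"
  shows "act (int p + 2) m - lead (int p + 2) m -
      pscale (- of_nat (2 * p + 2) * \<chi> 2 * of_nat (count m p)) (monom (m - {#p#}))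
    \<in> below (weight m - int p - 3)"
  using assms
proof (induction m rule: multiset_induct_max)
  case empty
  then show ?case by (simp add: act_def)
next
  case (add n u)
  let ?k = "int p + 2"
  define c where "c = - of_nat (2 * p + 2) * \<chi> 2"
  define z where "z = act ?k u - lead ?k u - pscale (c * of_nat (count u p)) (monom (u - {#p#}))"
  have z: "z \<in> below (weight u - int p - 3)"
    using add.IH add.prems by (simp add: z_def c_def)
  have n: "\<forall>x\<in>#u. x \<le> n" "n \<le> p" using add.hyps add.prems by auto
  have gen: "gen n < ?k" by (simp add: gen_def)
  have "\<forall>x\<in>#u - {#p#}. x \<le> n" using n(1) by (auto dest: in_diffD)
  then have "e (gen n) (monom (u - {#p#})) = monom (add_mset n (u - {#p#}))"
    by (simp add: act_leftmost)
  moreover have "act ?k u - lead ?k u = pscale (c * of_nat (count u p)) (monom (u - {#p#})) + z"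
    by (simp add: z_def)
  ultimately have eq: "act ?k (add_mset n u) - lead ?k (add_mset n u) =
      pscale (c * of_nat (count u p)) (monom (add_mset n (u - {#p#}))) + e (gen n) z
      + pscale (of_int (gen n - ?k)) (act (?k + gen n) u)"
    unfolding act_minus_lead_add_mset[OF n(1) gen] using n(2)
    by (simp add: e_add e_scale commutator_def central_def gen_def)
  have ez: "e (gen n) z \<in> below (weight (add_mset n u) - int p - 3)"
    by (rule below_mono[OF e_below[OF z]]) (simp add: gen_def)
  show ?case
  proof (cases "n = p")
    case True
    define z' where "z' = act 2 u - lead 2 u"
    have two: "?k + gen n = 2" by (simp add: True gen_def)
    have act: "act (?k + gen n) u = pscale (\<chi> 2) (monom u) + z'"
      unfolding two by (simp add: z'_def lead_def pscale_single)
    have z': "z' \<in> below (weight (add_mset n u) - int p - 3)"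
      unfolding z'_def by (rule below_mono[OF act_minus_lead_below]) (simp add: True)
    have top: "pscale (c * of_nat (count u p)) (monom (add_mset p (u - {#p#}))) = pscale (c * of_nat (count u p)) (monom u)"
      by (cases "p \<in># u") (auto simp: not_in_iff)
    have c: "of_int (gen n - ?k) * \<chi> 2 = c" by (simp add: c_def gen_def True algebra_simps)
    have "act ?k (add_mset n u) - lead ?k (add_mset n u) - pscale (c * of_nat (count (add_mset n u) p)) (monom (add_mset n u - {#p#}))
      = e (gen n) z + pscale (of_int (gen n - ?k)) z'"
      unfolding eq act ps.scale_right_distrib ps.scale_scale c using True top
      by (simp add: distrib_left ps.scale_left_distrib)
    then show ?thesis using ez z' by (simp add: c_def supported_add supported_scale)
  next
    case False
    then have "n < p" using n(2) by simp
    then have count: "count u p = 0" using n(1) by (auto simp: not_in_iff[symmetric] dest!: bspec)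
    have "act (?k + gen n) u = act (?k + gen n) u - lead (?k + gen n) u"
      using \<open>n < p\<close> by (simp add: lead_def gen_def chi_zero)
    also have "\<dots> \<in> below (weight (add_mset n u) - int p - 3)"
      by (rule below_mono[OF act_minus_lead_below]) (simp add: gen_def)
    finally show ?thesis
      using eq ez count False by (simp add: supported_add supported_scale)
  qed
qed

text \<open>The coefficient of \<open>m - {#p#}\<close> in \<open>y'\<close> comes from \<open>m\<close> alone: components of \<open>y\<close> of smaller weight end up in
smaller weight, and those of weight \<open>d\<close> are differentiated by the letter \<open>p\<close>.\<close>

lemma lower_weight:
  assumes y: "y \<in> below d" and top: "m \<in> Poly_Mapping.keys y" "weight m = d" and p: "p \<in># m"
    and max: "\<And>x. x \<in> Poly_Mapping.keys y \<Longrightarrow> weight x = d \<Longrightarrow> \<forall>n\<in>#x. n \<le> p"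
  defines "y' \<equiv> e (int p + 2) y - pscale (\<chi> (int p + 2)) y"
  shows "y' \<in> below (d - (int p + 2))" "y' \<noteq> 0"
proof -
  let ?k = "int p + 2"
  define r where "r x = act ?k x - lead ?k x" for x
  have y': "y' = lin r y"
  proof -
    have "pscale (\<chi> ?k) y = lin (lead ?k) y"
    proof -
      have "y \<in> supported UNIV" by simp
      then show ?thesis
        by (induction rule: lin_induct)
           (simp_all add: lin_single lin_add pscale_single lead_def ps.scale_right_distrib mult.commute)
    qed
    then show ?thesis
      by (simp add: y'_def e_def r_def[abs_def]) (simp add: lin_def sum_subtractf ps.scale_right_diff_distrib)
  qed
  show "y' \<in> below (d - ?k)"
    unfolding y' using y
    by (rule supported_lin) (auto simp: r_def intro: below_mono[OF act_minus_lead_below])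
  define c where "c = - of_nat (2 * p + 2) * \<chi> 2"
  have "Poly_Mapping.lookup (r x) (m - {#p#}) = (if x = m then c * of_nat (count m p) else 0)"
    if x: "x \<in> Poly_Mapping.keys y" for x
  proof -
    have m: "m = add_mset p (m - {#p#})" using p by simp
    from arg_cong[OF this, of weight] have wm: "weight (m - {#p#}) = d - ?k"
      using top(2) by simp
    have "weight x \<le> d" using y x by (auto simp: supported_def)
    then consider "weight x < d" | "weight x = d" by linarith
    then show ?thesis
    proof cases
      case 1
      then have "Poly_Mapping.lookup (r x) (m - {#p#}) = 0"
        unfolding r_def by (intro supportedD[OF act_minus_lead_below]) (simp add: wm)
      then show ?thesis using 1 top(2) by auto
    next
      case 2
      have "Poly_Mapping.lookup (r x - pscale (c * of_nat (count x p)) (monom (x - {#p#}))) (m - {#p#}) = 0"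
        unfolding r_def c_def by (intro supportedD[OF act_derivative[OF max[OF x 2]]]) (simp add: wm 2)
      then have "Poly_Mapping.lookup (r x) (m - {#p#}) = (if x - {#p#} = m - {#p#} then c * of_nat (count x p) else 0)"
        by (simp add: lookup_minus lookup_single when_def split: if_splits)
      moreover have "x = m" if "x - {#p#} = m - {#p#}" "count x p \<noteq> 0"
        using that p by (metis count_eq_zero_iff insert_DiffM)
      ultimately show ?thesis by auto
    qed
  qed
  then have "Poly_Mapping.lookup y' (m - {#p#}) =
      (\<Sum>x\<in>Poly_Mapping.keys y. if x = m then Poly_Mapping.lookup y m * (c * of_nat (count m p)) else 0)"
    unfolding y' lookup_lin by (intro sum.cong) auto
  also have "\<dots> = Poly_Mapping.lookup y m * (c * of_nat (count m p))"
    using top(1) by simp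
  also have "\<dots> \<noteq> 0"
  proof -
    have "of_nat (2 * p + 2) \<noteq> (0 :: 'k)" unfolding of_nat_eq_0_iff by simp
    then have "c \<noteq> 0" unfolding c_def using chi_2 by (metis mult_eq_0_iff neg_equal_0_iff_equal)
    then show ?thesis using top(1) p by (simp add: in_keys_iff)
  qed
  finally show "y' \<noteq> 0" by auto
qed

theorem whittaker_simple: "simple_left_module U rep.M"
  unfolding simple_left_module_def
proof (intro conjI allI impI)
  show "left_module U rep.M" by (rule rep.rep_left_module)
  have "monom {#} \<noteq> 0" by simp
  then show "carrier rep.M \<noteq> {\<zero>\<^bsub>rep.M\<^esub>}" by (metis UNIV_I rep.M_simps(1,2) singletonD)
  fix N assume "submodule N U rep.M"
  then have N: "0 \<in> N" "\<And>y z. y \<in> N \<Longrightarrow> z \<in> N \<Longrightarrow> y + z \<in> N"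
    "\<And>X y. X \<in> carrier U \<Longrightarrow> y \<in> N \<Longrightarrow> X \<odot>\<^bsub>rep.M\<^esub> y \<in> N"
    by (simp_all add: left_module.submodule_iff[OF rep.rep_left_module])
  have run: "rep.run p y \<in> N" if "y \<in> N" for p y
    using N(3)[OF _ that, of "rep.coset p"] by (simp add: rep.coset_smult)
  have N_scale: "pscale a y \<in> N" if "y \<in> N" for a y
    using run[OF that, of "const a"] by (simp add: rep.run_single)
  have N_e: "e i y \<in> N" if "y \<in> N" for i y
    using run[OF that, of "letter (vir_e i)"] by (simp add: rep.run_single action_basis basis_action_def)
  have N_diff: "y - z \<in> N" if "y \<in> N" "z \<in> N" for y z
    using N(2)[OF that(1) N_scale[OF that(2), of "- 1"]] by simp
  have "N = UNIV" if nonzero: "\<exists>y\<in>N. y \<noteq> 0"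
  proof -
    define P where "P d \<longleftrightarrow> (\<exists>y\<in>N. y \<noteq> 0 \<and> y \<in> below (int d))" for d
    obtain y where "y \<in> N" "y \<noteq> 0" using nonzero by blast
    moreover have "y \<in> below (int (nat (Max (weight ` Poly_Mapping.keys y))))"
    proof -
      have "weight x \<le> int (nat (Max (weight ` Poly_Mapping.keys y)))" if "x \<in> Poly_Mapping.keys y" for x
      proof -
        have "weight x \<le> Max (weight ` Poly_Mapping.keys y)" using that by simp
        then show ?thesis by linarith
      qed
      then show ?thesis unfolding supported_def by blast
    qed
    ultimately have "P (nat (Max (weight ` Poly_Mapping.keys y)))" unfolding P_def by blast
    then have least: "P (LEAST d. P d)" by (rule LeastI)
    define d where "d = (LEAST d. P d)"
    obtain y where y: "y \<in> N" "y \<noteq> 0" "y \<in> below (int d)" using least unfolding P_def d_def by blast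
    have "d = 0"
    proof (rule ccontr)
      assume "d \<noteq> 0"
      let ?top = "{x \<in> Poly_Mapping.keys y. weight x = int d}"
      have "?top \<noteq> {}"
      proof
        assume "?top = {}"
        then have "y \<in> below (int (d - 1))"
          using y(3) \<open>d \<noteq> 0\<close> by (fastforce simp: supported_def)
        then have "P (d - 1)" using y unfolding P_def by blast
        then show False using not_less_Least[of "d - 1" P] \<open>d \<noteq> 0\<close> by (simp add: d_def)
      qed
      then obtain x where x: "x \<in> ?top" by blast
      define S where "S = (\<Union>x\<in>?top. set_mset x)"
      have "finite S" by (simp add: S_def)
      moreover have "S \<noteq> {}"
      proof -
        have "x \<noteq> {#}" using x \<open>d \<noteq> 0\<close> by auto
        then show ?thesis using x by (auto simp: S_def)
      qed
      ultimately have "Max S \<in> S" by (rule Max_in)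
      then obtain m where m: "m \<in> ?top" "Max S \<in># m" by (auto simp: S_def)
      have max: "\<forall>n\<in>#x. n \<le> Max S" if "x \<in> Poly_Mapping.keys y" "weight x = int d" for x
        using that \<open>finite S\<close> by (auto simp: S_def intro!: Max_ge)
      define p where "p = Max S"
      define y' where "y' = e (int p + 2) y - pscale (\<chi> (int p + 2)) y"
      have y': "y' \<in> below (int d - (int p + 2))" "y' \<noteq> 0"
        using lower_weight[OF y(3), of m p] m max unfolding y'_def p_def by auto
      have "y' \<in> N" unfolding y'_def by (intro N_diff N_e N_scale y)
      have "0 \<le> int d - (int p + 2)"
      proof -
        have "m = add_mset p (m - {#p#})" using m(2) by (simp add: p_def)
        from arg_cong[OF this, of weight] show ?thesis using m(1) weight_nonneg[of "m - {#p#}"] by simp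
      qed
      then have "int d - (int p + 2) = int (d - (p + 2))" by simp
      then have "P (d - (p + 2))" using y' \<open>y' \<in> N\<close> unfolding P_def by metis
      then show False using not_less_Least[of "d - (p + 2)" P] \<open>d \<noteq> 0\<close> by (simp add: d_def)
    qed
    then have keys: "Poly_Mapping.keys y \<subseteq> {{#}}" using y(3) weight_zero by (auto simp: supported_def)
    then have "y = Poly_Mapping.single {#} (Poly_Mapping.lookup y {#})"
      by (intro poly_mapping_eqI) (auto simp: lookup_single when_def in_keys_iff)
    then have "y = pscale (Poly_Mapping.lookup y {#}) (monom {#})"
      by (simp only: pscale_single mult_1_right)
    moreover have "Poly_Mapping.lookup y {#} \<noteq> 0"
      using keys y(2) by (metis calculation ps.scale_zero_left)
    ultimately have "monom {#} = pscale (inverse (Poly_Mapping.lookup y {#})) y"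
      by (metis ps.scale_one ps.scale_scale left_inverse)
    then have one: "monom {#} \<in> N" using N_scale[OF y(1)] by metis
    have "z \<in> N" for z by (rule mem_if_generator_mem[OF run N(1,2) one])
    then show ?thesis by blast
  qed
  then show "N = {\<zero>\<^bsub>rep.M\<^esub>} \<or> N = carrier rep.M" using N(1) by auto
qed

end

section \<open>Annihilators of extended modules\<close>

locale scalar_extension = S: ring S
  for S :: "('s, 't) ring_scheme" +
  fixes j :: "'a \<Rightarrow> 's" and R :: "('a, 'r) ring_scheme" and N :: "('a, 'n, 'm) module_scheme"
  assumes j_closed: "r \<in> carrier R \<Longrightarrow> j r \<in> carrier S"
    and N_add_closed: "\<lbrakk>n \<in> carrier N; n' \<in> carrier N\<rbrakk> \<Longrightarrow> n \<oplus>\<^bsub>N\<^esub> n' \<in> carrier N"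
    and N_smult_closed: "\<lbrakk>r \<in> carrier R; n \<in> carrier N\<rbrakk> \<Longrightarrow> r \<odot>\<^bsub>N\<^esub> n \<in> carrier N"
begin

abbreviation F where "F \<equiv> free_Abelian_group (carrier S \<times> carrier N)"
abbreviation K where "K \<equiv> tensor_kernel j R S N"
abbreviation T where "T \<equiv> extend_scalars j R S N"

lemma relations_closed: "tensor_relations j R S N \<subseteq> carrier F"
proof -
  have diff: "x - y \<in> carrier F" if "x \<in> carrier F" "y \<in> carrier F" for x y
    using that keys_diff[of x y] by auto
  show ?thesis
    unfolding tensor_relations_def
    by (intro Un_least subsetI; elim CollectE exE conjE; hypsubst)
       (intro diff; simp add: j_closed N_add_closed N_smult_closed)+
qed

lemma kernel_subgroup: "subgroup K F"
  unfolding tensor_kernel_def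
  by (rule group.generate_is_subgroup[OF group_free_Abelian_group relations_closed])

lemma kernel_add: "\<lbrakk>x \<in> K; y \<in> K\<rbrakk> \<Longrightarrow> x + y \<in> K"
  using subgroup.m_closed[OF kernel_subgroup, of x y] by simp

lemma kernel_zero: "0 \<in> K"
  using subgroup.one_closed[OF kernel_subgroup] by simp

lemma kernel_minus: "x \<in> K \<Longrightarrow> - x \<in> K"
  using subgroup.m_inv_closed[OF kernel_subgroup, of x] subgroup.mem_carrier[OF kernel_subgroup, of x] by simp

lemma kernel_diff: "\<lbrakk>x \<in> K; y \<in> K\<rbrakk> \<Longrightarrow> x - y \<in> K"
  using kernel_add[OF _ kernel_minus, of x y] by simp

lemma relation_in_kernel: "x \<in> tensor_relations j R S N \<Longrightarrow> x \<in> K"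
  unfolding tensor_kernel_def by (rule generate.incl)

lemma kernel_balanced:
  assumes "s \<in> carrier S" "r \<in> carrier R" "n \<in> carrier N"
  shows "frag_of (s \<otimes>\<^bsub>S\<^esub> j r, n) - frag_of (s, r \<odot>\<^bsub>N\<^esub> n) \<in> K"
  using assms by (intro relation_in_kernel) (auto simp: tensor_relations_def)

lemma kernel_null:
  assumes "s \<in> carrier S" "z \<in> carrier N" "z \<oplus>\<^bsub>N\<^esub> z = z"
  shows "frag_of (s, z) \<in> K"
proof -
  have "frag_of (s, z \<oplus>\<^bsub>N\<^esub> z) - frag_of (s, z) - frag_of (s, z) \<in> K"
    using assms(1,2) by (intro relation_in_kernel) (auto simp: tensor_relations_def)
  then show ?thesis using kernel_minus assms(3) by fastforce
qed

lemma extend_scalars_simps: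
  "carrier T = rcosets\<^bsub>F\<^esub> K" "\<zero>\<^bsub>T\<^esub> = K"
  "a \<odot>\<^bsub>T\<^esub> A = K <#>\<^bsub>F\<^esub> frag_extend (\<lambda>(s, n). frag_of (a \<otimes>\<^bsub>S\<^esub> s, n)) ` A"
  by (simp_all add: extend_scalars_def Let_def FactGroup_def)

text \<open>The quotient by \<open>K\<close> is generated by the classes of the \<open>s \<otimes> n\<close>.\<close>

lemma annihilator_extend_scalars:
  "annihilator S T = {a \<in> carrier S. \<forall>s\<in>carrier S. \<forall>n\<in>carrier N. frag_of (a \<otimes>\<^bsub>S\<^esub> s, n) \<in> K}"
proof (intro subset_antisym subsetI)
  fix a assume a: "a \<in> annihilator S T"
  have "frag_of (a \<otimes>\<^bsub>S\<^esub> s, n) \<in> K" if "s \<in> carrier S" "n \<in> carrier N" for s n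
  proof -
    let ?A = "K #>\<^bsub>F\<^esub> frag_of (s, n)"
    have "?A \<in> carrier T" using that unfolding extend_scalars_simps RCOSETS_def by auto
    then have "a \<odot>\<^bsub>T\<^esub> ?A = K" using a by (auto simp: annihilator_def extend_scalars_simps)
    moreover have "frag_of (s, n) \<in> ?A"
      unfolding r_coset_def using kernel_zero by (auto intro!: bexI[of _ 0])
    then have "0 + frag_extend (\<lambda>(s, n). frag_of (a \<otimes>\<^bsub>S\<^esub> s, n)) (frag_of (s, n)) \<in> a \<odot>\<^bsub>T\<^esub> ?A"
      unfolding extend_scalars_simps set_mult_def using kernel_zero by fastforce
    ultimately show ?thesis by simp
  qed
  then show "a \<in> {a \<in> carrier S. \<forall>s\<in>carrier S. \<forall>n\<in>carrier N. frag_of (a \<otimes>\<^bsub>S\<^esub> s, n) \<in> K}"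
    using a by (simp add: annihilator_def)
next
  fix a assume "a \<in> {a \<in> carrier S. \<forall>s\<in>carrier S. \<forall>n\<in>carrier N. frag_of (a \<otimes>\<^bsub>S\<^esub> s, n) \<in> K}"
  then have a: "a \<in> carrier S" "\<And>s n. s \<in> carrier S \<Longrightarrow> n \<in> carrier N \<Longrightarrow> frag_of (a \<otimes>\<^bsub>S\<^esub> s, n) \<in> K"
    by auto
  let ?\<phi> = "frag_extend (\<lambda>(s, n). frag_of (a \<otimes>\<^bsub>S\<^esub> s, n))"
  have \<phi>: "?\<phi> x \<in> K" if "Poly_Mapping.keys x \<subseteq> carrier S \<times> carrier N" for x
    using that by (rule free_Abelian_group_induct) (auto simp: frag_extend_diff kernel_zero kernel_diff a)
  have "a \<odot>\<^bsub>T\<^esub> A = K" if A: "A \<in> carrier T" for A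
  proof -
    obtain x where x: "x \<in> carrier F" "A = K #>\<^bsub>F\<^esub> x"
      using A unfolding extend_scalars_simps RCOSETS_def by blast
    have AF: "y \<in> carrier F" if y: "y \<in> A" for y
    proof -
      obtain k where "k \<in> K" "y = k + x" using y unfolding x(2) r_coset_def by auto
      then show ?thesis
        using subgroup.mem_carrier[OF kernel_subgroup, of k] x(1) keys_add[of k x] by auto
    qed
    have xA: "x \<in> A"
      unfolding x(2) r_coset_def using kernel_zero by (auto intro!: bexI[of _ 0])
    show ?thesis
    proof (intro subset_antisym subsetI)
      fix k assume "k \<in> a \<odot>\<^bsub>T\<^esub> A"
      then obtain h y where "h \<in> K" "y \<in> A" "k = h + ?\<phi> y"
        unfolding extend_scalars_simps set_mult_def by auto
      then show "k \<in> K" using \<phi>[of y] AF[of y] by (auto intro: kernel_add)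
    next
      fix k assume "k \<in> K"
      then have "k - ?\<phi> x \<in> K" using \<phi>[of x] x(1) by (intro kernel_diff) auto
      then have "(k - ?\<phi> x) \<otimes>\<^bsub>F\<^esub> ?\<phi> x \<in> a \<odot>\<^bsub>T\<^esub> A"
        unfolding extend_scalars_simps(3) set_mult_def using xA by blast
      then show "k \<in> a \<odot>\<^bsub>T\<^esub> A" by simp
    qed
  qed
  then show "a \<in> annihilator S T"
    using a(1) by (simp add: annihilator_def extend_scalars_simps(2))
qed

text \<open>The homomorphism from the free abelian group to \<open>M\<close> with \<open>(s, n) \<mapsto> s f(n)\<close> kills the tensor relations when \<open>f\<close> is
linear over \<open>R\<close>; it is the map that extension of scalars associates with \<open>f\<close>.\<close>

lemma kernel_maps_to_zero:
  assumes M: "left_module S M"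
    and f: "\<And>n. n \<in> carrier N \<Longrightarrow> f n \<in> carrier M"
    and f_add: "\<And>n n'. \<lbrakk>n \<in> carrier N; n' \<in> carrier N\<rbrakk> \<Longrightarrow> f (n \<oplus>\<^bsub>N\<^esub> n') = f n \<oplus>\<^bsub>M\<^esub> f n'"
    and f_smult: "\<And>r n. \<lbrakk>r \<in> carrier R; n \<in> carrier N\<rbrakk> \<Longrightarrow> f (r \<odot>\<^bsub>N\<^esub> n) = j r \<odot>\<^bsub>M\<^esub> f n"
    and "s \<in> carrier S" "n \<in> carrier N" "frag_of (s, n) \<in> K"
  shows "s \<odot>\<^bsub>M\<^esub> f n = \<zero>\<^bsub>M\<^esub>"
proof -
  interpret M: left_module S M by (rule M)
  have "(\<lambda>(s, n). s \<odot>\<^bsub>M\<^esub> f n) ` (carrier S \<times> carrier N) \<subseteq> carrier (add_monoid M)"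
    using f by auto
  then obtain h where h: "h \<in> hom F (add_monoid M)"
    and h_frag: "\<And>x. x \<in> carrier S \<times> carrier N \<Longrightarrow> h (frag_of x) = (\<lambda>(s, n). s \<odot>\<^bsub>M\<^esub> f n) x"
    by (rule comm_group.free_Abelian_group_universal[OF M.M.a_comm_group]) blast
  interpret h: group_hom F "add_monoid M" h
    by (intro group_hom.intro group_hom_axioms.intro h group_free_Abelian_group M.M.a_group)
  have h_add: "h (x + y) = h x \<oplus>\<^bsub>M\<^esub> h y" if "x \<in> carrier F" "y \<in> carrier F" for x y
    using h.hom_mult[OF that] by simp
  have h_diff_add: "h (x - y) \<oplus>\<^bsub>M\<^esub> h y = h x" if "x \<in> carrier F" "y \<in> carrier F" for x y
  proof -
    have "x - y \<in> carrier F" using that keys_diff[of x y] by auto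
    from h_add[OF this that(2)] show ?thesis by simp
  qed
  have h_eq: "h (x - y) = \<zero>\<^bsub>M\<^esub>" if "x \<in> carrier F" "y \<in> carrier F" "h x = h y" for x y
  proof -
    have xy: "x - y \<in> carrier F" using that keys_diff[of x y] by auto
    then have hM: "h (x - y) \<in> carrier M" "h y \<in> carrier M" using h.hom_closed[of "x - y"] h.hom_closed[of y] that by auto
    have "h (x - y) \<oplus>\<^bsub>M\<^esub> h y = \<zero>\<^bsub>M\<^esub> \<oplus>\<^bsub>M\<^esub> h y"
      using h_diff_add[OF that(1,2)] that(3) hM(2) by (simp only: M.M.l_zero)
    then show ?thesis by (simp only: M.M.add.right_cancel hM M.M.zero_closed)
  qed
  have "tensor_relations j R S N \<subseteq> kernel F (add_monoid M) h"
  proof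
    fix x assume x: "x \<in> tensor_relations j R S N"
    have sum: "h (frag_of p - frag_of q - frag_of q') = \<zero>\<^bsub>M\<^esub>"
      if "p \<in> carrier S \<times> carrier N" "q \<in> carrier S \<times> carrier N" "q' \<in> carrier S \<times> carrier N"
        "h (frag_of p) = h (frag_of q) \<oplus>\<^bsub>M\<^esub> h (frag_of q')" for p q q'
    proof -
      have "frag_of q + frag_of q' \<in> carrier F"
        using that keys_add[of "frag_of q" "frag_of q'"] by auto
      then have "h (frag_of p - (frag_of q + frag_of q')) = \<zero>\<^bsub>M\<^esub>"
        using that by (intro h_eq) (simp_all add: h_add)
      then show ?thesis by (simp add: diff_diff_add)
    qed
    have "h x = \<zero>\<^bsub>M\<^esub>"
      using x unfolding tensor_relations_def
    proof (elim UnE CollectE exE conjE)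
      fix s s' n assume *: "x = frag_of (s \<oplus>\<^bsub>S\<^esub> s', n) - frag_of (s, n) - frag_of (s', n)"
        "s \<in> carrier S" "s' \<in> carrier S" "n \<in> carrier N"
      show ?thesis unfolding *(1)
        by (rule sum) (use *(2-) in \<open>simp_all add: h_frag M.smult_l_distr f\<close>)
    next
      fix s n n' assume *: "x = frag_of (s, n \<oplus>\<^bsub>N\<^esub> n') - frag_of (s, n) - frag_of (s, n')"
        "s \<in> carrier S" "n \<in> carrier N" "n' \<in> carrier N"
      show ?thesis unfolding *(1)
        by (rule sum) (use *(2-) in \<open>simp_all add: h_frag M.smult_r_distr f f_add N_add_closed\<close>)
    next
      fix s r n assume *: "x = frag_of (s \<otimes>\<^bsub>S\<^esub> j r, n) - frag_of (s, r \<odot>\<^bsub>N\<^esub> n)"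
        "s \<in> carrier S" "r \<in> carrier R" "n \<in> carrier N"
      show ?thesis unfolding *(1)
        by (rule h_eq) (use *(2-) in \<open>simp_all add: h_frag M.smult_assoc f f_smult j_closed N_smult_closed\<close>)
    qed
    then show "x \<in> kernel F (add_monoid M) h"
      using subsetD[OF relations_closed x] unfolding kernel_def by simp
  qed
  then have "K \<subseteq> kernel F (add_monoid M) h"
    unfolding tensor_kernel_def
    by (rule group.generate_subgroup_incl[OF group_free_Abelian_group _ h.subgroup_kernel])
  then have "h (frag_of (s, n)) = \<zero>\<^bsub>M\<^esub>"
    using assms(7) by (auto simp: kernel_def)
  then show ?thesis using assms(5,6) by (simp add: h_frag)
qed

end

section \<open>The Verma module\<close>

definition nonneg_basis :: "vir_basis set" where
  "nonneg_basis = insert C (E ` {0..})"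

lemma supported_vir_scale: "x \<in> supported A \<Longrightarrow> vir_scale a x \<in> supported A"
  by (auto simp: supported_iff)

lemma vir_b_plus_eq: "vir_b_plus = (supported nonneg_basis :: 'k::field_char_0 vir set)"
proof (intro subset_antisym subsetI)
  have span: "vir_vs.span X \<subseteq> (supported nonneg_basis :: 'k vir set)" if "X \<subseteq> supported nonneg_basis" for X
    using that
    by (rule vir_vs.span_minimal)
       (auto simp: vir_vs.subspace_def intro: supported_add supported_vir_scale)
  fix x :: "'k vir" assume "x \<in> vir_b_plus"
  then obtain y z where "x = y + z" "y \<in> vir_n_plus" "z \<in> vir_h" by (auto simp: vir_b_plus_def)
  moreover have "vir_n_plus \<subseteq> (supported nonneg_basis :: 'k vir set)"
    unfolding vir_n_plus_def by (rule span) (auto simp: nonneg_basis_def intro!: supported_single)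
  moreover have "vir_h \<subseteq> (supported nonneg_basis :: 'k vir set)"
    unfolding vir_h_def by (rule span) (auto simp: nonneg_basis_def intro!: supported_single)
  ultimately show "x \<in> supported nonneg_basis" by (auto intro: supported_add)
next
  have sum: "y + z \<in> vir_b_plus" if "y \<in> vir_n_plus" "z \<in> vir_h" for y z :: "'k vir"
    using that unfolding vir_b_plus_def by blast
  have null: "0 \<in> vir_n_plus" "0 \<in> (vir_h :: 'k vir set)"
    unfolding vir_n_plus_def vir_h_def by (rule vir_vs.span_zero)+
  fix x :: "'k vir" assume "x \<in> supported nonneg_basis"
  then show "x \<in> vir_b_plus"
  proof (induction rule: lin_induct)
    case zero
    show ?case using sum[OF null] by simp
  next
    case (single b c)
    then consider "b = C \<or> b = E 0" | i where "b = E i" "1 \<le> i"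
      by (fastforce simp: nonneg_basis_def)
    then show ?case
    proof cases
      case 1
      then have "vir_scale c (Poly_Mapping.single b 1) \<in> vir_h"
        unfolding vir_h_def by (intro vir_vs.span_scale vir_vs.span_base) auto
      from sum[OF null(1) this] show ?thesis by (simp add: vir_scale_single)
    next
      case 2
      then have "vir_scale c (Poly_Mapping.single b 1) \<in> vir_n_plus"
        unfolding vir_n_plus_def by (intro vir_vs.span_scale vir_vs.span_base) auto
      from sum[OF this null(2)] show ?thesis by (simp add: vir_scale_single)
    qed
  next
    case (add x y)
    then obtain a b a' b' where "x = a + b" "y = a' + b'" "a \<in> vir_n_plus" "a' \<in> vir_n_plus" "b \<in> vir_h" "b' \<in> vir_h"
      unfolding vir_b_plus_def by blast
    moreover from this have "a + a' \<in> vir_n_plus" "b + b' \<in> vir_h"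
      unfolding vir_n_plus_def vir_h_def by (simp_all add: vir_vs.span_add)
    moreover have "x + y = (a + a') + (b + b')" using calculation by (simp add: algebra_simps)
    ultimately show ?case by (metis sum)
  qed
qed

lemma verma_weight_add: "verma_weight \<kappa> \<mu> (x + y) = verma_weight \<kappa> \<mu> x + verma_weight \<kappa> \<mu> y"
  by (simp add: verma_weight_def lookup_add algebra_simps)

lemma verma_weight_scale: "verma_weight \<kappa> \<mu> (vir_scale a x) = a * verma_weight \<kappa> \<mu> x"
  by (simp add: verma_weight_def algebra_simps)

text \<open>A bracket \<open>[e\<^sub>i, e\<^sub>j]\<close> involves \<open>c\<close> or \<open>e\<^sub>0\<close> only if \<open>i + j = 0\<close>, which for \<open>i, j \<ge> 0\<close> means
\<open>i = j = 0\<close>, and \<open>[e\<^sub>0, e\<^sub>0] = 0\<close>.\<close>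

lemma bracket_b_plus:
  fixes x y :: "'k::field_char_0 vir"
  assumes x: "x \<in> supported nonneg_basis" and y: "y \<in> supported nonneg_basis"
  shows "vir_bracket x y \<in> supported nonneg_basis" "verma_weight \<kappa> \<mu> (vir_bracket x y) = 0"
proof -
  let ?P = "\<lambda>z :: 'k vir. z \<in> supported nonneg_basis \<and> verma_weight \<kappa> \<mu> z = 0"
  have P_add: "?P (u + v)" if "?P u" "?P v" for u v using that by (simp add: supported_add verma_weight_add)
  have zero: "?P 0" by (simp add: verma_weight_def)
  have scale: "?P (vir_scale a u)" if "?P u" for a u
    using that by (simp add: verma_weight_scale supported_vir_scale)
  have basis: "?P (vir_basis_bracket a b)" if mem: "a \<in> nonneg_basis" "b \<in> nonneg_basis" for a b
  proof (cases "\<exists>i j. a = E i \<and> b = E j")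
    case True
    then obtain i j where ab: "a = E i" "b = E j" "0 \<le> i" "0 \<le> j" using mem by (auto simp: nonneg_basis_def)
    show ?thesis
    proof (cases "i + j = 0")
      case True
      then have "i = 0" "j = 0" using ab by auto
      then show ?thesis using ab by (auto simp: vir_scale_single verma_weight_def)
    next
      case False
      then show ?thesis using ab
        by (auto simp: vir_scale_single verma_weight_def lookup_single nonneg_basis_def intro!: supported_single)
    qed
  next
    case False
    then show ?thesis by (cases a; cases b) (auto simp: verma_weight_def)
  qed
  have single_eq: "Poly_Mapping.single b c = vir_scale c (Poly_Mapping.single b 1)" for b and c :: 'k
    by (simp add: vir_scale_single)
  from x have "?P (vir_bracket x y)"
  proof (induction rule: lin_induct)
    case a: (single a c)
    from y show ?case
    proof (induction rule: lin_induct)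
      case (single b d)
      show ?case
        unfolding single_eq[of a c] single_eq[of b d] vir_bracket_scale_left vir_bracket_scale_right vir_bracket_basis
        by (intro scale basis a single)
    next
      case (add p q)
      show ?case unfolding vir_bracket_add_right by (rule P_add[OF add.IH])
    qed (simp add: zero)
  next
    case (add p q)
    show ?case unfolding vir_bracket_add_left by (rule P_add[OF add.IH])
  qed (simp add: zero)
  then show "vir_bracket x y \<in> supported nonneg_basis" "verma_weight \<kappa> \<mu> (vir_bracket x y) = 0" by auto
qed

locale vir_verma =
  fixes \<kappa> \<mu> :: "'k::field_char_0"
begin

sublocale induced: vir_character 0 "\<lambda>i. if i = 0 then \<mu> else 0" \<kappa>
  by standard auto

sublocale one_dim: lie_representation vir_scale vir_bracket "(*)" vir_b_plus "\<lambda>x u. verma_weight \<kappa> \<mu> x * u"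
proof
  have "vir_vs.subspace (supported nonneg_basis :: 'k vir set)"
    by (auto simp: vir_vs.subspace_def intro: supported_add supported_vir_scale)
  then show "vir.lie_subalgebra (vir_b_plus :: 'k vir set)"
    unfolding vir.lie_subalgebra_def vir_b_plus_eq using bracket_b_plus(1) by blast
  fix x y :: "'k vir" and a u v :: 'k
  show "verma_weight \<kappa> \<mu> (vir_bracket x y) * u =
      verma_weight \<kappa> \<mu> x * (verma_weight \<kappa> \<mu> y * u) - verma_weight \<kappa> \<mu> y * (verma_weight \<kappa> \<mu> x * u)"
    if "x \<in> vir_b_plus" "y \<in> vir_b_plus"
    using that bracket_b_plus(2)[of x y \<kappa> \<mu>] by (simp add: vir_b_plus_eq)
qed (simp_all add: verma_weight_add verma_weight_scale algebra_simps)

abbreviation U where "U \<equiv> U_vir :: ('k vir list \<Rightarrow>\<^sub>0 'k) set ring"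
abbreviation \<iota> where "\<iota> \<equiv> vir.uea_map UNIV :: ('k vir list \<Rightarrow>\<^sub>0 'k) set \<Rightarrow> _"
definition highest :: "nat multiset \<Rightarrow>\<^sub>0 'k" where "highest = Poly_Mapping.single {#} 1"

lemma one_dim_module_eq: "one_dim_module \<kappa> \<mu> = one_dim.M"
  by (simp add: one_dim_module_def)

text \<open>The relations of \<open>U(b\<^sub>+)\<close> hold in \<open>U(Vir)\<close>, so that \<open>uea_map\<close> sends the coset of an element to its coset
in the larger algebra.\<close>

lemma ideal_mono: "p \<in> vir.uea_ideal vir_b_plus \<Longrightarrow> p \<in> vir.uea_ideal (UNIV :: 'k vir set)"
proof -
  let ?I = "{p \<in> supported (lists vir_b_plus). p \<in> vir.uea_ideal (UNIV :: 'k vir set)}"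
  have "ideal ?I one_dim.free"
  proof (rule idealI[OF one_dim.free.ring_axioms])
    show "subgroup ?I (add_monoid one_dim.free)"
    proof (rule one_dim.free.add.subgroupI)
      show "?I \<noteq> {}"
        using induced.rep.relations.zero_closed by (auto intro!: exI[of _ 0])
      fix p assume p: "p \<in> ?I"
      have "const (- 1) * p \<in> vir.uea_ideal UNIV"
        using induced.rep.relations.I_l_closed[of p "const (- 1)"] p by simp
      moreover have "\<ominus>\<^bsub>one_dim.free\<^esub> p = const (- 1) * p"
        using p supported_scale[of p _ "- 1"] by (intro one_dim.free.minus_equality) (auto simp: const_mult)
      ultimately show "\<ominus>\<^bsub>one_dim.free\<^esub> p \<in> ?I"
        using p one_dim.free.a_inv_closed[of p] by simp
    next
      fix p q assume p: "p \<in> ?I" and q: "q \<in> ?I"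
      then show "p \<oplus>\<^bsub>one_dim.free\<^esub> q \<in> ?I"
        using induced.rep.relations.a_closed[of p q] by (auto intro: supported_add)
    qed auto
  next
    fix p q assume "p \<in> ?I" "q \<in> carrier one_dim.free"
    then show "q \<otimes>\<^bsub>one_dim.free\<^esub> p \<in> ?I" "p \<otimes>\<^bsub>one_dim.free\<^esub> q \<in> ?I"
      using induced.rep.relations.I_l_closed[of p q] induced.rep.relations.I_r_closed[of p q]
      by (auto intro: supported_lists_mult)
  qed
  moreover have "vir.uea_relations vir_b_plus \<subseteq> ?I"
  proof
    fix p :: "'k vir list \<Rightarrow>\<^sub>0 'k" assume p: "p \<in> vir.uea_relations vir_b_plus"
    then have "p \<in> vir.uea_relations UNIV" unfolding vir.uea_relations_def by blast
    then have "p \<in> vir.uea_ideal UNIV"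
      unfolding vir.uea_ideal_def using induced.rep.free.genideal_self[OF induced.rep.relations_carrier] by blast
    then show "p \<in> ?I" using p one_dim.relations_carrier by auto
  qed
  ultimately have "vir.uea_ideal vir_b_plus \<subseteq> ?I"
    unfolding vir.uea_ideal_def by (rule one_dim.free.genideal_minimal)
  then show "p \<in> vir.uea_ideal vir_b_plus \<Longrightarrow> p \<in> vir.uea_ideal UNIV" by blast
qed

lemma \<iota>_coset: "\<iota> (one_dim.coset p) = induced.rep.coset p"
proof (intro subset_antisym subsetI)
  fix q assume "q \<in> \<iota> (one_dim.coset p)"
  then obtain x y where "x \<in> vir.uea_ideal UNIV" "y \<in> vir.uea_ideal vir_b_plus" "q = x + (y + p)"
    by (auto simp: vir.uea_map_def set_add_def set_mult_def a_r_coset_def r_coset_def)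
  moreover from this have "x + y \<in> vir.uea_ideal UNIV"
    using induced.rep.relations.a_closed[of x y] ideal_mono by simp
  ultimately show "q \<in> induced.rep.coset p"
    by (auto simp: a_r_coset_def r_coset_def add.assoc[symmetric])
next
  fix q assume "q \<in> induced.rep.coset p"
  then obtain x where "x \<in> vir.uea_ideal UNIV" "q = x + (0 + p)"
    by (auto simp: a_r_coset_def r_coset_def)
  moreover have "0 \<in> vir.uea_ideal (vir_b_plus :: 'k vir set)"
    using one_dim.relations.zero_closed by simp
  ultimately show "q \<in> \<iota> (one_dim.coset p)"
    unfolding vir.uea_map_def set_add_def set_mult_def a_r_coset_def r_coset_def by fastforce
qed

sublocale scalar_extension U \<iota> "vir.uea vir_b_plus" "one_dim_module \<kappa> \<mu>"
proof (intro scalar_extension.intro scalar_extension_axioms.intro induced.rep.U.ring_axioms)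
  fix r :: "('k vir list \<Rightarrow>\<^sub>0 'k) set" assume "r \<in> carrier (vir.uea vir_b_plus)"
  then show "\<iota> r \<in> carrier U" by (auto simp: one_dim.uea_carrier \<iota>_coset)
qed (simp_all add: one_dim_module_eq)

lemma action_highest:
  assumes "x \<in> vir_b_plus"
  shows "induced.action x highest = pscale (verma_weight \<kappa> \<mu> x) highest"
  using assms unfolding vir_b_plus_eq
proof (induction rule: lin_induct)
  case (single b c)
  have "induced.basis_action b highest = pscale (verma_weight \<kappa> \<mu> (Poly_Mapping.single b 1)) highest"
  proof (cases b)
    case (E i)
    then have "0 \<le> i" using single by (auto simp: nonneg_basis_def)
    then show ?thesis
      using E by (auto simp: highest_def induced.basis_action_def induced.act_empty verma_weight_def lookup_single when_def pscale_single
          simp del: single_one)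
  next
    case C
    then show ?thesis by (simp add: induced.basis_action_def verma_weight_def lookup_single)
  qed
  moreover have "verma_weight \<kappa> \<mu> (Poly_Mapping.single b c) = c * verma_weight \<kappa> \<mu> (Poly_Mapping.single b 1)"
    using verma_weight_scale[of \<kappa> \<mu> c "Poly_Mapping.single b 1"] by (simp add: vir_scale_single)
  ultimately show ?case by (simp only: induced.action_basis ps.scale_scale)
next
  case (add p q)
  then show ?case by (simp only: induced.action_vir_add verma_weight_add ps.scale_left_distrib)
qed (simp add: induced.action_def verma_weight_def)

lemma run_highest:
  assumes "p \<in> supported (lists vir_b_plus)"
  shows "induced.rep.run p highest = pscale (one_dim.run p 1) highest"
  using assms
proof (induction rule: lin_induct)
  case (single w a)
  then have "foldr induced.action w highest = pscale (foldr (\<lambda>x u. verma_weight \<kappa> \<mu> x * u) w 1) highest"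
    by (induction w) (simp_all add: induced.action_scale action_highest mult.commute)
  then show ?case by (simp add: induced.rep.run_single one_dim.run_single)
qed (simp_all add: induced.rep.run_plus one_dim.run_plus ps.scale_left_distrib)

text \<open>If \<open>X\<close> kills the Verma module, then \<open>(X Y) \<otimes> 1 = 0\<close> for all \<open>Y\<close>; under \<open>s \<otimes> n \<mapsto> n (s v)\<close> this becomes
\<open>X (Y v) = 0\<close>, and the \<open>Y v\<close> exhaust the induced module.\<close>

lemma verma_annihilator_subset: "annihilator U (verma_module \<kappa> \<mu>) \<subseteq> annihilator U induced.rep.M"
proof
  fix X assume "X \<in> annihilator U (verma_module \<kappa> \<mu>)"
  then have X: "X \<in> carrier U" "\<And>Y. Y \<in> carrier U \<Longrightarrow> frag_of (X \<otimes>\<^bsub>U\<^esub> Y, 1) \<in> K"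
    unfolding verma_module_def annihilator_extend_scalars by (auto simp: one_dim_module_eq)
  interpret M: left_module U induced.rep.M by (rule induced.rep.rep_left_module)
  have kernel: "Z \<odot>\<^bsub>induced.rep.M\<^esub> highest = 0" if "Z \<in> carrier U" "frag_of (Z, 1) \<in> K" for Z
  proof -
    have "Z \<odot>\<^bsub>induced.rep.M\<^esub> pscale 1 highest = \<zero>\<^bsub>induced.rep.M\<^esub>"
    proof (rule kernel_maps_to_zero[OF induced.rep.rep_left_module])
      fix r :: "('k vir list \<Rightarrow>\<^sub>0 'k) set" and n :: 'k
      assume "r \<in> carrier (vir.uea vir_b_plus)"
      then obtain p where p: "p \<in> supported (lists vir_b_plus)" "r = one_dim.coset p"
        unfolding one_dim.uea_carrier by blast
      have "one_dim.run p n = n * one_dim.run p 1"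
        using one_dim.run_scale[OF p(1), of n 1] by simp
      then show "pscale (r \<odot>\<^bsub>one_dim_module \<kappa> \<mu>\<^esub> n) highest = \<iota> r \<odot>\<^bsub>induced.rep.M\<^esub> pscale n highest"
        using p by (simp add: one_dim_module_eq one_dim.coset_smult \<iota>_coset induced.rep.coset_smult
            induced.rep.run_scale run_highest)
    qed (use that in \<open>simp_all add: one_dim_module_eq ps.scale_left_distrib\<close>)
    then show ?thesis by simp
  qed
  have "X \<odot>\<^bsub>induced.rep.M\<^esub> y = 0" for y
  proof -
    obtain p where p: "induced.rep.run p highest = y" using induced.generator_cyclic unfolding highest_def by blast
    let ?Y = "induced.rep.coset p"
    have "(X \<otimes>\<^bsub>U\<^esub> ?Y) \<odot>\<^bsub>induced.rep.M\<^esub> highest = 0"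
      using X by (intro kernel) simp_all
    then show ?thesis using X(1) p by (simp add: M.smult_assoc induced.rep.coset_smult)
  qed
  then show "X \<in> annihilator U induced.rep.M" using X(1) by (simp add: annihilator_def)
qed

abbreviation \<gamma> where "\<gamma> \<equiv> (letter vir_c - const \<kappa> :: 'k vir list \<Rightarrow>\<^sub>0 'k)"

lemma c_central: "induced.rep.coset \<gamma> \<otimes>\<^bsub>U\<^esub> induced.rep.coset p = induced.rep.coset p \<otimes>\<^bsub>U\<^esub> induced.rep.coset \<gamma>"
proof -
  let ?I = "vir.uea_ideal (UNIV :: 'k vir set)"
  have I_add: "q + q' \<in> ?I" if "q \<in> ?I" "q' \<in> ?I" for q q'
    using induced.rep.relations.a_closed[OF that] by simp
  have I_left: "r * q \<in> ?I" and I_right: "q * r \<in> ?I" if "q \<in> ?I" for q r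
    using induced.rep.relations.I_l_closed[OF that, of r] induced.rep.relations.I_r_closed[OF that, of r] by simp_all
  have I_rel: "q \<in> ?I" if "q \<in> vir.uea_relations UNIV" for q
    unfolding vir.uea_ideal_def using induced.rep.free.genideal_self[OF induced.rep.relations_carrier] that by blast
  have zero: "0 \<in> ?I" using induced.rep.relations.zero_closed by simp
  have letter_0: "letter 0 \<in> ?I"
  proof -
    have "letter (vir_scale 0 0) - const 0 * letter 0 \<in> ?I"
      by (rule I_rel) (unfold vir.uea_relations_def, blast)
    then show ?thesis by simp
  qed
  \<comment> \<open>The map \<open>D\<close> is a derivation, so it suffices to see that it maps the letters into the ideal of relations.\<close>
  define D where "D q = \<gamma> * q - q * \<gamma>" for q
  have D: "D q = letter vir_c * q - q * letter vir_c" for q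
    by (simp add: D_def left_diff_distrib right_diff_distrib const_mult mult_const)
  have D_letter: "D (letter x) \<in> ?I" for x
  proof -
    have "vir_bracket vir_c x = 0"
      by (induction x rule: vir_induct) (simp_all add: vir_bracket_bilinear vir_bracket_basis)
    moreover have "letter vir_c * letter x - letter x * letter vir_c - letter (vir_bracket vir_c x) \<in> ?I"
      by (rule I_rel) (unfold vir.uea_relations_def, blast)
    ultimately show ?thesis using I_add[OF _ letter_0] unfolding D by fastforce
  qed
  have D_mult: "D (q * r) = D q * r + q * D r" for q r
    by (simp add: D_def algebra_simps)
  have D_word: "D (Poly_Mapping.single w a) \<in> ?I" for w a
  proof (induction w)
    case Nil
    show ?case by (simp add: D const_mult mult_const zero)
  next
    case (Cons x w)
    have "D (letter x * Poly_Mapping.single w a) \<in> ?I"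
      unfolding D_mult by (intro I_add I_left I_right D_letter Cons)
    then show ?case by (simp add: single_list_mult)
  qed
  have "p \<in> supported UNIV" by simp
  then have "D p \<in> ?I"
  proof (induction rule: lin_induct)
    case (add p q)
    have "D (p + q) = D p + D q" by (simp add: D_def algebra_simps)
    then show ?case using add I_add by simp
  qed (simp_all add: D_word, simp add: D_def zero)
  then have "induced.rep.coset (\<gamma> * p) = induced.rep.coset (D p + p * \<gamma>)"
    by (simp add: D_def)
  also have "\<dots> = induced.rep.coset (D p) \<oplus>\<^bsub>U\<^esub> induced.rep.coset (p * \<gamma>)"
    by (simp add: induced.rep.coset_add)
  also have "induced.rep.coset (D p) = \<zero>\<^bsub>U\<^esub>"
    using abelian_subgroup.a_rcos_const[OF induced.rep.relations.abelian_subgroup \<open>D p \<in> ?I\<close>]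
    by (simp add: vir.uea_def FactRing_def)
  finally show ?thesis by (simp add: induced.rep.coset_mult)
qed

text \<open>As \<open>c - \<kappa>\<close> is central, its left multiples already form a two-sided ideal.\<close>

lemma c_minus_ideal_subset:
  "c_minus_ideal \<kappa> \<subseteq> (\<lambda>Z. Z \<otimes>\<^bsub>U\<^esub> induced.rep.coset \<gamma>) ` carrier U" (is "_ \<subseteq> ?I")
  unfolding induced.c_minus_ideal_eq
proof (rule induced.rep.U.genideal_minimal)
  let ?g = "induced.rep.coset \<gamma>"
  have g: "?g \<in> carrier U" by simp
  have central: "?g \<otimes>\<^bsub>U\<^esub> Z = Z \<otimes>\<^bsub>U\<^esub> ?g" if "Z \<in> carrier U" for Z
    using that c_central by (auto simp: induced.rep.uea_carrier)
  show "ideal ?I U"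
  proof (rule idealI[OF induced.rep.U.ring_axioms])
    show "subgroup ?I (add_monoid U)"
    proof (rule induced.rep.U.add.subgroupI)
      show "\<ominus>\<^bsub>U\<^esub> X \<in> ?I" if "X \<in> ?I" for X
        using that g by (auto simp: induced.rep.U.l_minus[symmetric])
      fix X Y assume "X \<in> ?I" "Y \<in> ?I"
      then show "X \<oplus>\<^bsub>U\<^esub> Y \<in> ?I"
        using g by (auto simp: induced.rep.U.l_distr[symmetric])
    qed (use g in auto)
    fix X Y assume "X \<in> ?I" and Y: "Y \<in> carrier U"
    then obtain Z where Z: "Z \<in> carrier U" "X = Z \<otimes>\<^bsub>U\<^esub> ?g" by blast
    show "Y \<otimes>\<^bsub>U\<^esub> X \<in> ?I"
      using Z Y g by (auto simp: induced.rep.U.m_assoc[symmetric])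
    have "X \<otimes>\<^bsub>U\<^esub> Y = (Z \<otimes>\<^bsub>U\<^esub> Y) \<otimes>\<^bsub>U\<^esub> ?g"
      using Z Y g central[OF Y] by (simp add: induced.rep.U.m_assoc)
    then show "X \<otimes>\<^bsub>U\<^esub> Y \<in> ?I" using Z Y by blast
  qed
  have "?g = \<one>\<^bsub>U\<^esub> \<otimes>\<^bsub>U\<^esub> ?g" using g by simp
  then show "{?g} \<subseteq> ?I" by blast
qed

theorem verma_annihilator: "annihilator U (verma_module \<kappa> \<mu>) = c_minus_ideal \<kappa>"
proof
  show "annihilator U (verma_module \<kappa> \<mu>) \<subseteq> c_minus_ideal \<kappa>"
    using verma_annihilator_subset unfolding induced.annihilator_eq .
  show "c_minus_ideal \<kappa> \<subseteq> annihilator U (verma_module \<kappa> \<mu>)"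
  proof
    fix X assume "X \<in> c_minus_ideal \<kappa>"
    let ?g = "induced.rep.coset \<gamma>"
    have g: "?g \<in> carrier U" by simp
    obtain Z where Z: "Z \<in> carrier U" "X = Z \<otimes>\<^bsub>U\<^esub> ?g"
      using c_minus_ideal_subset \<open>X \<in> _\<close> by blast
    have "frag_of (X \<otimes>\<^bsub>U\<^esub> Y, n) \<in> K" if Y: "Y \<in> carrier U" for Y n
    proof -
      have "?g \<otimes>\<^bsub>U\<^esub> Y = Y \<otimes>\<^bsub>U\<^esub> ?g" using Y c_central by (auto simp: induced.rep.uea_carrier)
      then have XY: "X \<otimes>\<^bsub>U\<^esub> Y = (Z \<otimes>\<^bsub>U\<^esub> Y) \<otimes>\<^bsub>U\<^esub> \<iota> (one_dim.coset \<gamma>)"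
        using Z Y g by (simp add: induced.rep.U.m_assoc \<iota>_coset)
      have "vir_c \<in> (vir_b_plus :: 'k vir set)"
        by (auto simp: vir_b_plus_eq nonneg_basis_def intro: supported_single)
      then have \<gamma>: "\<gamma> \<in> supported (lists vir_b_plus)"
        by (intro supported_diff one_dim.letter_carrier one_dim.const_carrier)
      have "verma_weight \<kappa> \<mu> vir_c = \<kappa>" by (simp add: verma_weight_def lookup_single)
      then have "one_dim.coset \<gamma> \<odot>\<^bsub>one_dim_module \<kappa> \<mu>\<^esub> n = 0"
        using \<gamma> by (simp add: one_dim_module_eq one_dim.coset_smult one_dim.run_diff one_dim.run_single)
      moreover have "frag_of ((Z \<otimes>\<^bsub>U\<^esub> Y) \<otimes>\<^bsub>U\<^esub> \<iota> (one_dim.coset \<gamma>), n) -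
          frag_of (Z \<otimes>\<^bsub>U\<^esub> Y, one_dim.coset \<gamma> \<odot>\<^bsub>one_dim_module \<kappa> \<mu>\<^esub> n) \<in> K"
        using Z Y \<gamma> by (intro kernel_balanced) (simp_all add: one_dim_module_eq)
      moreover have "frag_of (Z \<otimes>\<^bsub>U\<^esub> Y, 0) \<in> K"
        using Z Y by (intro kernel_null) (simp_all add: one_dim_module_eq)
      ultimately show ?thesis unfolding XY using kernel_add by fastforce
    qed
    then show "X \<in> annihilator U (verma_module \<kappa> \<mu>)"
      using Z g unfolding verma_module_def annihilator_extend_scalars by simp
  qed
qed

end

theorem theorem1p4:
  fixes \<kappa> :: "'k::field_char_0"
  shows "(\<forall>\<mu>. annihilator U_vir (verma_module \<kappa> \<mu>) = c_minus_ideal \<kappa>) \<and>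
         primitive_ring (U_vir Quot c_minus_ideal \<kappa>)"
proof (intro conjI allI)
  show "annihilator U_vir (verma_module \<kappa> \<mu>) = c_minus_ideal \<kappa>" for \<mu>
    by (rule vir_verma.verma_annihilator)
  interpret vir_whittaker "\<lambda>i. if i = 2 then 1 else 0" \<kappa>
    by standard auto
  show "primitive_ring (U_vir Quot c_minus_ideal \<kappa>)"
    using primitive_quotient_by_annihilator[OF whittaker_simple] unfolding annihilator_eq .
qed

end
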